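(* Let $\lambda$ be an $(n|m)$-hook partition and let $\mathcal B$ be a Borel subalgebra of $\mathfrak{osp}(2m|2n)$. (1) Assume $\mathcal B$ is of $\curlyvee$-shape. Then (i) $\lambda^{\mathcal B}$ is the $\mathcal B$-extremal weight of $L'(\mathfrak{osp}(2m|2n),\lambda^\#)$; (ii) $\lambda^{\mathcal B}_-$ is the $\mathcal B$-extremal weight of $L'(\mathfrak{osp}(2m|2n),\lambda^\#_-)$. (2) Assume $\mathcal B$ is of $|$-shape. Then (i) $\lambda^{\mathcal B}$ is the $\mathcal B$-extremal weight of $L'(\mathfrak{osp}(2m|2n),\lambda^\#)$ if $\mathrm s(\mathcal B)=+$; (ii) $\lambda^{\mathcal B}$ is the $\mathcal B$-extremal weight of $L'(\mathfrak{osp}(2m|2n),\lambda^\#_-)$ if $\mathrm s(\mathcal B)=-$.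
   Context: Let $m,n\ge1$. The weights of the natural $\mathfrak{osp}(2m|2n)$-module $\mathbb C^{2n|2m}$ are denoted $\pm\delta_i,\pm\bar\epsilon_j$ ($1\le i\le n$, $1\le j\le m$), where $\pm\delta_i$ belong to the $2n$-dimensional symplectic part and $\pm\bar\epsilon_j$ to the $2m$-dimensional orthogonal part. Borel subalgebras contain the fixed standard Cartan subalgebra; the $\mathcal B$-extremal weight of an irreducible finite dimensional module is its highest weight with respect to $\mathcal B$. The standard Borel $\mathcal B^{\mathrm{st}}$ has simple roots $\delta_1-\delta_2,\dots,\delta_{n-1}-\delta_n,\ \delta_n-\bar\epsilon_1,\ \bar\epsilon_1-\bar\epsilon_2,\dots,\bar\epsilon_{m-1}-\bar\epsilon_m,\ \bar\epsilon_{m-1}+\bar\epsilon_m$ (for $m=1$ the last two nodes are $\delta_n\mp\bar\epsilon_1$). A partition $\lambda$ is an $(n|m)$-hook partition if $\lambda_{n+1}\le m$. Then $\lambda^\#=\sum_{i=1}^n\lambda_i\delta_i+\sum_{j=1}^m\nu_j\bar\epsilon_j$, where $(\nu_1,\dots,\nu_m)$ is the conjugate partition of $(\lambda_{n+1},\lambda_{n+2},\dots)$, and $\lambda^\#_-=\sum_{i=1}^n\lambda_i\delta_i+\sum_{j=1}^{m-1}\nu_j\bar\epsilon_j-\nu_m\bar\epsilon_m$. $L'(\mathfrak{osp}(2m|2n),\lambda^\#)$ and $L'(\mathfrak{osp}(2m|2n),\lambda^\#_-)$ are the irreducible modules with these highest weights with respect to $\mathcal B^{\mathrm{st}}$ (they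 are finite dimensional). An arbitrary Borel subalgebra $\mathcal B$ is encoded by a sequence $f_1,\dots,f_{m+n}$ whose entries are, in some interleaved order, $\xi_1\delta_{s(1)},\dots,\xi_n\delta_{s(n)}$ (in this relative order) and $\eta_1\bar\epsilon_{t(1)},\dots,\eta_m\bar\epsilon_{t(m)}$ (in this relative order), with permutations $s$ of $\{1,\dots,n\}$, $t$ of $\{1,\dots,m\}$ and signs $\xi_i,\eta_j\in\{\pm1\}$. If $f_{m+n}=\xi_n\delta_{s(n)}$, the simple roots are $f_k-f_{k+1}$ ($1\le k<m+n$) and $2f_{m+n}$; then $\mathcal B$ is of $|$-shape (there is a long simple root), and $\mathrm s(\mathcal B)$ is the sign of $\prod_{j=1}^m\eta_j$. If $f_{m+n}=\eta_m\bar\epsilon_{t(m)}$, the simple roots are $f_k-f_{k+1}$ ($1\le k<m+n$) and $f_{m+n-1}+f_{m+n}$; then $\mathcal B$ is of $\curlyvee$-shape (no long simple root $\pm2\delta_i$). In the $\curlyvee$-shape case $\eta_m$ is not determined by $\mathcal B$, and it is fixed by requiring the number of negative signs among $\eta_1,\dots,\eta_m$ to be even. Block Frobenius coordinates $(p_i|q_j)$ of $\lambda$ associated to $\mathcal B$: $p_i=\max\{\lambda_i-e,0\}$ with $e$ the number of $\bar\epsilon$-entries preceding the $i$-th $\delta$-entry; $q_j=\max\{\lambda'_j-d,0\}$ with $d$ the number of $\delta$-entries preceding the $j$-th $\bar\epsilon$-entry ($\lambda'$ the conjugate partition). Put $\lambda^{\mathcal B}=\sum_{i=1}^n\xi_ip_i\delta_{s(i)}+\sum_{j=1}^m\eta_jq_j\bar\epsilon_{t(j)}$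 and $\lambda^{\mathcal B}_-=\sum_{i=1}^n\xi_ip_i\delta_{s(i)}+\sum_{j=1}^{m-1}\eta_jq_j\bar\epsilon_{t(j)}-\eta_mq_m\bar\epsilon_{t(m)}$. *)

theory Defs
  imports Complex_Main "HOL-Library.Function_Algebras" "Jordan_Normal_Form.Matrix"
begin

section \<open>The Lie superalgebra osp(2m|2n)\<close>

text \<open>
  The natural module has the basis \<open>e\<^sub>0, \<dots>, e\<^bsub>2n+2m-1\<^esub>\<close>; its weights are, in this order,
  \<open>\<delta>\<^sub>1..\<delta>\<^sub>n, -\<delta>\<^sub>1..-\<delta>\<^sub>n, \<epsilon>\<^sub>1..\<epsilon>\<^sub>m, -\<epsilon>\<^sub>1..-\<epsilon>\<^sub>m\<close>.
  Parities are Booleans, \<open>True\<close> being odd.  The symplectic part is taken to be odd, so that the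
  invariant form is supersymmetric; the opposite choice of parity gives the form on the
  parity-shifted module and an isomorphic superalgebra with the same Cartan subalgebra.
\<close>

definition gdim :: "nat \<Rightarrow> nat \<Rightarrow> nat" where
  "gdim m n = 2 * n + 2 * m"

definition form_mat :: "nat \<Rightarrow> nat \<Rightarrow> complex mat" where
  "form_mat m n = four_block_mat
     (four_block_mat (0\<^sub>m n n) (1\<^sub>m n) (- 1\<^sub>m n) (0\<^sub>m n n)) (0\<^sub>m (2 * n) (2 * m))
     (0\<^sub>m (2 * m) (2 * n)) (four_block_mat (0\<^sub>m m m) (1\<^sub>m m) (1\<^sub>m m) (0\<^sub>m m m))"

definition parity_mat :: "nat \<Rightarrow> nat \<Rightarrow> complex mat" where
  "parity_mat m n = four_block_mat
     (- 1\<^sub>m (2 * n)) (0\<^sub>m (2 * n) (2 * m)) (0\<^sub>m (2 * m) (2 * n)) (1\<^sub>m (2 * m))"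

definition has_parity :: "nat \<Rightarrow> nat \<Rightarrow> bool \<Rightarrow> complex mat \<Rightarrow> bool" where
  "has_parity m n a A \<longleftrightarrow> A \<in> carrier_mat (gdim m n) (gdim m n) \<and>
     (\<forall>i<gdim m n. \<forall>j<gdim m n. A $$ (i, j) \<noteq> 0 \<longrightarrow> ((i < 2 * n) \<noteq> (j < 2 * n)) = a)"

text \<open>
  The homogeneous components of osp(2m|2n): the matrix form of
  \<open>(A v, w) + (-1)\<^sup>|\<^sup>A\<^sup>|\<^sup>|\<^sup>v\<^sup>| (v, A w) = 0\<close>.
\<close>

definition osp_hom :: "nat \<Rightarrow> nat \<Rightarrow> bool \<Rightarrow> complex mat set" where
  "osp_hom m n a = {A. has_parity m n a A \<and>
     transpose_mat A * form_mat m n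
       + (if a then parity_mat m n * form_mat m n * A else form_mat m n * A)
     = 0\<^sub>m (gdim m n) (gdim m n)}"

definition osp :: "nat \<Rightarrow> nat \<Rightarrow> complex mat set" where
  "osp m n = {A + C | A C. A \<in> osp_hom m n False \<and> C \<in> osp_hom m n True}"

definition super_bracket :: "bool \<Rightarrow> bool \<Rightarrow> complex mat \<Rightarrow> complex mat \<Rightarrow> complex mat" where
  "super_bracket a b A C = A * C - (if a \<and> b then - 1 else 1) \<cdot>\<^sub>m (C * A)"

definition cartan :: "nat \<Rightarrow> nat \<Rightarrow> complex mat set" where
  "cartan m n = {H \<in> osp m n. diagonal_mat H}"


section \<open>Weights, roots, Borel subalgebras\<close>

text \<open>
  Only integral weights occur.  The weight \<open>\<Sum>\<^sub>i a\<^sub>i \<delta>\<^sub>i + \<Sum>\<^sub>j b\<^sub>j \<epsilon>\<^sub>j\<close> is the function with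
  \<open>Del i \<mapsto> a\<^sub>i\<close> and \<open>Eps j \<mapsto> b\<^sub>j\<close>; indices start at 1.
\<close>

datatype coord = is_Del: Del nat | is_Eps: Eps nat

type_synonym weight = "coord \<Rightarrow> int"

definition coords :: "nat \<Rightarrow> nat \<Rightarrow> coord set" where
  "coords m n = Del ` {1..n} \<union> Eps ` {1..m}"

definition wscale :: "int \<Rightarrow> weight \<Rightarrow> weight" where
  "wscale k \<mu> = (\<lambda>c. k * \<mu> c)"

definition basis_wt :: "coord \<Rightarrow> weight" where
  "basis_wt c = (\<lambda>d. if d = c then 1 else 0)"

definition wt_eval :: "nat \<Rightarrow> nat \<Rightarrow> weight \<Rightarrow> complex mat \<Rightarrow> complex" where
  "wt_eval m n \<mu> H =
     (\<Sum>i=1..n. of_int (\<mu> (Del i)) * H $$ (i - 1, i - 1))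
   + (\<Sum>j=1..m. of_int (\<mu> (Eps j)) * H $$ (2 * n + j - 1, 2 * n + j - 1))"

definition root_space :: "nat \<Rightarrow> nat \<Rightarrow> weight \<Rightarrow> complex mat set" where
  "root_space m n \<alpha> = {A \<in> osp m n. \<forall>H \<in> cartan m n. H * A - A * H = wt_eval m n \<alpha> H \<cdot>\<^sub>m A}"

definition roots :: "nat \<Rightarrow> nat \<Rightarrow> weight set" where
  "roots m n = {\<alpha>. (\<forall>c. \<alpha> c \<noteq> 0 \<longrightarrow> c \<in> coords m n) \<and> \<alpha> \<noteq> 0 \<and>
     (\<exists>A \<in> root_space m n \<alpha>. A \<noteq> 0\<^sub>m (gdim m n) (gdim m n))}"

definition mat_subspace :: "nat \<Rightarrow> complex mat set \<Rightarrow> bool" where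
  "mat_subspace N W \<longleftrightarrow> W \<subseteq> carrier_mat N N \<and> 0\<^sub>m N N \<in> W \<and>
     (\<forall>A \<in> W. \<forall>C \<in> W. A + C \<in> W) \<and> (\<forall>k. \<forall>A \<in> W. k \<cdot>\<^sub>m A \<in> W)"

text \<open>The span of the Cartan subalgebra and the root spaces of the roots in \<open>P\<close>.\<close>

definition cartan_plus :: "nat \<Rightarrow> nat \<Rightarrow> weight set \<Rightarrow> complex mat set" where
  "cartan_plus m n P =
     mat_subspace (gdim m n) hull (cartan m n \<union> (\<Union>\<alpha> \<in> P. root_space m n \<alpha>))"

text \<open>
  Borel subalgebras containing the Cartan subalgebra, which is the only kind considered:
  the positive systems are cut out by the real linear functionals \<open>\<phi>\<close> vanishing on no root.
\<close>

definition real_eval :: "nat \<Rightarrow> nat \<Rightarrow> (coord \<Rightarrow> real) \<Rightarrow> weight \<Rightarrow> real" where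
  "real_eval m n \<phi> \<alpha> = (\<Sum>c \<in> coords m n. \<phi> c * of_int (\<alpha> c))"

definition borel_subalgebra :: "nat \<Rightarrow> nat \<Rightarrow> complex mat set \<Rightarrow> bool" where
  "borel_subalgebra m n B \<longleftrightarrow> (\<exists>\<phi>. (\<forall>\<alpha> \<in> roots m n. real_eval m n \<phi> \<alpha> \<noteq> 0) \<and>
     B = cartan_plus m n {\<alpha> \<in> roots m n. real_eval m n \<phi> \<alpha> > 0})"

definition pos_roots :: "nat \<Rightarrow> nat \<Rightarrow> complex mat set \<Rightarrow> weight set" where
  "pos_roots m n B = {\<alpha> \<in> roots m n. root_space m n \<alpha> \<subseteq> B}"

definition simple_roots :: "nat \<Rightarrow> nat \<Rightarrow> complex mat set \<Rightarrow> weight set" where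
  "simple_roots m n B =
     {\<alpha> \<in> pos_roots m n B. \<not> (\<exists>\<beta> \<in> pos_roots m n B. \<exists>\<gamma> \<in> pos_roots m n B. \<alpha> = \<beta> + \<gamma>)}"

definition long_roots :: "nat \<Rightarrow> weight set" where
  "long_roots n = {wscale k (basis_wt (Del i)) | k i. k \<in> {2, -2} \<and> i \<in> {1..n}}"

definition bar_shape :: "nat \<Rightarrow> nat \<Rightarrow> complex mat set \<Rightarrow> bool" where
  "bar_shape m n B \<longleftrightarrow> simple_roots m n B \<inter> long_roots n \<noteq> {}"

definition vee_shape :: "nat \<Rightarrow> nat \<Rightarrow> complex mat set \<Rightarrow> bool" where
  "vee_shape m n B \<longleftrightarrow> simple_roots m n B \<inter> long_roots n = {}"


section \<open>Encoding Borel subalgebras by sequences\<close>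

text \<open>The entry \<open>(\<xi>, c)\<close> of a sequence stands for the weight \<open>\<xi> c\<close>, where \<open>\<xi> = \<plusminus>1\<close>.\<close>

type_synonym entry = "int \<times> coord"

definition entry_wt :: "entry \<Rightarrow> weight" where
  "entry_wt x = wscale (fst x) (basis_wt (snd x))"

definition seq_simple :: "entry list \<Rightarrow> weight set" where
  "seq_simple f =
     {entry_wt (f ! k) - entry_wt (f ! Suc k) | k. Suc k < length f} \<union>
     (if is_Del (snd (last f)) then {wscale 2 (entry_wt (last f))}
      else {entry_wt (f ! (length f - 2)) + entry_wt (f ! (length f - 1))})"

definition admissible_seq :: "nat \<Rightarrow> nat \<Rightarrow> entry list \<Rightarrow> bool" where
  "admissible_seq m n f \<longleftrightarrow> distinct (map snd f) \<and> snd ` set f = coords m n \<and>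
     fst ` set f \<subseteq> {1, -1} \<and>
     (is_Eps (snd (last f)) \<longrightarrow> even (card {k. k < length f \<and> is_Eps (snd (f ! k)) \<and> fst (f ! k) = -1}))"

definition encodes :: "nat \<Rightarrow> nat \<Rightarrow> entry list \<Rightarrow> complex mat set \<Rightarrow> bool" where
  "encodes m n f B \<longleftrightarrow> admissible_seq m n f \<and> simple_roots m n B = seq_simple f"

definition std_seq :: "nat \<Rightarrow> nat \<Rightarrow> entry list" where
  "std_seq m n = map (\<lambda>i. (1, Del i)) [1..<Suc n] @ map (\<lambda>j. (1, Eps j)) [1..<Suc m]"

definition nonneg_comb :: "weight set \<Rightarrow> weight set" where
  "nonneg_comb S = {\<Sum>\<beta>\<in>S. wscale (int (k \<beta>)) \<beta> | k :: weight \<Rightarrow> nat. True}"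

definition std_borel :: "nat \<Rightarrow> nat \<Rightarrow> complex mat set" where
  "std_borel m n = cartan_plus m n (roots m n \<inter> nonneg_comb (seq_simple (std_seq m n)))"


section \<open>Modules\<close>

locale osp_module = vector_space sc
  for m n :: nat
  and sc :: "complex \<Rightarrow> 'v::ab_group_add \<Rightarrow> 'v"
  and gr :: "bool \<Rightarrow> 'v set"
  and act :: "complex mat \<Rightarrow> 'v \<Rightarrow> 'v" +
  assumes gr_subspace: "subspace (gr a)"
    and gr_disjoint: "gr False \<inter> gr True = {0}"
    and gr_span: "\<exists>u \<in> gr False. \<exists>w \<in> gr True. v = u + w"
    and act_linear: "A \<in> osp m n \<Longrightarrow> Vector_Spaces.linear sc sc (act A)"
    and act_add: "A \<in> osp m n \<Longrightarrow> C \<in> osp m n \<Longrightarrow> act (A + C) v = act A v + act C v"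
    and act_smult: "A \<in> osp m n \<Longrightarrow> act (k \<cdot>\<^sub>m A) v = sc k (act A v)"
    and act_parity: "A \<in> osp_hom m n a \<Longrightarrow> v \<in> gr b \<Longrightarrow> act A v \<in> gr (a \<noteq> b)"
    and act_bracket: "A \<in> osp_hom m n a \<Longrightarrow> C \<in> osp_hom m n b \<Longrightarrow>
      act (super_bracket a b A C) v =
        act A (act C v) - sc (if a \<and> b then - 1 else 1) (act C (act A v))"

definition osp_submodule ::
  "nat \<Rightarrow> nat \<Rightarrow> (complex \<Rightarrow> 'v::ab_group_add \<Rightarrow> 'v) \<Rightarrow> (bool \<Rightarrow> 'v set) \<Rightarrow>
   (complex mat \<Rightarrow> 'v \<Rightarrow> 'v) \<Rightarrow> 'v set \<Rightarrow> bool" where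
  "osp_submodule m n sc gr act W \<longleftrightarrow> module.subspace sc W \<and>
     (\<forall>v \<in> W. \<exists>u \<in> W \<inter> gr False. \<exists>w \<in> W \<inter> gr True. v = u + w) \<and>
     (\<forall>A \<in> osp m n. \<forall>v \<in> W. act A v \<in> W)"

definition osp_irreducible ::
  "nat \<Rightarrow> nat \<Rightarrow> (complex \<Rightarrow> 'v::ab_group_add \<Rightarrow> 'v) \<Rightarrow> (bool \<Rightarrow> 'v set) \<Rightarrow>
   (complex mat \<Rightarrow> 'v \<Rightarrow> 'v) \<Rightarrow> bool" where
  "osp_irreducible m n sc gr act \<longleftrightarrow> (\<exists>v :: 'v. v \<noteq> 0) \<and>
     (\<forall>W. osp_submodule m n sc gr act W \<longrightarrow> W = {0} \<or> W = UNIV)"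

definition highest_weight ::
  "nat \<Rightarrow> nat \<Rightarrow> (complex \<Rightarrow> 'v::ab_group_add \<Rightarrow> 'v) \<Rightarrow> (bool \<Rightarrow> 'v set) \<Rightarrow>
   (complex mat \<Rightarrow> 'v \<Rightarrow> 'v) \<Rightarrow> complex mat set \<Rightarrow> weight \<Rightarrow> bool" where
  "highest_weight m n sc gr act B \<mu> \<longleftrightarrow>
     (\<exists>v. v \<noteq> 0 \<and> (\<exists>a. v \<in> gr a) \<and>
        (\<forall>H \<in> cartan m n. act H v = sc (wt_eval m n \<mu> H) v) \<and>
        (\<forall>\<alpha> \<in> pos_roots m n B. \<forall>A \<in> root_space m n \<alpha>. act A v = 0) \<and>
        (\<forall>W. osp_submodule m n sc gr act W \<and> v \<in> W \<longrightarrow> W = UNIV))"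

text \<open>
  The module \<open>(sc, gr, act)\<close> is a copy of the irreducible module \<open>L'(osp(2m|2n), \<mu>)\<close>, which is
  unique up to isomorphism and parity shift.
\<close>

definition is_L ::
  "nat \<Rightarrow> nat \<Rightarrow> (complex \<Rightarrow> 'v::ab_group_add \<Rightarrow> 'v) \<Rightarrow> (bool \<Rightarrow> 'v set) \<Rightarrow>
   (complex mat \<Rightarrow> 'v \<Rightarrow> 'v) \<Rightarrow> weight \<Rightarrow> bool" where
  "is_L m n sc gr act \<mu> \<longleftrightarrow> osp_module m n sc gr act \<and> osp_irreducible m n sc gr act \<and>
     highest_weight m n sc gr act (std_borel m n) \<mu>"


section \<open>Hook partitions and block Frobenius coordinates\<close>

text \<open>The parts of a partition are \<open>\<lambda> 1 \<ge> \<lambda> 2 \<ge> \<dots>\<close>; the value \<open>\<lambda> 0\<close> is never used.\<close>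

definition is_partition :: "(nat \<Rightarrow> nat) \<Rightarrow> bool" where
  "is_partition lam \<longleftrightarrow> (\<forall>i\<ge>1. lam (Suc i) \<le> lam i) \<and> (\<exists>N. \<forall>i>N. lam i = 0)"

definition conjugate :: "(nat \<Rightarrow> nat) \<Rightarrow> nat \<Rightarrow> nat" where
  "conjugate lam j = card {i. 1 \<le> i \<and> j \<le> lam i}"

definition hook_partition :: "nat \<Rightarrow> nat \<Rightarrow> (nat \<Rightarrow> nat) \<Rightarrow> bool" where
  "hook_partition n m lam \<longleftrightarrow> is_partition lam \<and> lam (n + 1) \<le> m"

definition hook_nu :: "nat \<Rightarrow> (nat \<Rightarrow> nat) \<Rightarrow> nat \<Rightarrow> nat" where
  "hook_nu n lam = conjugate (\<lambda>i. lam (n + i))"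

definition lam_sharp :: "nat \<Rightarrow> nat \<Rightarrow> (nat \<Rightarrow> nat) \<Rightarrow> weight" where
  "lam_sharp m n lam =
     (\<Sum>i=1..n. wscale (int (lam i)) (basis_wt (Del i)))
   + (\<Sum>j=1..m. wscale (int (hook_nu n lam j)) (basis_wt (Eps j)))"

definition lam_sharp_minus :: "nat \<Rightarrow> nat \<Rightarrow> (nat \<Rightarrow> nat) \<Rightarrow> weight" where
  "lam_sharp_minus m n lam =
     (\<Sum>i=1..n. wscale (int (lam i)) (basis_wt (Del i)))
   + (\<Sum>j=1..m-1. wscale (int (hook_nu n lam j)) (basis_wt (Eps j)))
   - wscale (int (hook_nu n lam m)) (basis_wt (Eps m))"

text \<open>
  Positions (counted from 0) of the i-th \<open>\<delta>\<close>-entry and of the j-th \<open>\<epsilon>\<close>-entry (i and j counted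
  from 1).
\<close>

definition del_pos :: "entry list \<Rightarrow> nat \<Rightarrow> nat" where
  "del_pos f i = filter (\<lambda>k. is_Del (snd (f ! k))) [0..<length f] ! (i - 1)"

definition eps_pos :: "entry list \<Rightarrow> nat \<Rightarrow> nat" where
  "eps_pos f j = filter (\<lambda>k. is_Eps (snd (f ! k))) [0..<length f] ! (j - 1)"

text \<open>Truncated subtraction on \<open>nat\<close> is \<open>max {_ - _, 0}\<close>.\<close>

definition frob_p :: "(nat \<Rightarrow> nat) \<Rightarrow> entry list \<Rightarrow> nat \<Rightarrow> nat" where
  "frob_p lam f i = lam i - card {k. k < del_pos f i \<and> is_Eps (snd (f ! k))}"

definition frob_q :: "(nat \<Rightarrow> nat) \<Rightarrow> entry list \<Rightarrow> nat \<Rightarrow> nat" where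
  "frob_q lam f j = conjugate lam j - card {k. k < eps_pos f j \<and> is_Del (snd (f ! k))}"

text \<open>The i-th \<open>\<delta>\<close>-entry is \<open>\<xi>\<^sub>i \<delta>\<^bsub>s(i)\<^esub>\<close>, the j-th \<open>\<epsilon>\<close>-entry is \<open>\<eta>\<^sub>j \<epsilon>\<^bsub>t(j)\<^esub>\<close>.\<close>

definition lam_borel :: "nat \<Rightarrow> nat \<Rightarrow> (nat \<Rightarrow> nat) \<Rightarrow> entry list \<Rightarrow> weight" where
  "lam_borel m n lam f =
     (\<Sum>i=1..n. wscale (int (frob_p lam f i)) (entry_wt (f ! del_pos f i)))
   + (\<Sum>j=1..m. wscale (int (frob_q lam f j)) (entry_wt (f ! eps_pos f j)))"

definition lam_borel_minus :: "nat \<Rightarrow> nat \<Rightarrow> (nat \<Rightarrow> nat) \<Rightarrow> entry list \<Rightarrow> weight" where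
  "lam_borel_minus m n lam f =
     (\<Sum>i=1..n. wscale (int (frob_p lam f i)) (entry_wt (f ! del_pos f i)))
   + (\<Sum>j=1..m-1. wscale (int (frob_q lam f j)) (entry_wt (f ! eps_pos f j)))
   - wscale (int (frob_q lam f m)) (entry_wt (f ! eps_pos f m))"

definition seq_sign :: "nat \<Rightarrow> entry list \<Rightarrow> int" where
  "seq_sign m f = (\<Prod>j=1..m. fst (f ! eps_pos f j))"

end

theory Submission
  imports Defs
begin

text \<open>
  Order the basis indices of the natural module by the sequence \<open>f\<close>; call a vector singular if it is
  killed by the root vectors that are positive for this order. Passing to a neighbouring sequence is
  a reflection in a simple root, even (\<open>\<delta>\<^sub>i \<plusminus> \<delta>\<^sub>j\<close>, \<open>\<epsilon>\<^sub>i \<plusminus> \<epsilon>\<^sub>j\<close>, \<open>2\<delta>\<^sub>i\<close>) or odd. If \<open>v\<close> is singular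
  and \<open>F\<close> lowers by that root, then \<open>F\<^sup>K v\<close> is singular for the reflected order, where \<open>K\<close> is the
  eigenvalue of \<open>v\<close> under the coroot for an even root, and 1 or 0 for an odd root according to whether
  the weight of \<open>v\<close> pairs nontrivially with it or not; \<open>F\<^bsup>K+1\<^esup> v\<close> vanishes because it would be a
  singular vector that generates a proper submodule.
  The block Frobenius weight follows the same rule: for an odd reflection the point is that
  \<open>e < \<lambda>\<^bsub>d+1\<^esub>\<close> iff \<open>d < \<lambda>'\<^bsub>e+1\<^esub>\<close>. The moves preserve the parity of the number of negative
  \<open>\<epsilon>\<close>-entries, and connect all sequences with the same parity; \<open>\<lambda>\<^sup>#\<close> belongs to the standard
  sequence and \<open>\<lambda>\<^sup>#\<^sub>-\<close> to the standard sequence with the sign of its last entry changed.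
\<close>

section \<open>Root vectors\<close>

text \<open>Roots are handled through pairs of basis indices: the root
  \<open>index_wt i - index_wt j\<close> belongs to (i, j) and also to the mirror pair
  (\<open>opp j\<close>, \<open>opp i\<close>), so facts about one pair always come with a mirror
  image. An order is an integer rank \<open>r\<close> with \<open>r (opp i) = - r i\<close>. The
  same function yields a Cartan element \<open>diag_of r\<close>, whose eigenvalues measure how far
  a vector has been lowered; they turn irreducibility into an inequality, because a singular vector
  generates only vectors with eigenvalues up to its own. That K is a natural number for even roots
  is read off from the explicit weight: the parts of \<lambda> and of its conjugate decrease. The
  obstacle is the fork at a sequence ending in \<epsilon>. The reflection in the sum of the last two
  entries is not a swap of neighbours. It is reached by changing the sign of the last entry, which
  is harmless because twice an \<epsilon> is not a root. The same ambiguity of the last sign lets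
  one sequence serve both signed versions of the weight.\<close>

locale osp_indices =
  fixes m n :: nat
begin

text \<open>
  The basis vector with index \<open>i\<close> has weight \<open>index_sign i \<cdot> index_coord i\<close>; the weight of
  index \<open>opp i\<close> is the opposite one.
\<close>

definition opp :: "nat \<Rightarrow> nat" where
  "opp i = (if i < n then i + n else if i < 2 * n then i - n
     else if i < 2 * n + m then i + m else i - m)"

definition index_coord :: "nat \<Rightarrow> coord" where
  "index_coord i = (if i < n then Del (i + 1) else if i < 2 * n then Del (i - n + 1)
     else if i < 2 * n + m then Eps (i - 2 * n + 1) else Eps (i - 2 * n - m + 1))"

definition index_sign :: "nat \<Rightarrow> int" where
  "index_sign i = (if i < n \<or> (2 * n \<le> i \<and> i < 2 * n + m) then 1 else - 1)"

text \<open>Used in two roles: for the weight of a vector it is the eigenvalue of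
  \<open>root_vec i i\<close>, and for \<open>rho f\<close> it is the rank of the index in the order
  given by \<open>f\<close>.\<close>

definition index_eval :: "weight \<Rightarrow> nat \<Rightarrow> int" where
  "index_eval \<mu> i = index_sign i * \<mu> (index_coord i)"

definition index_wt :: "nat \<Rightarrow> weight" where
  "index_wt i = wscale (index_sign i) (basis_wt (index_coord i))"

text \<open>The sign for which osp consists of the matrices with \<open>A\<^bsub>ij\<^esub> = - theta i j * A\<^bsub>opp j, opp i\<^esub>\<close>.\<close>

definition theta :: "nat \<Rightarrow> nat \<Rightarrow> complex" where
  "theta i j = (if i < 2 * n then if j < 2 * n then of_int (index_sign i * index_sign j) else of_int (index_sign i)
     else if j < 2 * n then - of_int (index_sign j) else 1)"

text \<open>The pairs for which \<open>index_wt i - index_wt j\<close> is a root: \<open>\<plusminus>2\<epsilon>\<close> is excluded.\<close>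

definition root_pair :: "nat \<Rightarrow> nat \<Rightarrow> bool" where
  "root_pair i j \<longleftrightarrow> i < gdim m n \<and> j < gdim m n \<and> i \<noteq> j \<and> (j = opp i \<longrightarrow> i < 2 * n)"

text \<open>\<open>root_vec i j\<close> is \<open>2E\<^bsub>ij\<^esub>\<close> for \<open>j = opp i\<close> in the symplectic part, and 0 in the orthogonal part.\<close>

definition root_vec :: "nat \<Rightarrow> nat \<Rightarrow> complex mat" where
  "root_vec i j = mat (gdim m n) (gdim m n) (\<lambda>(p, q).
     (if p = i \<and> q = j then 1 else 0) - (if p = opp j \<and> q = opp i then theta i j else 0))"

lemma opp_less [simp]: "i < gdim m n \<Longrightarrow> opp i < gdim m n"
  by (auto simp: opp_def gdim_def)

lemma opp_opp [simp]: "i < gdim m n \<Longrightarrow> opp (opp i) = i"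
  by (auto simp: opp_def gdim_def)

lemma opp_neq [simp]: "i < gdim m n \<Longrightarrow> opp i \<noteq> i"
  by (auto simp: opp_def gdim_def)

lemma opp_neq' [simp]: "i < gdim m n \<Longrightarrow> i \<noteq> opp i"
  by (metis opp_neq)

lemma opp_parity [simp]: "i < gdim m n \<Longrightarrow> opp i < 2 * n \<longleftrightarrow> i < 2 * n"
  by (auto simp: opp_def gdim_def)

lemma index_sign_opp [simp]: "i < gdim m n \<Longrightarrow> index_sign (opp i) = - index_sign i"
  by (auto simp: opp_def gdim_def index_sign_def)

lemma index_coord_opp [simp]: "i < gdim m n \<Longrightarrow> index_coord (opp i) = index_coord i"
  by (auto simp: opp_def gdim_def index_coord_def)

lemma index_sign_cases: "index_sign i = 1 \<or> index_sign i = -1"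
  by (auto simp: index_sign_def)

lemma index_sign_sq [simp]: "index_sign i * index_sign i = 1"
  by (auto simp: index_sign_def)

lemma index_eval_opp [simp]: "i < gdim m n \<Longrightarrow> index_eval \<mu> (opp i) = - index_eval \<mu> i"
  by (simp add: index_eval_def)

lemma index_coord_eq_iff:
  assumes "i < gdim m n" "j < gdim m n"
  shows "index_coord i = index_coord j \<longleftrightarrow> j = i \<or> j = opp i"
  using assms by (auto simp: index_coord_def opp_def gdim_def split: if_splits)

lemma index_coord_index_sign_inj:
  assumes "i < gdim m n" "j < gdim m n" "index_coord i = index_coord j" "index_sign i = index_sign j"
  shows "i = j"
  using assms index_coord_eq_iff[of i j] index_sign_opp[of i] index_sign_cases[of i] by auto

lemma is_Del_index_coord: "i < gdim m n \<Longrightarrow> is_Del (index_coord i) \<longleftrightarrow> i < 2 * n"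
  by (auto simp: index_coord_def gdim_def)

lemma index_coord_in_coords: "i < gdim m n \<Longrightarrow> index_coord i \<in> coords m n"
  by (auto simp: index_coord_def gdim_def coords_def image_iff Bex_def)

lemma entry_index:
  assumes "c \<in> coords m n" "s = 1 \<or> s = -1"
  shows "\<exists>i<gdim m n. index_coord i = c \<and> index_sign i = s"
proof -
  have "\<exists>i<gdim m n. index_coord i = c \<and> index_sign i = 1"
    using assms(1)
  proof (cases c)
    case (Del k)
    then show ?thesis using assms(1)
      by (intro exI[of _ "k - 1"]) (auto simp: coords_def gdim_def index_coord_def index_sign_def)
  next
    case (Eps k)
    then show ?thesis using assms(1)
      by (intro exI[of _ "2 * n + k - 1"]) (auto simp: coords_def gdim_def index_coord_def index_sign_def)
  qed
  then obtain i where i: "i < gdim m n" "index_coord i = c" "index_sign i = 1" by blast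
  then show ?thesis using assms(2) by (metis index_coord_opp index_sign_opp opp_less)
qed

lemma index_eval_index_wt:
  assumes "i < gdim m n" "j < gdim m n"
  shows "index_eval (index_wt i) j = (if j = i then 1 else if j = opp i then -1 else 0)"
  using assms index_coord_eq_iff[of i j] index_coord_eq_iff[of j i]
  by (auto simp: index_eval_def index_wt_def wscale_def basis_wt_def)

lemma index_eval_add [simp]: "index_eval (\<mu> + \<nu>) i = index_eval \<mu> i + index_eval \<nu> i"
  by (simp add: index_eval_def algebra_simps)

lemma index_eval_diff [simp]: "index_eval (\<mu> - \<nu>) i = index_eval \<mu> i - index_eval \<nu> i"
  by (simp add: index_eval_def algebra_simps)

lemma theta_opp:
  assumes "i < gdim m n" "j < gdim m n"
  shows "theta (opp j) (opp i) = theta i j"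
  using assms by (auto simp: theta_def)

lemma theta_sq: "theta i j * theta i j = 1"
  using index_sign_cases[of i] index_sign_cases[of j] by (auto simp: theta_def)

lemma theta_mult_sym: "theta i j * theta j i = (if (i < 2 * n) = (j < 2 * n) then 1 else - 1)"
  using index_sign_cases[of i] index_sign_cases[of j] by (auto simp: theta_def)

lemma theta_self [simp]: "theta i i = 1"
  using index_sign_cases[of i] by (auto simp: theta_def)

lemma theta_self_opp: "i < gdim m n \<Longrightarrow> theta i (opp i) = (if i < 2 * n then - 1 else 1)"
  using index_sign_cases[of i] by (auto simp: theta_def)

section \<open>Entrywise description of the superalgebra\<close>

lemma four_block_mat_square_index:
  assumes "A \<in> carrier_mat p p" "B \<in> carrier_mat p p" "C \<in> carrier_mat p p" "D \<in> carrier_mat p p"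
    and "i < 2 * p" "j < 2 * p"
  shows "four_block_mat A B C D $$ (i, j) =
    (if i < p then if j < p then A $$ (i, j) else B $$ (i, j - p)
     else if j < p then C $$ (i - p, j) else D $$ (i - p, j - p))"
  using assms by auto

lemma form_mat_index:
  assumes "i < gdim m n" "j < gdim m n"
  shows "form_mat m n $$ (i, j) = (if j = opp i then (if i < 2 * n then of_int (index_sign i) else 1) else 0)"
proof -
  define J1 :: "complex mat" where "J1 = four_block_mat (0\<^sub>m n n) (1\<^sub>m n) (- 1\<^sub>m n) (0\<^sub>m n n)"
  define J2 :: "complex mat" where "J2 = four_block_mat (0\<^sub>m m m) (1\<^sub>m m) (1\<^sub>m m) (0\<^sub>m m m)"
  have c: "J1 \<in> carrier_mat (2 * n) (2 * n)" "J2 \<in> carrier_mat (2 * m) (2 * m)"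
    unfolding J1_def J2_def
    by (auto simp only: mult_2 four_block_carrier_mat zero_carrier_mat one_carrier_mat)
  have J1: "J1 $$ (i, j) = (if i < n then if j < n then 0 else if i = j - n then 1 else 0
      else if j < n then if i - n = j then - 1 else 0 else 0)" if "i < 2 * n" "j < 2 * n" for i j
    unfolding J1_def using that by (subst four_block_mat_square_index[where p = n]) simp_all
  have J2: "J2 $$ (i, j) = (if i < m then if j < m then 0 else if i = j - m then 1 else 0
      else if j < m then if i - m = j then 1 else 0 else 0)" if "i < 2 * m" "j < 2 * m" for i j
    unfolding J2_def using that by (subst four_block_mat_square_index[where p = m]) simp_all
  have *: "form_mat m n $$ (i, j) = (if i < 2 * n then if j < 2 * n then J1 $$ (i, j) else 0
      else if j < 2 * n then 0 else J2 $$ (i - 2 * n, j - 2 * n))"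
    using assms c unfolding form_mat_def J1_def[symmetric] J2_def[symmetric] gdim_def
    by (subst index_mat_four_block) auto
  consider "i < n" | "n \<le> i" "i < 2 * n" | "2 * n \<le> i" "i < 2 * n + m" | "2 * n + m \<le> i"
    by linarith
  then show ?thesis
  proof cases
    case 1
    then have "j = opp i \<longleftrightarrow> \<not> j < n \<and> i = j - n" by (auto simp: opp_def)
    then show ?thesis using 1 by (cases "j < 2 * n") (simp_all add: * J1 index_sign_def)
  next
    case 2
    then have "j = opp i \<longleftrightarrow> j < n \<and> i - n = j" by (auto simp: opp_def)
    then show ?thesis using 2 by (cases "j < 2 * n") (simp_all add: * J1 index_sign_def)
  next
    case 3
    then have "j = opp i \<longleftrightarrow> \<not> j - 2 * n < m \<and> i - 2 * n = j - 2 * n - m" by (auto simp: opp_def)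
    then show ?thesis using 3 assms J2[of "i - 2 * n" "j - 2 * n"]
      by (cases "j < 2 * n") (simp_all add: * gdim_def)
  next
    case 4
    then have "j = opp i \<longleftrightarrow> 2 * n \<le> j \<and> j - 2 * n < m \<and> i - 2 * n - m = j - 2 * n"
      using assms by (auto simp: opp_def gdim_def)
    then show ?thesis using 4 assms J2[of "i - 2 * n" "j - 2 * n"]
      by (cases "j < 2 * n") (simp_all add: * gdim_def)
  qed
qed

lemma parity_mat_index:
  assumes "i < gdim m n" "j < gdim m n"
  shows "parity_mat m n $$ (i, j) = (if j = i then (if i < 2 * n then - 1 else 1) else 0)"
  using assms by (auto simp: parity_mat_def gdim_def)

lemma form_mat_carrier: "form_mat m n \<in> carrier_mat (gdim m n) (gdim m n)"
  by (auto simp: form_mat_def gdim_def)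

lemma parity_mat_carrier: "parity_mat m n \<in> carrier_mat (gdim m n) (gdim m n)"
  by (auto simp: parity_mat_def gdim_def)

lemma mult_index:
  assumes "A \<in> carrier_mat N N" "C \<in> carrier_mat N N" "i < N" "j < N"
  shows "(A * C) $$ (i, j) = (\<Sum>k<N. A $$ (i, k) * C $$ (k, j))"
  using assms by (auto simp: scalar_prod_def atLeast0LessThan)

text \<open>Each row of the form matrix has a single nonzero entry, in column \<open>opp i\<close>,
  so the matrix identity splits into equations that relate one entry of \<open>A\<close> to its
  mirror image.\<close>

lemma osp_hom_iff:
  "A \<in> osp_hom m n a \<longleftrightarrow> has_parity m n a A \<and>
     (\<forall>i<gdim m n. \<forall>j<gdim m n. A $$ (i, j) = - theta i j * A $$ (opp j, opp i))"
proof (cases "has_parity m n a A")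
  case True
  let ?N = "gdim m n"
  let ?J = "form_mat m n"
  have A: "A \<in> carrier_mat ?N ?N" using True by (simp add: has_parity_def)
  have par: "A $$ (i, j) = 0" if "i < ?N" "j < ?N" "((i < 2 * n) \<noteq> (j < 2 * n)) \<noteq> a" for i j
    using True that by (auto simp: has_parity_def)
  let ?M = "transpose_mat A * ?J + (if a then parity_mat m n * ?J * A else ?J * A)"
  let ?s = "\<lambda>i. if i < 2 * n then complex_of_int (index_sign i) else 1"
  have J: "?J \<in> carrier_mat ?N ?N" by (rule form_mat_carrier)
  have P: "parity_mat m n \<in> carrier_mat ?N ?N" by (rule parity_mat_carrier)
  have JA: "(?J * A) $$ (i, j) = ?s i * A $$ (opp i, j)" if "i < ?N" "j < ?N" for i j
    using that by (simp add: mult_index[OF J A] form_mat_index if_distrib[of "\<lambda>x. x * _"]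
        sum.delta cong: if_cong)
  have AJ: "(transpose_mat A * ?J) $$ (i, j) = A $$ (opp j, i) * ?s (opp j)"
    if "i < ?N" "j < ?N" for i j
  proof -
    have "(transpose_mat A * ?J) $$ (i, j) = (\<Sum>k<?N. if k = opp j then A $$ (opp j, i) * ?s (opp j) else 0)"
      using that A J unfolding mult_index[OF transpose_carrier_mat[THEN iffD2, OF A] J that]
      by (intro sum.cong) (auto simp: form_mat_index)
    then show ?thesis using that by simp
  qed
  have PJA: "(parity_mat m n * ?J * A) $$ (i, j) = (if i < 2 * n then - 1 else 1) * ?s i * A $$ (opp i, j)"
    if "i < ?N" "j < ?N" for i j
  proof -
    have "parity_mat m n * ?J * A = parity_mat m n * (?J * A)"
      using P J A by (rule assoc_mult_mat)
    then show ?thesis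
      using that mult_index[OF P mult_carrier_mat[OF J A], of i j] JA
      by (simp add: parity_mat_index if_distrib[of "\<lambda>x. x * _"] cong: if_cong)
  qed
  have M: "?M $$ (i, j) = A $$ (opp j, i) * ?s (opp j) +
      (if a \<and> i < 2 * n then - 1 else 1) * ?s i * A $$ (opp i, j)"
    if "i < ?N" "j < ?N" for i j
    using that A J P AJ[OF that] JA[OF that] PJA[OF that] by auto
  \<comment> \<open>A sign \<open>w\<close> is its own inverse, so the equation can be solved for
    the entry \<open>y\<close>.\<close>
  have alg: "x * u + w * y = 0 \<longleftrightarrow> y = - (u * w) * x" if "w = 1 \<or> w = - 1" for x y u w :: complex
    using that by (elim disjE) (simp_all add: add_eq_0_iff mult.commute eq_commute[of y])
  have eq: "?M $$ (i, j) = 0 \<longleftrightarrow> A $$ (opp i, j) = - theta (opp i) j * A $$ (opp j, i)"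
    if "i < ?N" "j < ?N" for i j
  proof (cases "((i < 2 * n) \<noteq> (j < 2 * n)) \<noteq> a")
    case True
    then show ?thesis
      unfolding M[OF that] using that par[of "opp i" j] par[of "opp j" i] by auto
  next
    case False
    let ?u = "?s (opp j)" and ?w = "(if a \<and> i < 2 * n then - 1 else 1) * ?s i"
    have w: "?w = 1 \<or> ?w = - 1" using index_sign_cases[of i] by auto
    have "?u * ?w = theta (opp i) j"
      using that False index_sign_cases[of i] index_sign_cases[of j] by (auto simp: theta_def)
    then have "- theta (opp i) j * A $$ (opp j, i) = - (?u * ?w) * A $$ (opp j, i)"
      by (simp only:)
    then show ?thesis
      unfolding M[OF that] by (simp only: alg[OF w])
  qed
  have "?M = 0\<^sub>m ?N ?N \<longleftrightarrow> (\<forall>i<?N. \<forall>j<?N. ?M $$ (i, j) = 0)"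
    using A J P by (auto simp: mat_eq_iff)
  also have "\<dots> \<longleftrightarrow> (\<forall>i<?N. \<forall>j<?N. A $$ (opp i, j) = - theta (opp i) j * A $$ (opp j, i))"
    using eq by blast
  also have "\<dots> \<longleftrightarrow> (\<forall>i<?N. \<forall>j<?N. A $$ (i, j) = - theta i j * A $$ (opp j, opp i))"
    by (metis opp_less opp_opp)
  finally show ?thesis using True by (simp add: osp_hom_def)
qed (simp add: osp_hom_def)

lemma osp_homD:
  assumes "A \<in> osp_hom m n a"
  shows "A \<in> carrier_mat (gdim m n) (gdim m n)"
    and "i < gdim m n \<Longrightarrow> j < gdim m n \<Longrightarrow> A $$ (i, j) = - theta i j * A $$ (opp j, opp i)"
    and "i < gdim m n \<Longrightarrow> j < gdim m n \<Longrightarrow> A $$ (i, j) \<noteq> 0 \<Longrightarrow> ((i < 2 * n) \<noteq> (j < 2 * n)) = a"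
  using assms unfolding osp_hom_iff has_parity_def by blast+

lemma osp_homI:
  assumes "A \<in> carrier_mat (gdim m n) (gdim m n)"
    and "\<And>i j. i < gdim m n \<Longrightarrow> j < gdim m n \<Longrightarrow> A $$ (i, j) = - theta i j * A $$ (opp j, opp i)"
    and "\<And>i j. i < gdim m n \<Longrightarrow> j < gdim m n \<Longrightarrow> A $$ (i, j) \<noteq> 0 \<Longrightarrow> ((i < 2 * n) \<noteq> (j < 2 * n)) = a"
  shows "A \<in> osp_hom m n a"
  using assms unfolding osp_hom_iff has_parity_def by blast

lemma osp_hom_opp_zero_iff:
  assumes "A \<in> osp_hom m n a" "i < gdim m n" "j < gdim m n"
  shows "A $$ (opp j, opp i) = 0 \<longleftrightarrow> A $$ (i, j) = 0"
  using osp_homD(2)[OF assms] theta_sq[of i j] by auto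

text \<open>At (i, \<open>opp i\<close>) in the orthogonal part the osp relation makes the entry its
  own negative. This is why twice an \<epsilon> is not a root.\<close>

lemma osp_hom_root_pair:
  assumes "A \<in> osp_hom m n a" "i < gdim m n" "j < gdim m n" "A $$ (i, j) \<noteq> 0" "i \<noteq> j"
  shows "root_pair i j"
proof -
  have "i < 2 * n" if "j = opp i"
  proof (rule ccontr)
    assume "\<not> i < 2 * n"
    then have "A $$ (i, j) = - (A $$ (i, j))"
      using osp_homD(2)[OF assms(1-3)] theta_self_opp[OF assms(2)] assms that by simp
    then show False using assms(4) by simp
  qed
  then show ?thesis using assms by (auto simp: root_pair_def)
qed

lemma zero_osp_hom [simp]: "0\<^sub>m (gdim m n) (gdim m n) \<in> osp_hom m n a"
  by (rule osp_homI) auto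

lemma add_osp_hom:
  assumes "A \<in> osp_hom m n a" "C \<in> osp_hom m n a"
  shows "A + C \<in> osp_hom m n a"
proof (rule osp_homI)
  note c = osp_homD(1)[OF assms(1)] osp_homD(1)[OF assms(2)]
  show "A + C \<in> carrier_mat (gdim m n) (gdim m n)" using c by simp
  fix i j assume ij: "i < gdim m n" "j < gdim m n"
  show "(A + C) $$ (i, j) = - theta i j * (A + C) $$ (opp j, opp i)"
    using ij c osp_homD(2)[OF assms(1) ij] osp_homD(2)[OF assms(2) ij] by (simp add: algebra_simps)
  assume "(A + C) $$ (i, j) \<noteq> 0"
  then have "A $$ (i, j) \<noteq> 0 \<or> C $$ (i, j) \<noteq> 0" using ij c by auto
  then show "((i < 2 * n) \<noteq> (j < 2 * n)) = a"
    using osp_homD(3)[OF assms(1) ij] osp_homD(3)[OF assms(2) ij] by blast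
qed

lemma smult_osp_hom:
  assumes "A \<in> osp_hom m n a"
  shows "t \<cdot>\<^sub>m A \<in> osp_hom m n a"
proof (rule osp_homI)
  note c = osp_homD(1)[OF assms(1)]
  show "t \<cdot>\<^sub>m A \<in> carrier_mat (gdim m n) (gdim m n)" using c by simp
  fix i j assume ij: "i < gdim m n" "j < gdim m n"
  show "(t \<cdot>\<^sub>m A) $$ (i, j) = - theta i j * (t \<cdot>\<^sub>m A) $$ (opp j, opp i)"
    using ij c osp_homD(2)[OF assms(1) ij] by simp
  show "(t \<cdot>\<^sub>m A) $$ (i, j) \<noteq> 0 \<Longrightarrow> ((i < 2 * n) \<noteq> (j < 2 * n)) = a"
    using ij c osp_homD(3)[OF assms(1) ij] by auto
qed

lemma osp_hom_subset_osp: "A \<in> osp_hom m n a \<Longrightarrow> A \<in> osp m n"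
proof -
  assume A: "A \<in> osp_hom m n a"
  let ?Z = "0\<^sub>m (gdim m n) (gdim m n) :: complex mat"
  have Z: "A = A + ?Z" "A = ?Z + A"
    using osp_homD(1)[OF A] by simp_all
  show ?thesis
  proof (cases a)
    case True
    then have "A \<in> osp_hom m n True" using A by simp
    then show ?thesis
      unfolding osp_def mem_Collect_eq using Z(2) zero_osp_hom[of False] by (intro exI[of _ ?Z] exI[of _ A] conjI)
  next
    case False
    then have "A \<in> osp_hom m n False" using A by simp
    then show ?thesis
      unfolding osp_def mem_Collect_eq using Z(1) zero_osp_hom[of True] by (intro exI[of _ A] exI[of _ ?Z] conjI)
  qed
qed

text \<open>The sign is -1 exactly when both factors of a product through the middle index
  \<open>k\<close> are odd; this is the supersign, and it makes osp closed under the
  superbracket.\<close>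

lemma theta_triple:
  "theta i j * theta i k * theta k j =
     (if ((i < 2 * n) \<noteq> (k < 2 * n)) \<and> ((k < 2 * n) \<noteq> (j < 2 * n)) then - 1 else 1)"
  using index_sign_cases[of i] index_sign_cases[of j] index_sign_cases[of k] by (auto simp: theta_def)

lemma mult_right_cong0: "(x \<noteq> 0 \<Longrightarrow> t = s) \<Longrightarrow> t * x = s * (x :: complex)"
  by (cases "x = 0") auto

text \<open>Passing to mirror entries reverses products: after reindexing the sum by
  \<open>opp\<close>, a term of the product AC becomes a term of CA. The theta signs collected on
  the way combine to the supersign by \<open>theta_triple\<close>.\<close>

lemma bracket_osp_hom:
  assumes "A \<in> osp_hom m n a" "C \<in> osp_hom m n b"
  shows "super_bracket a b A C \<in> osp_hom m n (a \<noteq> b)"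
proof (rule osp_homI)
  let ?N = "gdim m n"
  let ?s = "if a \<and> b then - 1 else 1 :: complex"
  note c = osp_homD(1)[OF assms(1)] osp_homD(1)[OF assms(2)]
  show "super_bracket a b A C \<in> carrier_mat ?N ?N"
    using c by (auto simp: super_bracket_def)
  have entry: "super_bracket a b A C $$ (i, j) =
      (\<Sum>k<?N. A $$ (i, k) * C $$ (k, j) - ?s * (C $$ (i, k) * A $$ (k, j)))"
    if "i < ?N" "j < ?N" for i j
    using that c by (simp add: super_bracket_def mult_index[OF c] mult_index[OF c(2) c(1)]
        sum_subtractf sum_distrib_left del: index_mult_mat(1))
  fix i j assume ij: "i < ?N" "j < ?N"
  have bij: "bij_betw opp {..<?N} {..<?N}"
    by (rule bij_betw_byWitness[where f' = opp]) auto
  have "super_bracket a b A C $$ (opp j, opp i) =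
     (\<Sum>k<?N. A $$ (opp j, opp k) * C $$ (opp k, opp i) - ?s * (C $$ (opp j, opp k) * A $$ (opp k, opp i)))"
    unfolding entry[OF opp_less[OF ij(2)] opp_less[OF ij(1)]]
    by (rule sum.reindex_bij_betw[OF bij, symmetric])
  then have "- theta i j * super_bracket a b A C $$ (opp j, opp i) =
     (\<Sum>k<?N. - theta i j * (A $$ (opp j, opp k) * C $$ (opp k, opp i) - ?s * (C $$ (opp j, opp k) * A $$ (opp k, opp i))))"
    by (simp only: sum_distrib_left)
  also have "\<dots> = super_bracket a b A C $$ (i, j)"
    unfolding entry[OF ij]
  proof (rule sum.cong[OF refl])
    fix k assume "k \<in> {..<?N}"
    then have k: "k < ?N" by simp
    have opp: "M $$ (opp q, opp p) = - theta p q * M $$ (p, q)"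
      if "p < ?N" "q < ?N" "M \<in> osp_hom m n d" for p q M d
    proof -
      have "- theta p q * M $$ (p, q) = (theta p q * theta p q) * M $$ (opp q, opp p)"
        using osp_homD(2)[OF that(3,1,2)] by simp
      then show ?thesis by (simp add: theta_sq)
    qed
    have 1: "theta i j * theta i k * theta k j = ?s" if "A $$ (i, k) * C $$ (k, j) \<noteq> 0"
      using that osp_homD(3)[OF assms(1) ij(1) k] osp_homD(3)[OF assms(2) k ij(2)]
      by (auto simp: theta_triple)
    have 2: "theta i j * theta i k * theta k j = ?s" if "C $$ (i, k) * A $$ (k, j) \<noteq> 0"
      using that osp_homD(3)[OF assms(2) ij(1) k] osp_homD(3)[OF assms(1) k ij(2)]
      by (auto simp: theta_triple)
    have "- theta i j * (A $$ (opp j, opp k) * C $$ (opp k, opp i) - ?s * (C $$ (opp j, opp k) * A $$ (opp k, opp i)))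
       = ?s * ((theta i j * theta i k * theta k j) * (A $$ (i, k) * C $$ (k, j)))
         - (theta i j * theta i k * theta k j) * (C $$ (i, k) * A $$ (k, j))"
      using opp[OF k ij(2) assms(1)] opp[OF ij(1) k assms(2)] opp[OF k ij(2) assms(2)]
        opp[OF ij(1) k assms(1)] by (simp add: algebra_simps)
    also have "\<dots> = A $$ (i, k) * C $$ (k, j) - ?s * (C $$ (i, k) * A $$ (k, j))"
    proof -
      have *: "(theta i j * theta i k * theta k j) * (A $$ (i, k) * C $$ (k, j)) = ?s * (A $$ (i, k) * C $$ (k, j))"
        "(theta i j * theta i k * theta k j) * (C $$ (i, k) * A $$ (k, j)) = ?s * (C $$ (i, k) * A $$ (k, j))"
        by (rule mult_right_cong0, erule 1, rule mult_right_cong0, erule 2)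
      show ?thesis unfolding * by simp
    qed
    finally show "- theta i j * (A $$ (opp j, opp k) * C $$ (opp k, opp i) - ?s * (C $$ (opp j, opp k) * A $$ (opp k, opp i)))
       = A $$ (i, k) * C $$ (k, j) - ?s * (C $$ (i, k) * A $$ (k, j))" .
  qed
  finally show "super_bracket a b A C $$ (i, j) = - theta i j * super_bracket a b A C $$ (opp j, opp i)"
    by simp
  assume "super_bracket a b A C $$ (i, j) \<noteq> 0"
  then obtain k where k: "k < ?N" "A $$ (i, k) * C $$ (k, j) - ?s * (C $$ (i, k) * A $$ (k, j)) \<noteq> 0"
    unfolding entry[OF ij] by (metis (no_types, lifting) lessThan_iff sum.neutral)
  then have "A $$ (i, k) \<noteq> 0 \<and> C $$ (k, j) \<noteq> 0 \<or> C $$ (i, k) \<noteq> 0 \<and> A $$ (k, j) \<noteq> 0" by auto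
  then show "((i < 2 * n) \<noteq> (j < 2 * n)) = (a \<noteq> b)"
    using osp_homD(3)[OF assms(1)] osp_homD(3)[OF assms(2)] ij k(1) by metis
qed

section \<open>Root vectors and their brackets\<close>

lemma root_vec_carrier [simp]: "root_vec i j \<in> carrier_mat (gdim m n) (gdim m n)"
  by (simp add: root_vec_def)

lemma root_vec_dim [simp]: "dim_row (root_vec i j) = gdim m n" "dim_col (root_vec i j) = gdim m n"
  by (simp_all add: root_vec_def)

lemma root_vec_index:
  assumes "p < gdim m n" "q < gdim m n"
  shows "root_vec i j $$ (p, q) =
    (if p = i \<and> q = j then 1 else 0) - (if p = opp j \<and> q = opp i then theta i j else 0)"
  using assms by (simp add: root_vec_def)

lemma root_vec_osp_hom:
  assumes "i < gdim m n" "j < gdim m n"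
  shows "root_vec i j \<in> osp_hom m n ((i < 2 * n) \<noteq> (j < 2 * n))"
proof (rule osp_homI)
  fix p q assume pq: "p < gdim m n" "q < gdim m n"
  have "p = opp j \<and> q = opp i \<longleftrightarrow> opp q = i \<and> opp p = j" "opp q = opp j \<and> opp p = opp i \<longleftrightarrow> p = i \<and> q = j"
    using pq assms by (metis opp_opp)+
  then show "root_vec i j $$ (p, q) = - theta p q * root_vec i j $$ (opp q, opp p)"
    using pq assms theta_opp[of i j] by (auto simp: root_vec_index theta_sq algebra_simps)
  show "root_vec i j $$ (p, q) \<noteq> 0 \<Longrightarrow> ((p < 2 * n) \<noteq> (q < 2 * n)) = ((i < 2 * n) \<noteq> (j < 2 * n))"
    using pq assms by (auto simp: root_vec_index split: if_splits)
qed simp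

lemma root_vec_osp: "i < gdim m n \<Longrightarrow> j < gdim m n \<Longrightarrow> root_vec i j \<in> osp m n"
  using root_vec_osp_hom osp_hom_subset_osp by blast

lemma root_vec_diag_entry:
  assumes "i = j \<and> i < gdim m n \<or> root_pair i j"
  shows "root_vec i j $$ (i, j) = (if j = opp i then 2 else 1)"
proof -
  have ij: "i < gdim m n" "j < gdim m n" using assms by (auto simp: root_pair_def)
  have "i = opp j \<longleftrightarrow> j = opp i" using ij by auto
  then show ?thesis
    using assms ij by (auto simp: root_vec_index root_pair_def theta_self_opp)
qed

lemma root_vec_support:
  assumes "i < gdim m n" "j < gdim m n" "p < gdim m n" "q < gdim m n" "root_vec i j $$ (p, q) \<noteq> 0"
  shows "p = i \<and> q = j \<or> p = opp j \<and> q = opp i"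
  using assms by (auto simp: root_vec_index split: if_splits)

lemma root_vec_mult_index:
  assumes "A \<in> carrier_mat (gdim m n) (gdim m n)"
    and "k < gdim m n" "l < gdim m n" "p < gdim m n" "q < gdim m n"
  shows "(root_vec k l * A) $$ (p, q) =
    (if p = k then A $$ (l, q) else 0) - (if p = opp l then theta k l * A $$ (opp k, q) else 0)"
proof -
  have "(root_vec k l * A) $$ (p, q) = (\<Sum>r<gdim m n.
      (if r = l then if p = k then A $$ (l, q) else 0 else 0) -
      (if r = opp k then if p = opp l then theta k l * A $$ (opp k, q) else 0 else 0))"
    unfolding mult_index[OF root_vec_carrier assms(1,4,5)]
    by (rule sum.cong) (use assms in \<open>auto simp: root_vec_index algebra_simps\<close>)
  then show ?thesis using assms by (simp add: sum_subtractf)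
qed

lemma mult_root_vec_index:
  assumes "A \<in> carrier_mat (gdim m n) (gdim m n)"
    and "k < gdim m n" "l < gdim m n" "p < gdim m n" "q < gdim m n"
  shows "(A * root_vec k l) $$ (p, q) =
    (if q = l then A $$ (p, k) else 0) - (if q = opp k then theta k l * A $$ (p, opp l) else 0)"
proof -
  have "(A * root_vec k l) $$ (p, q) = (\<Sum>r<gdim m n.
      (if r = k then if q = l then A $$ (p, k) else 0 else 0) -
      (if r = opp l then if q = opp k then theta k l * A $$ (p, opp l) else 0 else 0))"
    unfolding mult_index[OF assms(1) root_vec_carrier assms(4,5)]
    by (rule sum.cong) (use assms in \<open>auto simp: root_vec_index algebra_simps\<close>)
  then show ?thesis using assms by (simp add: sum_subtractf)
qed

lemma bracket_root_vec_support:
  assumes "A \<in> carrier_mat (gdim m n) (gdim m n)"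
    and "k < gdim m n" "l < gdim m n" "i < gdim m n" "j < gdim m n"
    and "super_bracket a b (root_vec k l) A $$ (i, j) \<noteq> 0"
  shows "i = k \<and> A $$ (l, j) \<noteq> 0 \<or> i = opp l \<and> A $$ (opp k, j) \<noteq> 0 \<or>
    j = l \<and> A $$ (i, k) \<noteq> 0 \<or> j = opp k \<and> A $$ (i, opp l) \<noteq> 0"
proof -
  have "super_bracket a b (root_vec k l) A $$ (i, j) =
      (root_vec k l * A) $$ (i, j) - (if a \<and> b then - 1 else 1) * (A * root_vec k l) $$ (i, j)"
    using assms(1,4,5) carrier_matD[OF assms(1)]
    by (simp add: super_bracket_def del: index_mult_mat(1))
  then show ?thesis
    using assms(6) unfolding root_vec_mult_index[OF assms(1-5)] mult_root_vec_index[OF assms(1-5)]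
    by (auto split: if_splits)
qed

lemma root_vec_mult_root_vec_swap_index:
  assumes "root_pair k l" "l \<noteq> opp k" "p < gdim m n" "q < gdim m n"
  shows "(root_vec k l * root_vec l k) $$ (p, q) = (if p = k \<and> q = k then 1 else 0) +
    (if (k < 2 * n) \<noteq> (l < 2 * n) then - 1 else 1) * (if p = opp l \<and> q = opp l then 1 else 0)"
proof -
  have kl: "k < gdim m n" "l < gdim m n" "k \<noteq> l" "l \<noteq> opp k" "k \<noteq> opp l" "opp k \<noteq> opp l"
    using assms by (auto simp: root_pair_def) (metis opp_opp)+
  have th: "theta k l * theta l k = (if (k < 2 * n) \<noteq> (l < 2 * n) then - 1 else 1)"
    using theta_mult_sym[of k l] by auto
  consider "p = k" | "p = opp l" "p \<noteq> k" | "p \<noteq> k" "p \<noteq> opp l" by blast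
  then show ?thesis
  proof cases
    case 1
    then show ?thesis using assms(3,4) kl kl(3-6)[symmetric]
      unfolding root_vec_mult_index[OF root_vec_carrier kl(1,2) assms(3,4)]
      by (simp add: root_vec_index[OF kl(2) assms(4)])
  next
    case 2
    then show ?thesis using assms(3,4) kl kl(3-6)[symmetric] th
      unfolding root_vec_mult_index[OF root_vec_carrier kl(1,2) assms(3,4)]
      by (simp add: root_vec_index[OF opp_less[OF kl(1)] assms(4)])
  next
    case 3
    then show ?thesis unfolding root_vec_mult_index[OF root_vec_carrier kl(1,2) assms(3,4)] by simp
  qed
qed

text \<open>The coroot. For an odd pair both the supersign and the product of the theta signs are
  -1, which turns the difference into a sum; so an odd root pairs to 0 with its own coroot.\<close>

lemma bracket_root_vec_root_vec:
  assumes "root_pair k l" "l \<noteq> opp k"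
  defines "a \<equiv> (k < 2 * n) \<noteq> (l < 2 * n)"
  shows "super_bracket a a (root_vec k l) (root_vec l k) = root_vec k k + (if a then 1 else - 1) \<cdot>\<^sub>m root_vec l l"
proof (rule eq_matI)
  have lk: "root_pair l k" "k \<noteq> opp l"
    using assms by (auto simp: root_pair_def)
  have aa: "((l < 2 * n) \<noteq> (k < 2 * n)) = a" "((k < 2 * n) \<noteq> (l < 2 * n)) = a"
    by (auto simp: a_def)
  fix p q assume "p < dim_row (root_vec k k + (if a then 1 else - 1) \<cdot>\<^sub>m root_vec l l)"
    "q < dim_col (root_vec k k + (if a then 1 else - 1) \<cdot>\<^sub>m root_vec l l)"
  then have pq: "p < gdim m n" "q < gdim m n" by auto
  define d where "d r = (if p = r \<and> q = r then 1 else 0 :: complex)" for r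
  have Xd: "root_vec r r $$ (p, q) = d r - d (opp r)" for r
    using pq by (auto simp: root_vec_index d_def)
  have "super_bracket a a (root_vec k l) (root_vec l k) $$ (p, q) =
      (root_vec k l * root_vec l k) $$ (p, q) - (if a then - 1 else 1) * (root_vec l k * root_vec k l) $$ (p, q)"
    using pq by (simp add: super_bracket_def del: index_mult_mat(1))
  also have "\<dots> = (d k + (if a then - 1 else 1) * d (opp l)) - (if a then - 1 else 1) * (d l + (if a then - 1 else 1) * d (opp k))"
    unfolding root_vec_mult_root_vec_swap_index[OF assms(1,2) pq] root_vec_mult_root_vec_swap_index[OF lk pq] aa d_def ..
  also have "\<dots> = root_vec k k $$ (p, q) + (if a then 1 else - 1) * root_vec l l $$ (p, q)"
    unfolding Xd by (simp add: algebra_simps)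
  also have "\<dots> = (root_vec k k + (if a then 1 else - 1) \<cdot>\<^sub>m root_vec l l) $$ (p, q)"
    using pq by simp
  finally show "super_bracket a a (root_vec k l) (root_vec l k) $$ (p, q) = (root_vec k k + (if a then 1 else - 1) \<cdot>\<^sub>m root_vec l l) $$ (p, q)" .
qed (auto simp: super_bracket_def)

text \<open>The factor 4 arises because both root vectors are twice a matrix unit.\<close>

lemma bracket_root_vec_root_vec_opp:
  assumes "k < 2 * n"
  shows "super_bracket False False (root_vec k (opp k)) (root_vec (opp k) k) = 4 \<cdot>\<^sub>m root_vec k k"
proof (rule eq_matI)
  have k: "k < gdim m n" using assms by (simp add: gdim_def)
  note k' = k opp_neq[OF k] opp_neq[OF k, symmetric] opp_less[OF k]
  have th: "theta k (opp k) = - 1" "theta (opp k) k = - 1"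
    using theta_self_opp[OF k] theta_self_opp[OF opp_less[OF k]] k assms by auto
  fix p q assume "p < dim_row (4 \<cdot>\<^sub>m root_vec k k)" "q < dim_col (4 \<cdot>\<^sub>m root_vec k k)"
  then have pq: "p < gdim m n" "q < gdim m n" by (auto simp: root_vec_def)
  have "super_bracket False False (root_vec k (opp k)) (root_vec (opp k) k) $$ (p, q) =
      (root_vec k (opp k) * root_vec (opp k) k) $$ (p, q) - (root_vec (opp k) k * root_vec k (opp k)) $$ (p, q)"
    using pq by (simp add: super_bracket_def root_vec_def del: index_mult_mat(1))
  also have "\<dots> = (4 \<cdot>\<^sub>m root_vec k k) $$ (p, q)"
    unfolding root_vec_mult_index[OF root_vec_carrier k'(1,4) pq] root_vec_mult_index[OF root_vec_carrier k'(4,1) pq]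
    using pq k' th by (simp add: root_vec_index del: index_mult_mat(1))
  finally show "super_bracket False False (root_vec k (opp k)) (root_vec (opp k) k) $$ (p, q) = (4 \<cdot>\<^sub>m root_vec k k) $$ (p, q)" .
qed (auto simp: super_bracket_def root_vec_def)

text \<open>For an odd root this makes the superbracket of the root vector with itself vanish, so
  the lowering operator squares to zero on every module.\<close>

lemma root_vec_square_zero:
  assumes "root_pair k l" "l \<noteq> opp k"
  shows "root_vec k l * root_vec k l = 0\<^sub>m (gdim m n) (gdim m n)"
proof (rule eq_matI)
  have kl: "k < gdim m n" "l < gdim m n" "k \<noteq> l" "l \<noteq> opp k" "k \<noteq> opp l" "opp k \<noteq> opp l"
    using assms by (auto simp: root_pair_def) (metis opp_opp)+
  fix p q assume "p < dim_row (0\<^sub>m (gdim m n) (gdim m n) :: complex mat)" "q < dim_col (0\<^sub>m (gdim m n) (gdim m n) :: complex mat)"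
  then have pq: "p < gdim m n" "q < gdim m n" by auto
  show "(root_vec k l * root_vec k l) $$ (p, q) = 0\<^sub>m (gdim m n) (gdim m n) $$ (p, q)"
    unfolding root_vec_mult_index[OF root_vec_carrier kl(1,2) pq]
    using pq kl kl(3-6)[symmetric] opp_neq[OF kl(1)] opp_neq[OF kl(2)] opp_neq[OF kl(1), symmetric] opp_neq[OF kl(2), symmetric]
    by (simp add: root_vec_index)
qed (auto simp: root_vec_def)

text \<open>Subtracting a multiple of \<open>root_vec i j\<close> clears a nonzero entry and its
  mirror image and changes no other entry, so the support shrinks. Keeping the support inside that
  of the original \<open>A\<close> restricts the root vectors used to positions where
  \<open>A\<close> itself is nonzero.\<close>

lemma osp_hom_induct [consumes 1, case_names zero step]:
  assumes "A \<in> osp_hom m n a"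
    and zero: "P (0\<^sub>m (gdim m n) (gdim m n))"
    and step: "\<And>C i j t. C \<in> osp_hom m n a \<Longrightarrow> P C \<Longrightarrow> i = j \<and> i < gdim m n \<or> root_pair i j \<Longrightarrow>
      ((i < 2 * n) \<noteq> (j < 2 * n)) = a \<Longrightarrow> A $$ (i, j) \<noteq> 0 \<Longrightarrow> P (C + t \<cdot>\<^sub>m root_vec i j)"
  shows "P A"
proof -
  let ?N = "gdim m n"
  define supp where "supp C = {(i, j). i < ?N \<and> j < ?N \<and> (C :: complex mat) $$ (i, j) \<noteq> 0}" for C
  have fin: "finite (supp C)" for C
    by (rule finite_subset[of _ "{..<?N} \<times> {..<?N}"]) (auto simp: supp_def)
  have "P C" if "C \<in> osp_hom m n a" "supp C \<subseteq> supp A" for C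
    using that
  proof (induction "card (supp C)" arbitrary: C rule: less_induct)
    case less
    note c = osp_homD(1)[OF less.prems(1)]
    show ?case
    proof (cases "supp C = {}")
      case True
      then have "C = 0\<^sub>m ?N ?N"
        using c by (intro eq_matI) (auto simp: supp_def)
      then show ?thesis using zero by simp
    next
      case False
      then obtain i j where ij: "i < ?N" "j < ?N" "C $$ (i, j) \<noteq> 0" by (auto simp: supp_def)
      have pair: "i = j \<and> i < ?N \<or> root_pair i j"
        using osp_hom_root_pair[OF less.prems(1) ij] ij by blast
      have par: "((i < 2 * n) \<noteq> (j < 2 * n)) = a" by (rule osp_homD(3)[OF less.prems(1) ij])
      \<comment> \<open>The divisor is 2 if \<open>j = opp i\<close> and 1 otherwise, by
        \<open>root_vec_diag_entry\<close>.\<close>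
      define t where "t = C $$ (i, j) / root_vec i j $$ (i, j)"
      define D where "D = C + (- t) \<cdot>\<^sub>m root_vec i j"
      have root_vec: "root_vec i j \<in> osp_hom m n a" using root_vec_osp_hom[OF ij(1,2)] par by simp
      have D: "D \<in> osp_hom m n a"
        unfolding D_def using less.prems(1) root_vec by (intro add_osp_hom smult_osp_hom)
      have Dij: "D $$ (i, j) = 0"
        using ij carrier_matD[OF c] root_vec_diag_entry[OF pair] by (simp add: D_def t_def)
      have "supp D \<subseteq> supp C - {(i, j)}"
      proof clarsimp
        fix p q assume pq: "(p, q) \<in> supp D"
        then have pq': "p < ?N" "q < ?N" "D $$ (p, q) \<noteq> 0" by (auto simp: supp_def)
        have "D $$ (p, q) = C $$ (p, q)" if "\<not> (p = i \<and> q = j)" "\<not> (p = opp j \<and> q = opp i)"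
        proof -
          have "root_vec i j $$ (p, q) = 0" using root_vec_support[OF ij(1,2) pq'(1,2)] that by blast
          then show ?thesis unfolding D_def using pq'(1,2) carrier_matD[OF c] by simp
        qed
        \<comment> \<open>The mirror entry need not be computed: \<open>D\<close> still satisfies
          the osp relation.\<close>
        moreover have "D $$ (opp j, opp i) = 0" using osp_hom_opp_zero_iff[OF D ij(1,2)] Dij by simp
        ultimately have "C $$ (p, q) \<noteq> 0" "\<not> (p = i \<and> q = j)"
          using pq'(3) Dij by metis+
        then show "(p, q) \<in> supp C \<and> (p = i \<longrightarrow> q \<noteq> j)"
          using pq'(1,2) by (simp add: supp_def)
      qed
      moreover have "(i, j) \<in> supp C" using ij by (simp add: supp_def)
      ultimately have "card (supp D) < card (supp C)" "supp D \<subseteq> supp A"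
        using less.prems(2) fin by (auto intro!: psubset_card_mono)
      then have "P D" using less.hyps D by blast
      moreover have "A $$ (i, j) \<noteq> 0"
        using less.prems(2) ij by (auto simp: supp_def)
      ultimately have "P (D + t \<cdot>\<^sub>m root_vec i j)" using step D pair par by blast
      moreover have "D + t \<cdot>\<^sub>m root_vec i j = C"
        unfolding D_def using carrier_matD[OF c] by (intro eq_matI) simp_all
      ultimately show ?thesis by simp
    qed
  qed
  then show ?thesis using assms(1) by blast
qed

section \<open>The Cartan subalgebra and evaluation of weights\<close>

lemma cartan_iff: "H \<in> cartan m n \<longleftrightarrow> H \<in> osp_hom m n False \<and> diagonal_mat H"
proof
  assume H: "H \<in> cartan m n"
  then obtain A C where AC: "H = A + C" "A \<in> osp_hom m n False" "C \<in> osp_hom m n True"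
    by (auto simp: cartan_def osp_def)
  note c = osp_homD(1)[OF AC(2)] osp_homD(1)[OF AC(3)]
  have "H = A"
  proof (rule eq_matI)
    fix i j assume "i < dim_row A" "j < dim_col A"
    then have ij: "i < gdim m n" "j < gdim m n" using c by auto
    have sum: "H $$ (i, j) = A $$ (i, j) + C $$ (i, j)" using ij carrier_matD[OF c(2)] AC(1) by simp
    \<comment> \<open>The even and odd components have disjoint supports and so cannot cancel; an
      odd position is off the diagonal, where \<open>H\<close> vanishes.\<close>
    have "C $$ (i, j) = 0"
    proof (rule ccontr)
      assume nz: "C $$ (i, j) \<noteq> 0"
      then have par: "(i < 2 * n) \<noteq> (j < 2 * n)" using osp_homD(3)[OF AC(3) ij] by blast
      then have "A $$ (i, j) = 0" using osp_homD(3)[OF AC(2) ij] by blast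
      moreover have "H $$ (i, j) = 0"
        using H ij par AC(1) carrier_matD[OF c(2)] by (auto simp: cartan_def diagonal_mat_def)
      ultimately show False using sum nz by simp
    qed
    then show "H $$ (i, j) = A $$ (i, j)" using sum by simp
  qed (use AC(1) c in auto)
  then show "H \<in> osp_hom m n False \<and> diagonal_mat H"
    using AC(2) H by (simp add: cartan_def)
qed (auto simp: cartan_def osp_hom_subset_osp)

lemma cartanD:
  assumes "H \<in> cartan m n"
  shows "H \<in> osp_hom m n False" "H \<in> carrier_mat (gdim m n) (gdim m n)"
    and "i < gdim m n \<Longrightarrow> j < gdim m n \<Longrightarrow> i \<noteq> j \<Longrightarrow> H $$ (i, j) = 0"
    and "i < gdim m n \<Longrightarrow> H $$ (opp i, opp i) = - H $$ (i, i)"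
proof -
  show H: "H \<in> osp_hom m n False" using assms cartan_iff by blast
  then show c: "H \<in> carrier_mat (gdim m n) (gdim m n)" by (rule osp_homD)
  show "i < gdim m n \<Longrightarrow> j < gdim m n \<Longrightarrow> i \<noteq> j \<Longrightarrow> H $$ (i, j) = 0"
    using assms carrier_matD[OF c] by (auto simp: cartan_def diagonal_mat_def)
  show "i < gdim m n \<Longrightarrow> H $$ (opp i, opp i) = - H $$ (i, i)"
    using osp_homD(2)[OF H, of i i] by simp
qed

lemma root_vec_cartan: "k < gdim m n \<Longrightarrow> root_vec k k \<in> cartan m n"
  using root_vec_osp_hom[of k k] unfolding cartan_iff
  by (auto simp: diagonal_mat_def root_vec_index)

lemma smult_cartan: "H \<in> cartan m n \<Longrightarrow> t \<cdot>\<^sub>m H \<in> cartan m n"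
  unfolding cartan_iff using smult_osp_hom[of H False t] by (auto simp: diagonal_mat_def)

lemma add_cartan:
  assumes "H \<in> cartan m n" "K \<in> cartan m n"
  shows "H + K \<in> cartan m n"
proof -
  have "H + K \<in> osp_hom m n False"
    using assms by (intro add_osp_hom) (simp_all add: cartanD)
  moreover have "(H + K) $$ (i, j) = 0" if "i < gdim m n" "j < gdim m n" "i \<noteq> j" for i j
    using that cartanD(3)[OF assms(1) that] cartanD(3)[OF assms(2) that]
      carrier_matD[OF cartanD(2)[OF assms(2)]] by simp
  ultimately show ?thesis
    using carrier_matD[OF cartanD(2)[OF assms(2)]] by (simp add: cartan_iff diagonal_mat_def)
qed

text \<open>For an antisymmetric \<open>r\<close> this is the Cartan element that grades osp by
  rank: its commutator with \<open>root_vec i j\<close> is \<open>r i - r j\<close> times that root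
  vector.\<close>

definition diag_of :: "(nat \<Rightarrow> int) \<Rightarrow> complex mat" where
  "diag_of r = mat (gdim m n) (gdim m n) (\<lambda>(i, j). if i = j then of_int (r i) else 0)"

lemma diag_of_cartan:
  assumes "\<And>i. i < gdim m n \<Longrightarrow> r (opp i) = - r i"
  shows "diag_of r \<in> cartan m n"
proof -
  have "diag_of r \<in> osp_hom m n False"
  proof (rule osp_homI)
    fix i j assume ij: "i < gdim m n" "j < gdim m n"
    then have "opp j = opp i \<longleftrightarrow> i = j" by (metis opp_opp)
    then show "diag_of r $$ (i, j) = - theta i j * diag_of r $$ (opp j, opp i)"
      using ij assms by (auto simp: diag_of_def)
    show "diag_of r $$ (i, j) \<noteq> 0 \<Longrightarrow> ((i < 2 * n) \<noteq> (j < 2 * n)) = False"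
      using ij by (auto simp: diag_of_def split: if_splits)
  qed (simp add: diag_of_def)
  then show ?thesis
    unfolding cartan_iff by (simp add: diagonal_mat_def diag_of_def)
qed

lemma cartan_commutator_index:
  assumes H: "H \<in> cartan m n" and A: "A \<in> carrier_mat (gdim m n) (gdim m n)"
    and ij: "i < gdim m n" "j < gdim m n"
  shows "(H * A - A * H) $$ (i, j) = (H $$ (i, i) - H $$ (j, j)) * A $$ (i, j)"
proof -
  note c = cartanD(2)[OF H]
  have "(H * A) $$ (i, j) = (\<Sum>k<gdim m n. if k = i then H $$ (i, i) * A $$ (i, j) else 0)"
    unfolding mult_index[OF c A ij]
    by (rule sum.cong) (use cartanD(3)[OF H ij(1)] in auto)
  moreover have "(A * H) $$ (i, j) = (\<Sum>k<gdim m n. if k = j then A $$ (i, j) * H $$ (j, j) else 0)"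
    unfolding mult_index[OF A c ij]
    by (rule sum.cong) (use cartanD(3)[OF H _ ij(2)] in auto)
  moreover have "(H * A - A * H) $$ (i, j) = (H * A) $$ (i, j) - (A * H) $$ (i, j)"
    using ij carrier_matD[OF c] carrier_matD[OF A] by (simp del: index_mult_mat(1))
  ultimately show ?thesis using ij by (simp add: algebra_simps)
qed

lemma cartan_commutator_root_vec:
  assumes H: "H \<in> cartan m n" and kl: "k < gdim m n" "l < gdim m n"
  shows "H * root_vec k l - root_vec k l * H = (H $$ (k, k) - H $$ (l, l)) \<cdot>\<^sub>m root_vec k l"
proof (rule eq_matI)
  note c = cartanD(2)[OF H]
  fix p q assume "p < dim_row ((H $$ (k, k) - H $$ (l, l)) \<cdot>\<^sub>m root_vec k l)"
    "q < dim_col ((H $$ (k, k) - H $$ (l, l)) \<cdot>\<^sub>m root_vec k l)"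
  then have pq: "p < gdim m n" "q < gdim m n" by auto
  have "H $$ (p, p) - H $$ (q, q) = H $$ (k, k) - H $$ (l, l)" if "root_vec k l $$ (p, q) \<noteq> 0"
    using root_vec_support[OF kl pq that] cartanD(4)[OF H kl(1)] cartanD(4)[OF H kl(2)] by auto
  then show "(H * root_vec k l - root_vec k l * H) $$ (p, q) = ((H $$ (k, k) - H $$ (l, l)) \<cdot>\<^sub>m root_vec k l) $$ (p, q)"
    unfolding cartan_commutator_index[OF H root_vec_carrier pq]
    using pq by (cases "root_vec k l $$ (p, q) = 0") auto
qed (use cartanD(2)[OF H] in auto)

lemma bracket_cartan_root_vec:
  assumes "H \<in> cartan m n" "k < gdim m n" "l < gdim m n"
  shows "super_bracket False a H (root_vec k l) = (H $$ (k, k) - H $$ (l, l)) \<cdot>\<^sub>m root_vec k l"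
proof -
  have "1 \<cdot>\<^sub>m (root_vec k l * H) = root_vec k l * H" by (intro eq_matI) auto
  then show ?thesis
    using cartan_commutator_root_vec[OF assms] by (simp add: super_bracket_def)
qed

lemma wt_eval_add: "wt_eval m n (\<mu> + \<nu>) H = wt_eval m n \<mu> H + wt_eval m n \<nu> H"
  by (simp add: wt_eval_def sum.distrib algebra_simps)

lemma wt_eval_diff: "wt_eval m n (\<mu> - \<nu>) H = wt_eval m n \<mu> H - wt_eval m n \<nu> H"
  by (simp add: wt_eval_def sum_subtractf algebra_simps)

lemma wt_eval_wscale: "wt_eval m n (wscale k \<mu>) H = of_int k * wt_eval m n \<mu> H"
  by (simp add: wt_eval_def wscale_def sum_distrib_left algebra_simps)

lemma wt_eval_basis_Del: "i \<in> {1..n} \<Longrightarrow> wt_eval m n (basis_wt (Del i)) H = H $$ (i - 1, i - 1)"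
  by (simp add: wt_eval_def basis_wt_def if_distrib[of "\<lambda>x. of_int x * _"] cong: if_cong)

lemma wt_eval_basis_Eps:
  "j \<in> {1..m} \<Longrightarrow> wt_eval m n (basis_wt (Eps j)) H = H $$ (2 * n + j - 1, 2 * n + j - 1)"
  by (simp add: wt_eval_def basis_wt_def if_distrib[of "\<lambda>x. of_int x * _"] cong: if_cong)

lemma index_coord_index:
  assumes "i < gdim m n" "index_sign i = 1"
  shows "(\<exists>k\<in>{1..n}. index_coord i = Del k \<and> i = k - 1) \<or> (\<exists>k\<in>{1..m}. index_coord i = Eps k \<and> i = 2 * n + k - 1)"
proof (cases "i < n")
  case True
  then show ?thesis using assms by (intro disjI1 bexI[of _ "i + 1"]) (auto simp: index_coord_def)
next
  case False
  then show ?thesis using assms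
    by (intro disjI2 bexI[of _ "i - 2 * n + 1"]) (auto simp: index_coord_def index_sign_def gdim_def split: if_splits)
qed

lemma wt_eval_index_wt:
  assumes "i < gdim m n" "H \<in> cartan m n"
  shows "wt_eval m n (index_wt i) H = H $$ (i, i)"
proof -
  have pos: "wt_eval m n (basis_wt (index_coord j)) H = H $$ (j, j)" if "j < gdim m n" "index_sign j = 1" for j
    using index_coord_index[OF that] wt_eval_basis_Del[of _ H] wt_eval_basis_Eps[of _ H] by auto
  show ?thesis
  proof (cases "index_sign i = 1")
    case True
    then show ?thesis using pos[OF assms(1)] by (simp add: index_wt_def wt_eval_wscale)
  next
    case False
    then have "index_sign i = - 1" using index_sign_cases by blast
    then show ?thesis
      using pos[of "opp i"] assms cartanD(4)[OF assms(2,1)] by (simp add: index_wt_def wt_eval_wscale)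
  qed
qed

text \<open>\<open>wt_eval\<close> reads only the rows of positive sign, and an index of negative
  sign is reached through its opposite. The elements \<open>root_vec k k\<close> thus test all
  coordinates of a weight separately.\<close>

lemma wt_eval_root_vec:
  assumes "k < gdim m n"
  shows "wt_eval m n \<mu> (root_vec k k) = of_int (index_eval \<mu> k)"
proof -
  have pos: "wt_eval m n \<mu> (root_vec j j) = of_int (\<mu> (index_coord j))" if j: "j < gdim m n" "index_sign j = 1" for j
  proof -
    have ind: "root_vec j j $$ (p, p) = (if p = j then 1 else 0)" if "p < gdim m n" "index_sign p = 1" for p
    proof -
      have "p \<noteq> opp j" using that j index_sign_opp[of j] by auto
      then show ?thesis using that by (simp add: root_vec_index)
    qed
    have D: "root_vec j j $$ (i - 1, i - 1) = (if Del i = index_coord j then 1 else 0)" if "i \<in> {1..n}" for i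
    proof -
      have i: "i - 1 < gdim m n" "index_sign (i - 1) = 1" "index_coord (i - 1) = Del i"
        using that by (auto simp: gdim_def index_sign_def index_coord_def)
      then show ?thesis using ind[OF i(1,2)] index_coord_index_sign_inj[of "i - 1" j] j by auto
    qed
    have E: "root_vec j j $$ (2 * n + i - 1, 2 * n + i - 1) = (if Eps i = index_coord j then 1 else 0)" if "i \<in> {1..m}" for i
    proof -
      have i: "2 * n + i - 1 < gdim m n" "index_sign (2 * n + i - 1) = 1" "index_coord (2 * n + i - 1) = Eps i"
        using that by (auto simp: gdim_def index_sign_def index_coord_def)
      then show ?thesis using ind[OF i(1,2)] index_coord_index_sign_inj[of "2 * n + i - 1" j] j by auto
    qed
    have "wt_eval m n \<mu> (root_vec j j) =
       (\<Sum>i=1..n. if Del i = index_coord j then of_int (\<mu> (Del i)) else 0) +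
       (\<Sum>i=1..m. if Eps i = index_coord j then of_int (\<mu> (Eps i)) else 0)"
      unfolding wt_eval_def by (intro arg_cong2[of _ _ _ _ "(+)"] sum.cong) (use D E in auto)
    also have "\<dots> = of_int (\<mu> (index_coord j))"
      using index_coord_index[OF j] by auto
    finally show ?thesis .
  qed
  show ?thesis
  proof (cases "index_sign k = 1")
    case True
    then show ?thesis using pos assms by (simp add: index_eval_def)
  next
    case False
    then have s: "index_sign k = - 1" using index_sign_cases by blast
    have "root_vec k k = - 1 \<cdot>\<^sub>m root_vec (opp k) (opp k)"
      using assms by (intro eq_matI) (auto simp: root_vec_index)
    moreover have "wt_eval m n \<mu> (- 1 \<cdot>\<^sub>m root_vec (opp k) (opp k)) = - wt_eval m n \<mu> (root_vec (opp k) (opp k))"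
    proof -
      have "wt_eval m n \<mu> (- 1 \<cdot>\<^sub>m root_vec (opp k) (opp k)) =
        (\<Sum>i=1..n. - (of_int (\<mu> (Del i)) * root_vec (opp k) (opp k) $$ (i - 1, i - 1))) +
        (\<Sum>i=1..m. - (of_int (\<mu> (Eps i)) * root_vec (opp k) (opp k) $$ (2 * n + i - 1, 2 * n + i - 1)))"
        unfolding wt_eval_def
        by (intro arg_cong2[of _ _ _ _ "(+)"] sum.cong refl) (auto simp: gdim_def)
      then show ?thesis by (simp add: wt_eval_def sum_negf)
    qed
    ultimately show ?thesis using pos[of "opp k"] assms s by (simp add: index_eval_def)
  qed
qed

section \<open>Root spaces and roots\<close>

lemma index_wt_support: "i < gdim m n \<Longrightarrow> index_wt i c \<noteq> 0 \<Longrightarrow> c \<in> coords m n"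
  using index_coord_in_coords[of i] by (auto simp: index_wt_def wscale_def basis_wt_def split: if_splits)

lemma root_vec_root_space:
  assumes "k < gdim m n" "l < gdim m n"
  shows "root_vec k l \<in> root_space m n (index_wt k - index_wt l)"
  using assms root_vec_osp cartan_commutator_root_vec
  by (auto simp: root_space_def wt_eval_diff wt_eval_index_wt)

text \<open>The (i, j) entry of the commutator with H shows that \<alpha> and the index difference
  agree on the Cartan subalgebra, where the \<open>root_vec k k\<close> separate coordinates. The
  support hypothesis settles the coordinates outside \<open>coords\<close>, which
  \<open>wt_eval\<close> does not see.\<close>

lemma root_space_support:
  assumes \<alpha>: "\<And>c. \<alpha> c \<noteq> 0 \<Longrightarrow> c \<in> coords m n" and A: "A \<in> root_space m n \<alpha>"
    and ij: "i < gdim m n" "j < gdim m n" "A $$ (i, j) \<noteq> 0"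
  shows "\<alpha> = index_wt i - index_wt j"
proof
  fix c
  have "A \<in> osp m n" using A by (simp add: root_space_def)
  then have cA: "A \<in> carrier_mat (gdim m n) (gdim m n)"
    by (auto simp: osp_def intro: osp_homD(1) add_carrier_mat)
  have ev: "wt_eval m n \<alpha> H = wt_eval m n (index_wt i - index_wt j) H" if H: "H \<in> cartan m n" for H
  proof -
    have "H * A - A * H = wt_eval m n \<alpha> H \<cdot>\<^sub>m A" using A H by (simp add: root_space_def)
    then have "(H $$ (i, i) - H $$ (j, j)) * A $$ (i, j) = wt_eval m n \<alpha> H * A $$ (i, j)"
      using cartan_commutator_index[OF H cA ij(1,2)] ij carrier_matD[OF cA] by simp
    then show ?thesis using ij H by (simp add: wt_eval_diff wt_eval_index_wt)
  qed
  show "\<alpha> c = (index_wt i - index_wt j) c"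
  proof (cases "c \<in> coords m n")
    case True
    then obtain k where k: "k < gdim m n" "index_coord k = c" "index_sign k = 1" using entry_index[of c 1] by auto
    then show ?thesis using ev[OF root_vec_cartan[OF k(1)]] unfolding wt_eval_root_vec[OF k(1)] of_int_eq_iff
      by (simp add: index_eval_def)
  next
    case False
    then have "\<alpha> c = 0" "index_wt i c = 0" "index_wt j c = 0"
      using \<alpha> index_wt_support ij(1,2) by blast+
    then show ?thesis by simp
  qed
qed

lemma root_pair_roots:
  assumes "root_pair i j"
  shows "index_wt i - index_wt j \<in> roots m n"
proof -
  have ij: "i < gdim m n" "j < gdim m n" "i \<noteq> j" using assms by (auto simp: root_pair_def)
  have "index_eval (index_wt i - index_wt j) i \<noteq> 0" using ij by (simp add: index_eval_index_wt)
  then have "index_wt i - index_wt j \<noteq> 0" by (auto simp: index_eval_def)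
  moreover have "root_vec i j \<noteq> 0\<^sub>m (gdim m n) (gdim m n)"
    using root_vec_diag_entry[of i j] assms ij by (metis index_zero_mat(1) zero_neq_numeral zero_neq_one)
  moreover have "c \<in> coords m n" if "(index_wt i - index_wt j) c \<noteq> 0" for c
    using that index_wt_support[OF ij(1), of c] index_wt_support[OF ij(2), of c] by force
  ultimately show ?thesis
    unfolding roots_def using root_vec_root_space[OF ij(1,2)] by blast
qed

lemma rootsE:
  assumes "\<alpha> \<in> roots m n"
  obtains i j where "root_pair i j" "\<alpha> = index_wt i - index_wt j"
proof -
  obtain A where A: "A \<in> root_space m n \<alpha>" "A \<noteq> 0\<^sub>m (gdim m n) (gdim m n)"
    using assms by (auto simp: roots_def)
  then obtain A0 A1 where A01: "A = A0 + A1" "A0 \<in> osp_hom m n False" "A1 \<in> osp_hom m n True"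
    by (auto simp: root_space_def osp_def)
  note c = osp_homD(1)[OF A01(2)] osp_homD(1)[OF A01(3)]
  have "\<exists>i<gdim m n. \<exists>j<gdim m n. A $$ (i, j) \<noteq> 0"
  proof (rule ccontr)
    assume "\<not> ?thesis"
    then have "A = 0\<^sub>m (gdim m n) (gdim m n)"
      using A01(1) carrier_matD[OF c(2)] by (intro eq_matI) auto
    then show False using A(2) by simp
  qed
  then obtain i j where ij: "i < gdim m n" "j < gdim m n" "A $$ (i, j) \<noteq> 0" by blast
  have \<alpha>: "\<alpha> = index_wt i - index_wt j"
    using assms by (intro root_space_support[OF _ A(1) ij]) (auto simp: roots_def)
  have "i \<noteq> j" using assms \<alpha> by (auto simp: roots_def)
  moreover have "A0 $$ (i, j) \<noteq> 0 \<or> A1 $$ (i, j) \<noteq> 0" using ij A01(1) carrier_matD[OF c(2)] by auto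
  ultimately have "root_pair i j" using osp_hom_root_pair A01(2,3) ij(1,2) by blast
  then show ?thesis using \<alpha> that by blast
qed

section \<open>Matrices strictly triangular for an order of the indices\<close>

definition upper :: "(nat \<Rightarrow> int) \<Rightarrow> complex mat \<Rightarrow> bool" where
  "upper r A \<longleftrightarrow> (\<forall>i<gdim m n. \<forall>j<gdim m n. A $$ (i, j) \<noteq> 0 \<longrightarrow> r j < r i)"

definition antisymmetric :: "(nat \<Rightarrow> int) \<Rightarrow> bool" where
  "antisymmetric r \<longleftrightarrow> (\<forall>i<gdim m n. r (opp i) = - r i)"

lemma upper_root_vec:
  assumes "antisymmetric r" "i < gdim m n" "j < gdim m n" "r j < r i"
  shows "upper r (root_vec i j)"
  unfolding upper_def
proof (intro allI impI)
  fix p q assume "p < gdim m n" "q < gdim m n" "root_vec i j $$ (p, q) \<noteq> 0"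
  then have "p = i \<and> q = j \<or> p = opp j \<and> q = opp i" using root_vec_support assms by blast
  then show "r q < r p" using assms by (auto simp: antisymmetric_def)
qed

text \<open>The two pairs that name the same root have proportional root vectors, so being killed by
  one means being killed by the other.\<close>

lemma root_vec_opp:
  assumes "i < gdim m n" "j < gdim m n"
  shows "root_vec (opp j) (opp i) = (- theta i j) \<cdot>\<^sub>m root_vec i j"
proof (rule eq_matI)
  fix p q assume "p < dim_row ((- theta i j) \<cdot>\<^sub>m root_vec i j)" "q < dim_col ((- theta i j) \<cdot>\<^sub>m root_vec i j)"
  then have pq: "p < gdim m n" "q < gdim m n" by auto
  define d e where "d = (if p = i \<and> q = j then 1 else 0 :: complex)"
    and "e = (if p = opp j \<and> q = opp i then 1 else 0 :: complex)"
  have "root_vec i j $$ (p, q) = d - theta i j * e" "root_vec (opp j) (opp i) $$ (p, q) = e - theta i j * d"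
    using assms theta_opp[OF assms] unfolding root_vec_index[OF pq] d_def e_def by auto
  moreover have "e - theta i j * d = - theta i j * (d - theta i j * e)"
  proof -
    have "- theta i j * (d - theta i j * e) = theta i j * theta i j * e - theta i j * d"
      by (simp add: algebra_simps)
    then show ?thesis by (simp add: theta_sq)
  qed
  ultimately show "root_vec (opp j) (opp i) $$ (p, q) = ((- theta i j) \<cdot>\<^sub>m root_vec i j) $$ (p, q)"
    using pq by simp
qed auto

text \<open>The matrix form of the fact that a simple reflection permutes the positive roots other
  than the simple one: as no rank lies strictly between those of \<open>l\<close> and
  \<open>k\<close>, lowering by this root cannot carry another positive root out of the positive
  ones.\<close>

lemma upper_bracket_adjacent:
  assumes r: "antisymmetric r" "inj_on r {..<gdim m n}"
    and kl: "root_pair k l"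
    and adj: "\<And>i. i < gdim m n \<Longrightarrow> \<not> (r l < r i \<and> r i < r k)"
    and A: "A \<in> osp_hom m n a" "upper r A" "A $$ (k, l) = 0"
  shows "upper r (super_bracket b a (root_vec l k) A)" "super_bracket b a (root_vec l k) A $$ (k, l) = 0"
proof -
  let ?N = "gdim m n"
  have N: "k < ?N" "l < ?N" "k \<noteq> l" using kl by (auto simp: root_pair_def)
  have r_opp: "r (opp i) = - r i" if "i < ?N" for i using r(1) that by (auto simp: antisymmetric_def)
  have r_inj: "r i = r j \<Longrightarrow> i = j" if "i < ?N" "j < ?N" for i j
    using r(2) that by (auto simp: inj_on_def)
  have up: "r j < r i" if "A $$ (i, j) \<noteq> 0" "i < ?N" "j < ?N" for i j
    using A(2) that by (auto simp: upper_def)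
  have A0: "A $$ (opp l, opp k) = 0" using osp_hom_opp_zero_iff[OF A(1) N(1,2)] A(3) by simp
  \<comment> \<open>A nonzero entry of the bracket comes from an entry of \<open>A\<close> with its
    row replaced by \<open>l\<close> or \<open>opp k\<close>, or its column by \<open>k\<close> or
    \<open>opp l\<close>. As the entry at (k, l) and its mirror image vanish, the remaining rank
    lies strictly beyond the gap between \<open>r l\<close> and \<open>r k\<close>.\<close>
  have key: "r j < r i \<and> \<not> (i = k \<and> j = l)"
    if ij: "i < ?N" "j < ?N" and nz: "super_bracket b a (root_vec l k) A $$ (i, j) \<noteq> 0" for i j
    using bracket_root_vec_support[OF osp_homD(1)[OF A(1)] N(2,1) ij nz]
  proof (elim disjE conjE)
    assume h: "i = l" "A $$ (k, j) \<noteq> 0"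
    then have "r j < r k" "j \<noteq> l" using up ij N A(3) by auto
    then have "r j < r l" using adj[OF ij(2)] r_inj[OF ij(2) N(2)] by linarith
    then show ?thesis using h N by auto
  next
    assume h: "i = opp k" "A $$ (opp l, j) \<noteq> 0"
    then have "r j < - r l" "j \<noteq> opp k" using up[OF h(2)] ij N A0 r_opp by auto
    then have "opp j \<noteq> k" "r l < r (opp j)" using r_opp ij by auto
    then have "r k < r (opp j)"
      using adj[OF opp_less[OF ij(2)]] r_inj[OF opp_less[OF ij(2)] N(1)] by linarith
    then show ?thesis using h N r_opp ij by auto
  next
    assume h: "j = k" "A $$ (i, l) \<noteq> 0"
    then have "r l < r i" "i \<noteq> k" using up[OF h(2)] ij N A(3) by auto
    then have "r k < r i" using adj[OF ij(1)] r_inj[OF ij(1) N(1)] by linarith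
    then show ?thesis using h N by auto
  next
    assume h: "j = opp l" "A $$ (i, opp k) \<noteq> 0"
    then have "- r k < r i" "i \<noteq> opp l" using up[OF h(2)] ij N A0 r_opp by auto
    then have "opp i \<noteq> l" "r (opp i) < r k" using r_opp ij by auto
    then have "r (opp i) < r l"
      using adj[OF opp_less[OF ij(1)]] r_inj[OF opp_less[OF ij(1)] N(2)] by linarith
    then show ?thesis using h N r_opp ij by auto
  qed
  then show "upper r (super_bracket b a (root_vec l k) A)" unfolding upper_def by blast
  show "super_bracket b a (root_vec l k) A $$ (k, l) = 0" using key[OF N(1,2)] by blast
qed

end

section \<open>Singular vectors and reflections\<close>

sublocale osp_module \<subseteq> osp_indices m n .

context osp_module begin

lemma act_linearity:
  assumes "A \<in> osp m n"
  shows "act A (u + w) = act A u + act A w" "act A (sc t u) = sc t (act A u)" "act A 0 = 0"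
    "act A (u - w) = act A u - act A w"
proof -
  interpret f: Vector_Spaces.linear sc sc "act A" using assms by (rule act_linear)
  show "act A (u + w) = act A u + act A w" "act A (sc t u) = sc t (act A u)" "act A 0 = 0"
    "act A (u - w) = act A u - act A w"
    by (simp_all add: f.add f.scale f.diff f.zero)
qed

lemma act_zero: "act (0\<^sub>m (gdim m n) (gdim m n)) v = 0"
proof -
  have "act (0 \<cdot>\<^sub>m 0\<^sub>m (gdim m n) (gdim m n)) v = sc 0 (act (0\<^sub>m (gdim m n) (gdim m n)) v)"
    using osp_hom_subset_osp[OF zero_osp_hom] by (rule act_smult)
  moreover have "0 \<cdot>\<^sub>m 0\<^sub>m (gdim m n) (gdim m n) = (0\<^sub>m (gdim m n) (gdim m n) :: complex mat)"
    by (intro eq_matI) auto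
  ultimately show ?thesis by simp
qed

text \<open>By \<open>osp_hom_induct\<close> it suffices to test the root vectors and diagonal
  elements at the nonzero entries of \<open>A\<close>.\<close>

lemma act_in_subspace:
  assumes "subspace W" "A \<in> osp_hom m n a"
    and "\<And>i j. i = j \<and> i < gdim m n \<or> root_pair i j \<Longrightarrow> A $$ (i, j) \<noteq> 0 \<Longrightarrow> act (root_vec i j) v \<in> W"
  shows "act A v \<in> W"
  using assms(2)
proof (induction rule: osp_hom_induct)
  case zero
  then show ?case using act_zero subspace_0[OF assms(1)] by simp
next
  case (step C i j t)
  then have ij: "i < gdim m n" "j < gdim m n" by (auto simp: root_pair_def)
  have "t \<cdot>\<^sub>m root_vec i j \<in> osp m n" using smult_osp_hom root_vec_osp_hom ij osp_hom_subset_osp by blast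
  then have "act (C + t \<cdot>\<^sub>m root_vec i j) v = act C v + sc t (act (root_vec i j) v)"
    using act_add act_smult root_vec_osp[OF ij] osp_hom_subset_osp[OF step(1)] by simp
  then show ?case using step assms(1,3) by (simp add: subspace_add subspace_scale)
qed

definition singular :: "(nat \<Rightarrow> int) \<Rightarrow> 'v \<Rightarrow> bool" where
  "singular r v \<longleftrightarrow> (\<forall>i j. root_pair i j \<and> r j < r i \<longrightarrow> act (root_vec i j) v = 0)"

definition has_weight :: "weight \<Rightarrow> 'v \<Rightarrow> bool" where
  "has_weight \<mu> v \<longleftrightarrow> (\<forall>H\<in>cartan m n. act H v = sc (wt_eval m n \<mu> H) v)"

lemma singular_upper:
  assumes "singular r v" "A \<in> osp_hom m n a" "upper r A"
  shows "act A v = 0"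
proof -
  have "act A v \<in> {0}"
  proof (rule act_in_subspace[OF _ assms(2)])
    show "subspace {0}" by (rule subspace_single_0)
    fix i j assume ij: "i = j \<and> i < gdim m n \<or> root_pair i j" "A $$ (i, j) \<noteq> 0"
    then have "r j < r i" using assms(3) by (auto simp: upper_def root_pair_def)
    then show "act (root_vec i j) v \<in> {0}" using ij assms(1) by (auto simp: singular_def)
  qed
  then show ?thesis by simp
qed

lemma act_root_vec_parity:
  assumes "i < gdim m n" "j < gdim m n" "\<exists>a. v \<in> gr a"
  shows "\<exists>a. act (root_vec i j) v \<in> gr a"
  using assms act_parity[OF root_vec_osp_hom] by blast

lemma act_swap:
  assumes "A \<in> osp_hom m n a" "C \<in> osp_hom m n b"
  shows "act A (act C v) = act (super_bracket a b A C) v + sc (if a \<and> b then - 1 else 1) (act C (act A v))"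
  using act_bracket[OF assms] by simp

lemma act_cartan_root_vec:
  assumes "H \<in> cartan m n" "i < gdim m n" "j < gdim m n"
  shows "act H (act (root_vec i j) v) = sc (H $$ (i, i) - H $$ (j, j)) (act (root_vec i j) v) + act (root_vec i j) (act H v)"
  using act_swap[OF cartanD(1)[OF assms(1)] root_vec_osp_hom[OF assms(2,3)], of v]
    bracket_cartan_root_vec[OF assms] act_smult[OF root_vec_osp[OF assms(2,3)]] by simp

lemma has_weight_root_vec:
  assumes "has_weight \<mu> v" "i < gdim m n" "j < gdim m n"
  shows "has_weight (\<mu> + (index_wt i - index_wt j)) (act (root_vec i j) v)"
  unfolding has_weight_def
proof
  fix H assume H: "H \<in> cartan m n"
  have "act H (act (root_vec i j) v) = sc (H $$ (i, i) - H $$ (j, j)) (act (root_vec i j) v) + sc (wt_eval m n \<mu> H) (act (root_vec i j) v)"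
    using act_cartan_root_vec[OF H assms(2,3), of v] assms(1) H act_linearity(2)[OF root_vec_osp[OF assms(2,3)]]
    by (simp add: has_weight_def)
  then show "act H (act (root_vec i j) v) = sc (wt_eval m n (\<mu> + (index_wt i - index_wt j)) H) (act (root_vec i j) v)"
    using H assms(2,3) by (simp add: wt_eval_add wt_eval_diff wt_eval_index_wt scale_left_distrib)
qed

section \<open>The submodule generated by a singular vector\<close>

inductive_set lowered :: "(nat \<Rightarrow> int) \<Rightarrow> 'v \<Rightarrow> 'v set" for r u where
  base: "u \<in> lowered r u"
| add: "x \<in> lowered r u \<Longrightarrow> y \<in> lowered r u \<Longrightarrow> x + y \<in> lowered r u"
| scale: "x \<in> lowered r u \<Longrightarrow> sc t x \<in> lowered r u"
| lower: "x \<in> lowered r u \<Longrightarrow> root_pair i j \<Longrightarrow> r i < r j \<Longrightarrow> act (root_vec i j) x \<in> lowered r u"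

lemma lowered_subspace: "subspace (lowered r u)"
proof (rule subspaceI)
  show "0 \<in> lowered r u" using lowered.scale[OF lowered.base, where t = 0] by simp
qed (auto intro: lowered.intros)

text \<open>Submodules are required to be graded; this holds because the generator and all lowering
  operators are homogeneous.\<close>

lemma lowered_graded:
  assumes "x \<in> lowered r u" "u \<in> gr a"
  shows "\<exists>y\<in>lowered r u \<inter> gr False. \<exists>z\<in>lowered r u \<inter> gr True. x = y + z"
  using assms(1)
proof induction
  case base
  have "0 \<in> lowered r u" "0 \<in> gr b" for b
    using subspace_0 lowered_subspace gr_subspace by blast+
  then show ?case using assms(2) lowered.base[of u r] by (cases a) force+
next
  case (add x y)
  then obtain x0 x1 y0 y1 where
    *: "x0 \<in> lowered r u \<inter> gr False" "x1 \<in> lowered r u \<inter> gr True" "x = x0 + x1"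
      "y0 \<in> lowered r u \<inter> gr False" "y1 \<in> lowered r u \<inter> gr True" "y = y0 + y1" by blast
  then have "x + y = (x0 + y0) + (x1 + y1)" by (simp add: algebra_simps)
  moreover have "x0 + y0 \<in> lowered r u \<inter> gr False" "x1 + y1 \<in> lowered r u \<inter> gr True"
    using * lowered_subspace gr_subspace by (auto intro: subspace_add)
  ultimately show ?case by blast
next
  case (scale x t)
  then obtain x0 x1 where
    *: "x0 \<in> lowered r u \<inter> gr False" "x1 \<in> lowered r u \<inter> gr True" "x = x0 + x1" by blast
  then have "sc t x = sc t x0 + sc t x1" by (simp add: scale_right_distrib)
  moreover have "sc t x0 \<in> lowered r u \<inter> gr False" "sc t x1 \<in> lowered r u \<inter> gr True"
    using * lowered_subspace gr_subspace by (auto intro: subspace_scale)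
  ultimately show ?case by blast
next
  case (lower x i j)
  then obtain x0 x1 where
    *: "x0 \<in> lowered r u \<inter> gr False" "x1 \<in> lowered r u \<inter> gr True" "x = x0 + x1" by blast
  have ij: "i < gdim m n" "j < gdim m n" using lower by (auto simp: root_pair_def)
  let ?y = "act (root_vec i j) x0" and ?z = "act (root_vec i j) x1"
  have sum: "act (root_vec i j) x = ?y + ?z" "act (root_vec i j) x = ?z + ?y"
    using * act_linearity(1)[OF root_vec_osp[OF ij]] by (simp_all add: add.commute)
  have mem: "?y \<in> lowered r u" "?z \<in> lowered r u"
    using * lower by (auto intro: lowered.lower)
  have gr: "?y \<in> gr (((i < 2 * n) \<noteq> (j < 2 * n)) \<noteq> False)"
    "?z \<in> gr (((i < 2 * n) \<noteq> (j < 2 * n)) \<noteq> True)"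
    using * act_parity[OF root_vec_osp_hom[OF ij]] by blast+
  show ?case
  proof (cases "(i < 2 * n) \<noteq> (j < 2 * n)")
    case True
    then have "?z \<in> lowered r u \<inter> gr False" "?y \<in> lowered r u \<inter> gr True" using mem gr by auto
    then show ?thesis using sum(2) by blast
  next
    case False
    then have "?y \<in> lowered r u \<inter> gr False" "?z \<in> lowered r u \<inter> gr True" using mem gr by auto
    then show ?thesis using sum(1) by blast
  qed
qed

text \<open>
  The span of the vectors obtained from \<open>u\<close> by lowering operators is a submodule: the vectors that
  all of osp maps into it contain \<open>u\<close> and are again stable under lowering.
\<close>

lemma act_lowered:
  assumes u: "has_weight \<mu> u" "singular r u"
    and r: "\<And>i j. root_pair i j \<Longrightarrow> r i \<noteq> r j"
    and x: "x \<in> lowered r u"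
  shows "\<forall>a. \<forall>A\<in>osp_hom m n a. act A x \<in> lowered r u"
  using x
proof induction
  case base
  show ?case
  proof (intro allI ballI)
    fix a A assume A: "A \<in> osp_hom m n a"
    show "act A u \<in> lowered r u"
    proof (rule act_in_subspace[OF lowered_subspace A])
      fix i j assume "i = j \<and> i < gdim m n \<or> root_pair i j"
      then show "act (root_vec i j) u \<in> lowered r u"
      proof
        assume "i = j \<and> i < gdim m n"
        then have "act (root_vec i j) u = sc (wt_eval m n \<mu> (root_vec i j)) u"
          using u(1) root_vec_cartan by (auto simp: has_weight_def)
        then show ?thesis by (simp add: lowered.base lowered.scale)
      next
        assume ij: "root_pair i j"
        then consider "r i < r j" | "r j < r i" using r by (meson linorder_neqE)
        then show ?thesis
        proof cases
          case 1
          then show ?thesis using ij by (intro lowered.lower lowered.base)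
        next
          case 2
          then have "act (root_vec i j) u = 0" using u(2) ij by (auto simp: singular_def)
          then show ?thesis using subspace_0[OF lowered_subspace] by simp
        qed
      qed
    qed
  qed
next
  case (add x y)
  then show ?case
    using act_linearity(1) osp_hom_subset_osp by (metis lowered.add)
next
  case (scale x t)
  then show ?case
    using act_linearity(2) osp_hom_subset_osp by (metis lowered.scale)
next
  case (lower x i j)
  have ij: "i < gdim m n" "j < gdim m n" using lower by (auto simp: root_pair_def)
  let ?b = "(i < 2 * n) \<noteq> (j < 2 * n)"
  show ?case
  proof (intro allI ballI)
    fix a A assume A: "A \<in> osp_hom m n a"
    \<comment> \<open>The induction hypothesis covers all homogeneous elements, hence also the
      bracket that appears when \<open>A\<close> moves past the lowering operator.\<close>
    have "act (super_bracket a ?b A (root_vec i j)) x \<in> lowered r u"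
      using lower.IH bracket_osp_hom[OF A root_vec_osp_hom[OF ij]] by blast
    moreover have "act (root_vec i j) (act A x) \<in> lowered r u"
      using lower A by (intro lowered.lower) auto
    ultimately show "act A (act (root_vec i j) x) \<in> lowered r u"
      unfolding act_swap[OF A root_vec_osp_hom[OF ij]] by (intro lowered.add lowered.scale)
  qed
qed

lemma foldr_eigenvector:
  assumes D: "D \<in> osp m n" and "act D y = sc e y"
  shows "foldr (\<lambda>k x. act D x - sc (c k) x) ks y = sc (\<Prod>k\<leftarrow>ks. e - c k) y"
proof (induction ks)
  case (Cons k ks)
  then show ?case
    using assms by (simp add: act_linearity(2)[OF D] scale_left_diff_distrib left_diff_distrib mult.commute)
qed simp

text \<open>A finite product of operators D - c_k annihilates \<open>x\<close>, whereas on an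
  eigenvector with an eigenvalue different from all c_k it acts by a nonzero scalar.\<close>

lemma eigenvector_in_span:
  assumes D: "D \<in> osp m n"
    and x: "x \<in> span {y. \<exists>k::nat. act D y = sc (c k) y}"
    and e: "act D x = sc e x" "\<And>k. e \<noteq> c k"
  shows "x = 0"
proof -
  let ?T = "\<lambda>k x. act D x - sc (c k) x"
  have add: "foldr ?T ks (y + z) = foldr ?T ks y + foldr ?T ks z" for ks y z
    by (induction ks) (simp_all add: act_linearity(1)[OF D] scale_right_distrib add_diff_add)
  have scl: "foldr ?T ks (sc t y) = sc t (foldr ?T ks y)" for ks t y
    by (induction ks) (simp_all add: act_linearity(2)[OF D] scale_right_diff_distrib mult.commute)
  have "\<exists>ks. foldr ?T ks x = 0"
    using x
  proof (induction rule: span_induct_alt)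
    case base
    show ?case by (intro exI[of _ "[]"]) simp
  next
    case (step t y z)
    then obtain ks k where ks: "foldr ?T ks z = 0" "act D y = sc (c k) y" by auto
    have "foldr ?T (k # ks) (sc t y + z) = 0"
      unfolding add scl using ks act_linearity(3)[OF D] foldr_eigenvector[OF D ks(2), of c "k # ks"] by simp
    then show ?case by blast
  qed
  then obtain ks where "foldr ?T ks x = 0" by blast
  moreover have "(\<Prod>k\<leftarrow>ks. e - c k) \<noteq> 0" using e(2) by (induction ks) auto
  ultimately show ?thesis using foldr_eigenvector[OF D e(1), of c ks] by simp
qed

text \<open>By irreducibility the lowered span of \<open>u\<close> is the whole module, and every
  lowering operator decreases the eigenvalue of \<open>diag_of r\<close> by a positive integer. So
  all eigenvalues are \<open>c\<close> minus a natural number.\<close>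

lemma singular_vector_maximal:
  assumes irr: "osp_irreducible m n sc gr act"
    and r: "antisymmetric r" "\<And>i j. root_pair i j \<Longrightarrow> r i \<noteq> r j"
    and u: "u \<noteq> 0" "\<exists>a. u \<in> gr a" "singular r u" "has_weight \<mu> u" "wt_eval m n \<mu> (diag_of r) = of_int c"
    and v: "v \<noteq> 0" "has_weight \<nu> v" "wt_eval m n \<nu> (diag_of r) = of_int d"
  shows "d \<le> c"
proof (rule ccontr)
  assume "\<not> d \<le> c"
  have D: "diag_of r \<in> cartan m n" using r(1) by (auto simp: antisymmetric_def intro: diag_of_cartan)
  then have Dosp: "diag_of r \<in> osp m n" by (simp add: cartan_def)
  have "osp_submodule m n sc gr act (lowered r u)"
    unfolding osp_submodule_def
  proof (intro conjI ballI)
    show "subspace (lowered r u)" by (rule lowered_subspace)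
    show "\<exists>y\<in>lowered r u \<inter> gr False. \<exists>z\<in>lowered r u \<inter> gr True. x = y + z" if "x \<in> lowered r u" for x
      using that u(2) lowered_graded by blast
    fix A x assume A: "A \<in> osp m n" and x: "x \<in> lowered r u"
    then obtain A0 A1 where *: "A = A0 + A1" "A0 \<in> osp_hom m n False" "A1 \<in> osp_hom m n True"
      by (auto simp: osp_def)
    then have "act A x = act A0 x + act A1 x" using act_add osp_hom_subset_osp by blast
    then show "act A x \<in> lowered r u"
      using act_lowered[OF u(4,3) r(2) x] * by (auto intro: lowered.add)
  qed
  moreover have "lowered r u \<noteq> {0}" using u(1) lowered.base by blast
  ultimately have UNIV: "lowered r u = UNIV" using irr by (auto simp: osp_irreducible_def)
  let ?E = "{y. \<exists>k::nat. act (diag_of r) y = sc (of_int (c - int k)) y}"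
  have "x \<in> span ?E" if "x \<in> lowered r u" for x
    using that
  proof induction
    case base
    have "act (diag_of r) u = sc (of_int (c - int 0)) u"
      using u(4,5) D by (simp add: has_weight_def)
    then show ?case by (intro span_base) blast
  next
    case (lower x i j)
    have ij: "i < gdim m n" "j < gdim m n" using lower by (auto simp: root_pair_def)
    note lin = act_linearity[OF root_vec_osp[OF ij]]
    from lower.IH show ?case
    proof (induction rule: span_induct_alt)
      case base
      then show ?case by (simp add: lin span_zero)
    next
      case (step t y z)
      then obtain k where k: "act (diag_of r) y = sc (of_int (c - int k)) y" by blast
      have "act (diag_of r) (act (root_vec i j) y) =
          sc (of_int (r i - r j)) (act (root_vec i j) y) + sc (of_int (c - int k)) (act (root_vec i j) y)"
        using act_cartan_root_vec[OF D ij, of y] k lin(2) ij by (simp add: diag_of_def)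
      also have "\<dots> = sc (of_int (c - int (k + nat (r j - r i)))) (act (root_vec i j) y)"
        using lower.hyps by (simp add: scale_left_distrib[symmetric])
      finally have "act (root_vec i j) y \<in> ?E" by blast
      then show ?case using step by (simp add: lin span_add span_scale span_base)
    qed
  qed (auto intro: span_add span_scale)
  then have "v \<in> span ?E" using UNIV by blast
  moreover have "act (diag_of r) v = sc (of_int d) v" using v D by (simp add: has_weight_def)
  moreover have "(of_int d :: complex) \<noteq> of_int (c - int k)" for k
    using \<open>\<not> d \<le> c\<close> by (simp only: of_int_eq_iff)
  ultimately have "v = 0" using eigenvector_in_span[OF Dosp, of v "\<lambda>k. of_int (c - int k)"] by blast
  then show False using v(1) by simp
qed

end

section \<open>Strings of lowering operators and simple reflections\<close>

lemma wscale_0 [simp]: "wscale 0 \<mu> = 0"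
  by (simp add: wscale_def zero_fun_def)

lemma wscale_1 [simp]: "wscale 1 \<mu> = \<mu>"
  by (simp add: wscale_def)

lemma wscale_Suc: "wscale (int (Suc j)) \<mu> = wscale (int j) \<mu> + \<mu>"
  by (simp add: wscale_def plus_fun_def algebra_simps)

context osp_indices begin

text \<open>Under this condition \<open>index_wt k - index_wt l\<close> is a simple root for the
  order. The converse fails at a fork: the sum of the last two entries uses the ranks 2 and -1, with
  rank 1 in between.\<close>

definition adjacent :: "(nat \<Rightarrow> int) \<Rightarrow> nat \<Rightarrow> nat \<Rightarrow> bool" where
  "adjacent r k l \<longleftrightarrow> antisymmetric r \<and> inj_on r {..<gdim m n} \<and> root_pair k l \<and> r l < r k \<and>
     (\<forall>i<gdim m n. \<not> (r l < r i \<and> r i < r k))"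

text \<open>The only pairs that are positive for \<open>r'\<close> but not for \<open>r\<close> are \<open>(l, k)\<close> and its opposite.\<close>

definition reflected :: "(nat \<Rightarrow> int) \<Rightarrow> (nat \<Rightarrow> int) \<Rightarrow> nat \<Rightarrow> nat \<Rightarrow> bool" where
  "reflected r r' k l \<longleftrightarrow> (\<forall>i j. root_pair i j \<and> r' j < r' i \<longrightarrow>
     i = l \<and> j = k \<or> i = opp k \<and> j = opp l \<or>
     r j < r i \<and> \<not> (i = k \<and> j = l) \<and> \<not> (i = opp l \<and> j = opp k))"

end

context osp_module begin

definition extremal :: "(nat \<Rightarrow> int) \<Rightarrow> weight \<Rightarrow> bool" where
  "extremal r \<mu> \<longleftrightarrow> (\<exists>v. v \<noteq> 0 \<and> (\<exists>a. v \<in> gr a) \<and> has_weight \<mu> v \<and> singular r v)"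

lemma adjacentD:
  assumes "adjacent r k l"
  shows "antisymmetric r" "inj_on r {..<gdim m n}" "root_pair k l" "r l < r k"
    "k < gdim m n" "l < gdim m n" "k \<noteq> l"
    "i < gdim m n \<Longrightarrow> \<not> (r l < r i \<and> r i < r k)"
  using assms by (auto simp: adjacent_def root_pair_def)

lemma extremal_cong:
  assumes "extremal r \<mu>" "\<And>i j. root_pair i j \<Longrightarrow> r' j < r' i \<Longrightarrow> r j < r i"
  shows "extremal r' \<mu>"
  using assms unfolding extremal_def singular_def by blast

text \<open>Moving \<open>A\<close> past one lowering operator leaves its bracket with
  \<open>root_vec l k\<close>, which by \<open>upper_bracket_adjacent\<close> satisfies the same
  hypotheses; hence an induction over all such \<open>A\<close> at once.\<close>

lemma string_upper:
  assumes adj: "adjacent r k l" and v: "singular r v"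
    and A: "A \<in> osp_hom m n a" "upper r A" "A $$ (k, l) = 0"
  shows "act A ((act (root_vec l k) ^^ j) v) = 0"
  using A
proof (induction j arbitrary: A a)
  case 0
  then show ?case using singular_upper[OF v] by simp
next
  case (Suc j)
  note ad = adjacentD[OF adj]
  let ?w = "(act (root_vec l k) ^^ j) v" and ?b = "(l < 2 * n) \<noteq> (k < 2 * n)"
  note root_vec = root_vec_osp_hom[OF ad(6,5)]
  have "act (super_bracket ?b a (root_vec l k) A) ?w = 0"
    using upper_bracket_adjacent[OF ad(1-3,8) Suc.prems, of ?b] bracket_osp_hom[OF root_vec Suc.prems(1)]
    by (intro Suc.IH)
  then have "act (root_vec l k) (act A ?w) = sc (if ?b \<and> a then - 1 else 1) (act A (act (root_vec l k) ?w))"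
    using act_swap[OF root_vec Suc.prems(1), of ?w] by simp
  then have "sc (if ?b \<and> a then - 1 else 1) (act A (act (root_vec l k) ?w)) = 0"
    using Suc.IH[OF Suc.prems] act_linearity(3)[OF root_vec_osp[OF ad(6,5)]] by simp
  then show ?case by (simp split: if_splits)
qed

lemma string_root_vec:
  assumes adj: "adjacent r k l" and v: "singular r v"
    and ij: "root_pair i j" "r j < r i" "\<not> (i = k \<and> j = l)" "\<not> (i = opp l \<and> j = opp k)"
  shows "act (root_vec i j) ((act (root_vec l k) ^^ K) v) = 0"
proof -
  note ad = adjacentD[OF adj]
  have N: "i < gdim m n" "j < gdim m n" using ij(1) by (auto simp: root_pair_def)
  have "root_vec i j $$ (k, l) = 0"
  proof (rule ccontr)
    assume "root_vec i j $$ (k, l) \<noteq> 0"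
    then have "k = i \<and> l = j \<or> k = opp j \<and> l = opp i" using root_vec_support[OF N ad(5,6)] by blast
    then show False using ij(3,4) N by auto
  qed
  then show ?thesis
    using string_upper[OF adj v root_vec_osp_hom[OF N]] upper_root_vec[OF ad(1) N ij(2)] by blast
qed

lemma has_weight_string:
  assumes "has_weight \<mu> v" "k < gdim m n" "l < gdim m n"
  shows "has_weight (\<mu> + wscale (int j) (index_wt l - index_wt k)) ((act (root_vec l k) ^^ j) v)"
proof (induction j)
  case 0
  show ?case using assms(1) by (simp only: int_ops(1) wscale_0 add_0_right funpow_0)
next
  case (Suc j)
  have "\<mu> + wscale (int (Suc j)) (index_wt l - index_wt k) = \<mu> + wscale (int j) (index_wt l - index_wt k) + (index_wt l - index_wt k)"
    by (simp only: wscale_Suc add.assoc)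
  then show ?case using has_weight_root_vec[OF Suc assms(3,2)] by (simp only: funpow.simps o_apply)
qed

lemma string_homogeneous:
  assumes "\<exists>a. v \<in> gr a" "k < gdim m n" "l < gdim m n"
  shows "\<exists>a. (act (root_vec l k) ^^ j) v \<in> gr a"
  using assms by (induction j) (auto intro!: act_root_vec_parity)

text \<open>Makes the eigenvalues of \<open>diag_of r\<close> integers, so that they can be compared
  in size.\<close>

lemma wt_eval_diag_of_int: "\<exists>c. wt_eval m n \<mu> (diag_of r) = of_int c"
proof -
  have "wt_eval m n \<mu> (diag_of r) =
    of_int ((\<Sum>i=1..n. \<mu> (Del i) * r (i - 1)) + (\<Sum>j=1..m. \<mu> (Eps j) * r (2 * n + j - 1)))"
    unfolding wt_eval_def of_int_add of_int_sum
    by (intro arg_cong2[of _ _ _ _ "(+)"] sum.cong) (auto simp: diag_of_def gdim_def)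
  then show ?thesis by blast
qed

lemma singular_opp_multiple:
  assumes "k < gdim m n" "l < gdim m n" "act (root_vec k l) w = 0"
  shows "act (root_vec (opp l) (opp k)) w = 0"
  using assms act_smult[OF root_vec_osp[OF assms(1,2)]] root_vec_opp[OF assms(1,2)] by simp

text \<open>
  With \<open>F\<close> the lowering operator and \<open>w = F\<^sup>K v\<close>, the vector \<open>F w\<close> is singular for \<open>r\<close> and lies below
  \<open>v\<close>, so it vanishes by irreducibility and \<open>w\<close> is singular for the reflected order.
\<close>

lemma reflect:
  assumes irr: "osp_irreducible m n sc gr act"
    and adj: "adjacent r k l" and refl: "reflected r r' k l"
    and v: "\<exists>a. v \<in> gr a" "has_weight \<mu> v" "singular r v"
    and nz: "(act (root_vec l k) ^^ K) v \<noteq> 0"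
    and kill: "act (root_vec k l) (act (root_vec l k) ((act (root_vec l k) ^^ K) v)) = 0"
  shows "extremal r' (\<mu> + wscale (int K) (index_wt l - index_wt k))"
proof -
  note ad = adjacentD[OF adj]
  let ?w = "(act (root_vec l k) ^^ K) v" and ?u = "(act (root_vec l k) ^^ Suc K) v"
  have D: "diag_of r \<in> cartan m n" using ad(1) by (auto simp: antisymmetric_def intro: diag_of_cartan)
  have v0: "v \<noteq> 0"
  proof
    assume "v = 0"
    then have "?w = 0" using act_linearity(3)[OF root_vec_osp[OF ad(6,5)]] by (induction K) auto
    then show False using nz by simp
  qed
  have "?u = 0"
  proof (rule ccontr)
    assume u0: "?u \<noteq> 0"
    have "singular r ?u"
      unfolding singular_def
    proof (intro allI impI)
      fix i j assume ij: "root_pair i j \<and> r j < r i"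
      have "act (root_vec k l) ?u = 0" using kill by simp
      then show "act (root_vec i j) ?u = 0"
        using string_root_vec[OF adj v(3)] ij singular_opp_multiple[OF ad(5,6)] by blast
    qed
    moreover obtain c where c: "wt_eval m n \<mu> (diag_of r) = of_int c"
      using wt_eval_diag_of_int by blast
    have "diag_of r $$ (i, i) = of_int (r i)" if "i < gdim m n" for i
      using that by (simp add: diag_of_def)
    then have "wt_eval m n (\<mu> + wscale (int (Suc K)) (index_wt l - index_wt k)) (diag_of r) =
        of_int (c + int (Suc K) * (r l - r k))"
      using ad(5,6) D by (simp add: wt_eval_add wt_eval_diff wt_eval_wscale wt_eval_index_wt c)
    moreover have "r i \<noteq> r j" if "root_pair i j" for i j
      using that ad(2) by (auto simp: root_pair_def inj_on_def)
    \<comment> \<open>A nonzero singular \<open>?u\<close> would bound the eigenvalue of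
      \<open>v\<close> by its own, although each lowering step decreases the eigenvalue by
      \<open>r k - r l\<close>.\<close>
    ultimately have "c \<le> c + int (Suc K) * (r l - r k)"
      using singular_vector_maximal[OF irr ad(1) _ u0 string_homogeneous[OF v(1) ad(5,6)] _
          has_weight_string[OF v(2) ad(5,6)] _ v0 v(2) c] by blast
    moreover have "int (Suc K) * (r l - r k) < 0"
      using ad(4) by (intro mult_pos_neg) auto
    ultimately show False by linarith
  qed
  have "singular r' ?w"
    unfolding singular_def
  proof (intro allI impI)
    fix i j assume ij: "root_pair i j \<and> r' j < r' i"
    then consider "i = l \<and> j = k" | "i = opp k \<and> j = opp l" |
      "r j < r i" "\<not> (i = k \<and> j = l)" "\<not> (i = opp l \<and> j = opp k)"
      using refl unfolding reflected_def by blast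
    then show "act (root_vec i j) ?w = 0"
    proof cases
      case 1
      then show ?thesis using \<open>?u = 0\<close> by simp
    next
      case 2
      then show ?thesis using \<open>?u = 0\<close> singular_opp_multiple[OF ad(6,5), of ?w] by simp
    next
      case 3
      then show ?thesis using string_root_vec[OF adj v(3)] ij by blast
    qed
  qed
  then show ?thesis
    unfolding extremal_def
    using nz string_homogeneous[OF v(1) ad(5,6)] has_weight_string[OF v(2) ad(5,6)] by blast
qed

text \<open>The sl2 string computation: E F^(j+1) v = c (j+1) (K - j) F^j v, where the scalar is
  nonzero for j < K and zero for j = K. For the long root, \<open>l = opp k\<close>, the coroot
  eigenvalue is the single coordinate at \<open>k\<close>, whence the 0 in the hypothesis.\<close>

lemma reflect_even:
  assumes irr: "osp_irreducible m n sc gr act"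
    and adj: "adjacent r k l" and refl: "reflected r r' k l" and ex: "extremal r \<mu>"
    and even: "(k < 2 * n) = (l < 2 * n)"
    and K: "index_eval \<mu> k - (if l = opp k then 0 else index_eval \<mu> l) = int K"
  shows "extremal r' (\<mu> + wscale (int K) (index_wt l - index_wt k))"
proof -
  note ad = adjacentD[OF adj]
  obtain v where v: "v \<noteq> 0" "\<exists>a. v \<in> gr a" "has_weight \<mu> v" "singular r v"
    using ex by (auto simp: extremal_def)
  define h where "h = super_bracket False False (root_vec k l) (root_vec l k)"
  \<comment> \<open>\<open>c\<close> compares \<open>h\<close> with the coroot: it is 4 for a long
    root, whose root vectors are twice matrix units, and 1 otherwise.\<close>
  have "\<exists>c::complex. c \<noteq> 0 \<and> h \<in> cartan m n \<and> wt_eval m n \<mu> h = c * of_nat K \<and>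
     wt_eval m n (index_wt l - index_wt k) h = - 2 * c"
  proof (cases "l = opp k")
    case True
    have k2: "k < 2 * n" using ad(3) True by (simp add: root_pair_def)
    have h: "h = 4 \<cdot>\<^sub>m root_vec k k" unfolding h_def True by (rule bracket_root_vec_root_vec_opp[OF k2])
    have c: "h \<in> cartan m n" unfolding h using root_vec_cartan ad(5) by (intro smult_cartan)
    have ev: "wt_eval m n \<nu> h = 4 * of_int (index_eval \<nu> k)" for \<nu>
    proof -
      have "wt_eval m n \<nu> (4 \<cdot>\<^sub>m root_vec k k) = 4 * wt_eval m n \<nu> (root_vec k k)"
        unfolding wt_eval_def distrib_left sum_distrib_left
        by (intro arg_cong2[of _ _ _ _ "(+)"] sum.cong refl) (auto simp: gdim_def)
      then show ?thesis unfolding h wt_eval_root_vec[OF ad(5)] .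
    qed
    have "index_eval \<mu> k = int K" using K True by simp
    moreover have "index_eval (index_wt l - index_wt k) k = - 2"
      using ad(5) True by (simp add: index_eval_index_wt)
    ultimately show ?thesis using c ev[of \<mu>] ev[of "index_wt l - index_wt k"]
      by (intro exI[of _ 4]) simp
  next
    case False
    have h: "h = root_vec k k + (- 1) \<cdot>\<^sub>m root_vec l l"
      unfolding h_def using bracket_root_vec_root_vec[OF ad(3) False] even by simp
    have c: "h \<in> cartan m n" unfolding h using root_vec_cartan ad(5,6) by (intro add_cartan smult_cartan) auto
    have ev: "wt_eval m n \<nu> h = of_int (index_eval \<nu> k) - of_int (index_eval \<nu> l)" for \<nu>
    proof -
      have "wt_eval m n \<nu> (root_vec k k + (- 1) \<cdot>\<^sub>m root_vec l l) = wt_eval m n \<nu> (root_vec k k) - wt_eval m n \<nu> (root_vec l l)"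
      proof -
        have "(\<Sum>i=1..n. of_int (\<nu> (Del i)) * (root_vec k k + (- 1) \<cdot>\<^sub>m root_vec l l) $$ (i - 1, i - 1)) =
          (\<Sum>i=1..n. of_int (\<nu> (Del i)) * root_vec k k $$ (i - 1, i - 1) - of_int (\<nu> (Del i)) * root_vec l l $$ (i - 1, i - 1))"
          by (rule sum.cong) (auto simp: gdim_def algebra_simps)
        moreover have "(\<Sum>i=1..m. of_int (\<nu> (Eps i)) * (root_vec k k + (- 1) \<cdot>\<^sub>m root_vec l l) $$ (2 * n + i - 1, 2 * n + i - 1)) =
          (\<Sum>i=1..m. of_int (\<nu> (Eps i)) * root_vec k k $$ (2 * n + i - 1, 2 * n + i - 1) - of_int (\<nu> (Eps i)) * root_vec l l $$ (2 * n + i - 1, 2 * n + i - 1))"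
          by (rule sum.cong) (auto simp: gdim_def algebra_simps)
        ultimately show ?thesis by (simp add: wt_eval_def sum_subtractf)
      qed
      then show ?thesis unfolding h wt_eval_root_vec[OF ad(5)] wt_eval_root_vec[OF ad(6)] .
    qed
    have kl: "k \<noteq> opp l" using False ad(5,6) by auto
    have "index_eval \<mu> k - index_eval \<mu> l = int K" using K False by simp
    then have "wt_eval m n \<mu> h = of_int (int K)" unfolding ev of_int_diff[symmetric] by (simp only:)
    moreover have "index_eval (index_wt l - index_wt k) k = - 1" "index_eval (index_wt l - index_wt k) l = 1"
      using ad(5-7) False kl by (simp_all add: index_eval_index_wt)
    ultimately show ?thesis using c ev[of "index_wt l - index_wt k"]
      by (intro exI[of _ 1]) simp
  qed
  then obtain c :: complex where c: "c \<noteq> 0" "h \<in> cartan m n" "wt_eval m n \<mu> h = c * of_nat K"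
    "wt_eval m n (index_wt l - index_wt k) h = - 2 * c" by blast
  have E: "root_vec k l \<in> osp_hom m n False" and F: "root_vec l k \<in> osp_hom m n False"
    using root_vec_osp_hom[OF ad(5,6)] root_vec_osp_hom[OF ad(6,5)] even by simp_all
  let ?w = "\<lambda>j. (act (root_vec l k) ^^ j) v"
  have EF: "act (root_vec k l) (act (root_vec l k) w) = act h w + act (root_vec l k) (act (root_vec k l) w)" for w
    using act_swap[OF E F, of w] by (simp add: h_def)
  have step: "act (root_vec k l) (?w (Suc j)) = sc (c * of_nat (Suc j) * (of_nat K - of_nat j)) (?w j)" for j
  proof (induction j)
    case 0
    have "act (root_vec k l) v = 0" using v(4) ad(3,4) by (simp add: singular_def)
    then show ?case
      using EF[of v] act_linearity(3)[OF root_vec_osp[OF ad(6,5)]] v(3) c(2,3) by (simp add: has_weight_def)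
  next
    case (Suc j)
    have "act h (?w (Suc j)) = sc (wt_eval m n (\<mu> + wscale (int (Suc j)) (index_wt l - index_wt k)) h) (?w (Suc j))"
      using has_weight_string[OF v(3) ad(5,6)] c(2) unfolding has_weight_def by blast
    moreover have "act (root_vec k l) (?w (Suc (Suc j))) = act h (?w (Suc j)) + act (root_vec l k) (act (root_vec k l) (?w (Suc j)))"
      using EF[of "?w (Suc j)"] by simp
    moreover have "act (root_vec l k) (act (root_vec k l) (?w (Suc j))) = sc (c * of_nat (Suc j) * (of_nat K - of_nat j)) (?w (Suc j))"
      unfolding Suc act_linearity(2)[OF root_vec_osp[OF ad(6,5)]] by simp
    ultimately have "act (root_vec k l) (?w (Suc (Suc j))) =
       sc (wt_eval m n (\<mu> + wscale (int (Suc j)) (index_wt l - index_wt k)) h + c * of_nat (Suc j) * (of_nat K - of_nat j)) (?w (Suc j))"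
      by (simp only: scale_left_distrib)
    moreover have "wt_eval m n (\<mu> + wscale (int (Suc j)) (index_wt l - index_wt k)) h + c * of_nat (Suc j) * (of_nat K - of_nat j)
      = c * of_nat (Suc (Suc j)) * (of_nat K - of_nat (Suc j))"
      unfolding wt_eval_add wt_eval_wscale c(3,4) by (simp add: algebra_simps)
    ultimately show ?case by simp
  qed
  have nz: "?w j \<noteq> 0" if "j \<le> K" for j
    using that
  proof (induction j)
    case (Suc j)
    show ?case
    proof
      assume "?w (Suc j) = 0"
      then have "sc (c * of_nat (Suc j) * (of_nat K - of_nat j)) (?w j) = 0"
        using step[of j] act_linearity(3)[OF root_vec_osp[OF ad(5,6)]] by simp
      moreover have "c * of_nat (Suc j) * (of_nat K - of_nat j) \<noteq> 0"
        using Suc.prems c(1) by (auto simp del: of_nat_Suc)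
      ultimately show False using Suc by simp
    qed
  qed (use v(1) in simp)
  have "act (root_vec k l) (?w (Suc K)) = 0" using step[of K] by simp
  then show ?thesis using reflect[OF irr adj refl v(2-4) nz[of K]] by simp
qed

text \<open>As E v = 0, the vector E F v is the superbracket [E, F] applied to v, a multiple of v by
  the pairing of its weight with the isotropic root. If the pairing is nonzero then F v is nonzero,
  and F F v = 0 ends the string at K = 1; if it is zero, K = 0 already satisfies the conditions of
  \<open>reflect\<close>.\<close>

lemma reflect_odd:
  assumes irr: "osp_irreducible m n sc gr act"
    and adj: "adjacent r k l" and refl: "reflected r r' k l" and ex: "extremal r \<mu>"
    and odd: "(k < 2 * n) \<noteq> (l < 2 * n)"
  shows "extremal r' (\<mu> + wscale (if index_eval \<mu> k + index_eval \<mu> l = 0 then 0 else 1) (index_wt l - index_wt k))"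
proof -
  note ad = adjacentD[OF adj]
  obtain v where v: "v \<noteq> 0" "\<exists>a. v \<in> gr a" "has_weight \<mu> v" "singular r v"
    using ex by (auto simp: extremal_def)
  have lk: "l \<noteq> opp k" using odd ad(5) by auto
  have E: "root_vec k l \<in> osp_hom m n True" and F: "root_vec l k \<in> osp_hom m n True"
    using root_vec_osp_hom[OF ad(5,6)] root_vec_osp_hom[OF ad(6,5)] odd by simp_all
  have h: "super_bracket True True (root_vec k l) (root_vec l k) = root_vec k k + 1 \<cdot>\<^sub>m root_vec l l"
    using bracket_root_vec_root_vec[OF ad(3) lk] odd by simp
  have Ev: "act (root_vec k l) v = 0" using v(4) ad(3,4) by (simp add: singular_def)
  have "act (root_vec k l) (act (root_vec l k) v) = act (root_vec k k + 1 \<cdot>\<^sub>m root_vec l l) v"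
    using act_swap[OF E F, of v] Ev act_linearity(3)[OF root_vec_osp[OF ad(6,5)]] by (simp add: h)
  also have "\<dots> = act (root_vec k k) v + sc 1 (act (root_vec l l) v)"
  proof -
    have "1 \<cdot>\<^sub>m root_vec l l \<in> osp m n"
      using smult_osp_hom root_vec_osp_hom[OF ad(6,6)] osp_hom_subset_osp by blast
    then show ?thesis using act_add[OF root_vec_osp[OF ad(5,5)]] act_smult[OF root_vec_osp[OF ad(6,6)]] by simp
  qed
  also have "\<dots> = sc (of_int (index_eval \<mu> k + index_eval \<mu> l)) v"
    using v(3) root_vec_cartan[OF ad(5)] root_vec_cartan[OF ad(6)] wt_eval_root_vec[OF ad(5), of \<mu>] wt_eval_root_vec[OF ad(6), of \<mu>]
    by (simp add: has_weight_def scale_left_distrib)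
  finally have EF: "act (root_vec k l) (act (root_vec l k) v) = sc (of_int (index_eval \<mu> k + index_eval \<mu> l)) v" .
  show ?thesis
  proof (cases "index_eval \<mu> k + index_eval \<mu> l = 0")
    case True
    then show ?thesis
      using reflect[OF irr adj refl v(2-4), of 0] v(1) EF by simp
  next
    case False
    have "act (root_vec l k) v \<noteq> 0"
    proof
      assume "act (root_vec l k) v = 0"
      then have "sc (of_int (index_eval \<mu> k + index_eval \<mu> l)) v = 0"
        using EF act_linearity(3)[OF root_vec_osp[OF ad(5,6)]] by simp
      then show False using False v(1) by (simp only: scale_eq_0_iff of_int_eq_0_iff simp_thms)
    qed
    moreover have "act (root_vec l k) (act (root_vec l k) v) = 0"
    proof -
      have "root_vec l k * root_vec l k = 0\<^sub>m (gdim m n) (gdim m n)"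
        using ad(3,5,6) lk by (intro root_vec_square_zero) (auto simp: root_pair_def)
      then have "super_bracket True True (root_vec l k) (root_vec l k) = 0\<^sub>m (gdim m n) (gdim m n)"
        by (simp add: super_bracket_def)
      \<comment> \<open>The square of an odd element is half its superbracket with itself.\<close>
      then have "act (root_vec l k) (act (root_vec l k) v) = - act (root_vec l k) (act (root_vec l k) v)"
        using act_swap[OF F F, of v] act_zero[of v] by simp
      then have "sc 2 (act (root_vec l k) (act (root_vec l k) v)) = 0"
        by (metis add.right_inverse one_add_one scale_left_distrib scale_one)
      then show ?thesis by simp
    qed
    ultimately show ?thesis
      using reflect[OF irr adj refl v(2-4), of 1] False act_linearity(3)[OF root_vec_osp[OF ad(5,6)]]
        act_linearity(3)[OF root_vec_osp[OF ad(6,5)]] by simp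
  qed
qed

end

section \<open>Sequences\<close>

text \<open>The functional with value \<open>length f - k\<close> on the k-th entry (from 0); it orders the indices as \<open>f\<close> does.\<close>

fun rho :: "entry list \<Rightarrow> weight" where
  "rho [] = (\<lambda>c. 0)"
| "rho (x # f) = (\<lambda>c. if c = snd x then fst x * int (Suc (length f)) else rho f c)"

text \<open>
  \<open>lam_borel\<close> as a recursion along the sequence; \<open>d\<close> and \<open>e\<close> count the \<open>\<delta>\<close>- and \<open>\<epsilon>\<close>-entries
  already passed.
\<close>

fun frob_weight :: "(nat \<Rightarrow> nat) \<Rightarrow> nat \<Rightarrow> nat \<Rightarrow> entry list \<Rightarrow> weight" where
  "frob_weight lam d e [] = 0"
| "frob_weight lam d e (x # f) =
     (if is_Del (snd x) then wscale (int (lam (Suc d) - e)) (entry_wt x) + frob_weight lam (Suc d) e f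
      else wscale (int (conjugate lam (Suc e) - d)) (entry_wt x) + frob_weight lam d (Suc e) f)"

definition dels :: "entry list \<Rightarrow> nat" where
  "dels f = length (filter (\<lambda>x. is_Del (snd x)) f)"

definition epss :: "entry list \<Rightarrow> nat" where
  "epss f = length (filter (\<lambda>x. is_Eps (snd x)) f)"

lemma is_Eps_not_Del: "is_Eps c \<longleftrightarrow> \<not> is_Del c"
  by (cases c) auto

lemma frob_weight_append: "frob_weight lam d e (f @ g) = frob_weight lam d e f + frob_weight lam (d + dels f) (e + epss f) g"
  by (induction f arbitrary: d e) (auto simp: dels_def epss_def is_Eps_not_Del add.assoc)

lemma frob_weight_outside: "c \<notin> snd ` set f \<Longrightarrow> frob_weight lam d e f c = 0"
  by (induction f arbitrary: d e) (auto simp: wscale_def entry_wt_def basis_wt_def)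

lemma rho_nth:
  assumes "distinct (map snd f)" "k < length f"
  shows "rho f (snd (f ! k)) = fst (f ! k) * int (length f - k)"
  using assms
proof (induction f arbitrary: k)
  case (Cons x f)
  show ?case
  proof (cases k)
    case (Suc j)
    then have "snd (f ! j) \<noteq> snd x" using Cons.prems by (auto simp: image_iff) (metis nth_mem)
    then show ?thesis using Cons Suc by simp
  qed simp
qed simp

lemma rho_append:
  "c \<notin> snd ` set f \<Longrightarrow> rho (f @ g) c = rho g c"
  by (induction f) auto

lemma rho_cong_tail:
  assumes "length g = length h" "c \<notin> snd ` set g" "c \<notin> snd ` set h"
  shows "rho (f @ g @ b) c = rho (f @ h @ b) c"
  using assms by (induction f) (auto simp: rho_append)

text \<open>Bubble sort: \<open>front\<close> carries one element leftwards past a block, and the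
  rest is treated by induction with that element absorbed into the fixed prefix
  \<open>a\<close>.\<close>

lemma adjacent_swaps_permute:
  assumes swap: "\<And>f x y g. Q (f @ x # y # g) \<Longrightarrow> Q (f @ y # x # g)"
    and "mset f = mset g" "Q f"
  shows "Q g"
proof -
  have front: "Q (a @ z # u @ w)" if "Q (a @ u @ z # w)" for a u z w
    using that
  proof (induction u arbitrary: w rule: rev_induct)
    case (snoc y u)
    then have "Q ((a @ u) @ y # z # w)" by simp
    then have "Q (a @ u @ z # (y # w))" using swap[of "a @ u" y z w] by simp
    then show ?case using snoc.IH[of "y # w"] by simp
  qed simp
  have "Q (a @ g)" if "mset f = mset g" "Q (a @ f)" for a f
    using that
  proof (induction g arbitrary: a f)
    case (Cons z g)
    then have "z \<in> set f" by (metis list.set_intros(1) set_mset_mset)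
    then obtain u w where f: "f = u @ z # w" by (meson split_list)
    then have "Q ((a @ [z]) @ (u @ w))" using front[of a u z w] Cons.prems(2) by simp
    moreover have "mset (u @ w) = mset g" using Cons.prems(1) f by simp
    ultimately have "Q ((a @ [z]) @ g)" using Cons.IH by blast
    then show ?case by simp
  qed simp
  from this[of f "[]"] assms(2,3) show ?thesis by simp
qed

text \<open>Both sides say that the box in row d + 1 and column e + 1 belongs to the Young diagram:
  the rows that reach a given column form an initial segment.\<close>

lemma less_conjugate_iff:
  assumes "is_partition lam"
  shows "d < conjugate lam (Suc e) \<longleftrightarrow> e < lam (Suc d)"
proof -
  have mono: "lam j \<le> lam i" if "1 \<le> i" "i \<le> j" for i j
    using that(2,1)
  proof (induction rule: dec_induct)
    case (step j)
    then show ?case using assms unfolding is_partition_def by (metis le_trans)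
  qed simp
  let ?S = "{i. 1 \<le> i \<and> Suc e \<le> lam i}"
  obtain N where N: "\<And>i. i > N \<Longrightarrow> lam i = 0" using assms by (auto simp: is_partition_def)
  have fin: "finite ?S"
    by (rule finite_subset[of _ "{..N}"]) (use N in \<open>force simp: not_le[symmetric]\<close>, simp)
  show ?thesis
  proof (cases "e < lam (Suc d)")
    case True
    then have "{1..Suc d} \<subseteq> ?S" using mono by (force intro: le_trans[of "Suc e" "lam (Suc d)"])
    then have "card {1..Suc d} \<le> card ?S" using fin by (rule card_mono[rotated])
    then show ?thesis using True by (simp add: conjugate_def)
  next
    case False
    have "?S \<subseteq> {1..d}"
    proof
      fix i assume "i \<in> ?S"
      then have "1 \<le> i" "e < lam i" by auto
      moreover have "\<not> Suc d \<le> i" using mono[of "Suc d" i] False \<open>e < lam i\<close> by auto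
      ultimately show "i \<in> {1..d}" by auto
    qed
    then have "card ?S \<le> card {1..d}" by (intro card_mono) auto
    then show ?thesis using False by (simp add: conjugate_def)
  qed
qed

lemma conjugate_Suc_le:
  assumes "is_partition lam"
  shows "conjugate lam (Suc (Suc e)) \<le> conjugate lam (Suc e)"
proof (rule ccontr)
  assume "\<not> ?thesis"
  then have "conjugate lam (Suc e) < conjugate lam (Suc (Suc e))" by simp
  then have "Suc e < lam (Suc (conjugate lam (Suc e)))" using less_conjugate_iff[OF assms] by blast
  then have "e < lam (Suc (conjugate lam (Suc e)))" by simp
  then show False using less_conjugate_iff[OF assms] by blast
qed

definition flip :: "entry \<Rightarrow> entry" where
  "flip x = (- fst x, snd x)"

lemma snd_flip [simp]: "snd (flip x) = snd x" and fst_flip [simp]: "fst (flip x) = - fst x"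
  by (simp_all add: flip_def)

text \<open>Separates the signs of a sequence from the order of its coordinates, so that the two can
  be changed independently.\<close>

definition signed :: "coord set \<Rightarrow> coord list \<Rightarrow> entry list" where
  "signed S cs = map (\<lambda>c. (if c \<in> S then - 1 else 1, c)) cs"

definition toggle :: "coord set \<Rightarrow> coord set \<Rightarrow> coord set" where
  "toggle S D = (S - D) \<union> (D - S)"

definition negatives :: "entry list \<Rightarrow> coord set" where
  "negatives f = {c. (- 1, c) \<in> set f}"

section \<open>Ranks of the indices defined by a sequence\<close>

context osp_indices begin

definition valid_entry :: "entry \<Rightarrow> bool" where
  "valid_entry x \<longleftrightarrow> snd x \<in> coords m n \<and> (fst x = 1 \<or> fst x = - 1)"

definition valid_seq :: "entry list \<Rightarrow> bool" where
  "valid_seq f \<longleftrightarrow> distinct (map snd f) \<and> snd ` set f = coords m n \<and> fst ` set f \<subseteq> {1, - 1}"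

definition idx :: "entry \<Rightarrow> nat" where
  "idx x = (SOME i. i < gdim m n \<and> index_sign i = fst x \<and> index_coord i = snd x)"

lemma idx:
  assumes "valid_entry x"
  shows "idx x < gdim m n" "index_sign (idx x) = fst x" "index_coord (idx x) = snd x"
proof -
  have "\<exists>i. i < gdim m n \<and> index_sign i = fst x \<and> index_coord i = snd x"
    using assms entry_index[of "snd x" "fst x"] by (auto simp: valid_entry_def)
  then have "idx x < gdim m n \<and> index_sign (idx x) = fst x \<and> index_coord (idx x) = snd x"
    unfolding idx_def by (rule someI_ex)
  then show "idx x < gdim m n" "index_sign (idx x) = fst x" "index_coord (idx x) = snd x" by auto
qed

lemma valid_flip: "valid_entry x \<Longrightarrow> valid_entry (flip x)"
  by (auto simp: valid_entry_def)

lemma idx_flip: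
  assumes "valid_entry x"
  shows "idx (flip x) = opp (idx x)"
  using idx[OF assms] idx[OF valid_flip[OF assms]]
  by (intro index_coord_index_sign_inj) simp_all

lemma index_eval_idx: "valid_entry x \<Longrightarrow> index_eval \<mu> (idx x) = fst x * \<mu> (snd x)"
  by (simp add: index_eval_def idx)

lemma index_wt_idx: "valid_entry x \<Longrightarrow> index_wt (idx x) = entry_wt x"
  by (simp add: index_wt_def entry_wt_def idx)

lemma idx_eqI:
  assumes "valid_entry x" "i < gdim m n" "index_coord i = snd x"
  shows "i = idx x \<or> i = opp (idx x)"
  using index_coord_eq_iff[OF idx(1)[OF assms(1)] assms(2)] idx(3)[OF assms(1)] assms(3) by auto

lemma valid_seq_entry: "valid_seq f \<Longrightarrow> x \<in> set f \<Longrightarrow> valid_entry x"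
  by (auto simp: valid_seq_def valid_entry_def)

lemma idx_less_2n: "valid_entry x \<Longrightarrow> idx x < 2 * n \<longleftrightarrow> is_Del (snd x)"
  using is_Del_index_coord[of "idx x"] idx[of x] by simp

lemma antisymmetric_index_eval: "antisymmetric (index_eval \<mu>)"
  by (simp add: antisymmetric_def)

lemma rank_index:
  assumes "valid_seq f" "i < gdim m n"
  obtains k where "k < length f" "index_coord i = snd (f ! k)"
    "index_eval (rho f) i = int (length f - k) \<or> index_eval (rho f) i = - int (length f - k)"
proof -
  have "index_coord i \<in> snd ` set f" using assms index_coord_in_coords by (auto simp: valid_seq_def)
  then obtain k where k: "k < length f" "index_coord i = snd (f ! k)" by (metis imageE in_set_conv_nth)
  have "fst (f ! k) = 1 \<or> fst (f ! k) = - 1"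
    using valid_seq_entry[OF assms(1) nth_mem[OF k(1)]] by (simp add: valid_entry_def)
  then have "index_eval (rho f) i = int (length f - k) \<or> index_eval (rho f) i = - int (length f - k)"
    using rho_nth[of f k] assms(1) k index_sign_cases[of i] by (auto simp: index_eval_def valid_seq_def)
  then show ?thesis using that k by blast
qed

lemma rank_inj:
  assumes "valid_seq f"
  shows "inj_on (index_eval (rho f)) {..<gdim m n}"
proof (rule inj_onI)
  fix i j assume ij: "i \<in> {..<gdim m n}" "j \<in> {..<gdim m n}" "index_eval (rho f) i = index_eval (rho f) j"
  obtain k where k: "k < length f" "index_coord i = snd (f ! k)"
    "index_eval (rho f) i = int (length f - k) \<or> index_eval (rho f) i = - int (length f - k)"
    using rank_index[OF assms, of i] ij(1) unfolding lessThan_iff by blast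
  obtain l where l: "l < length f" "index_coord j = snd (f ! l)"
    "index_eval (rho f) j = int (length f - l) \<or> index_eval (rho f) j = - int (length f - l)"
    using rank_index[OF assms, of j] ij(2) unfolding lessThan_iff by blast
  have "k = l" using k l ij(3) by auto
  then have "index_coord i = index_coord j" using k l by simp
  then have "j = i \<or> j = opp i" using ij index_coord_eq_iff[of i j] by auto
  moreover have "j \<noteq> opp i" using ij k by auto
  ultimately show "i = j" by simp
qed

lemma rank_nth:
  assumes "valid_seq f" "k < length f"
  shows "index_eval (rho f) (idx (f ! k)) = int (length f - k)"
proof -
  have v: "valid_entry (f ! k)" using valid_seq_entry assms by simp
  then show ?thesis
    using rho_nth[of f k] assms by (auto simp: index_eval_idx valid_seq_def valid_entry_def)
qed

lemma valid_seq_swap: "valid_seq (f @ x # y # g) \<Longrightarrow> valid_seq (f @ y # x # g)"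
  by (auto simp: valid_seq_def)

lemma valid_seq_flip: "valid_seq (f @ x # g) \<Longrightarrow> valid_seq (f @ flip x # g)"
  by (auto simp: valid_seq_def)

text \<open>The swap exchanges the ranks p + 1 and p, and likewise their negatives, where
  \<open>p\<close> is one more than the length of the tail. All other ranks stay and avoid these
  four values, so only the comparison of \<open>x\<close> with \<open>y\<close> and its mirror image
  are reversed.\<close>

lemma rank_swap:
  assumes f: "valid_seq (f @ x # y # g)"
  shows "adjacent (index_eval (rho (f @ x # y # g))) (idx x) (idx y)"
    and "reflected (index_eval (rho (f @ x # y # g))) (index_eval (rho (f @ y # x # g))) (idx x) (idx y)"
proof -
  let ?f = "f @ x # y # g" and ?h = "f @ y # x # g"
  let ?r = "index_eval (rho ?f)" and ?s = "index_eval (rho ?h)" and ?k = "idx x" and ?l = "idx y"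
  have h: "valid_seq ?h" using f by (rule valid_seq_swap)
  have v: "valid_entry x" "valid_entry y" using valid_seq_entry[OF f] by auto
  have xy: "snd x \<noteq> snd y" using f by (auto simp: valid_seq_def)
  define p where "p = int (Suc (length g))"
  have r: "?r ?k = p + 1" "?r ?l = p" "?s ?k = p" "?s ?l = p + 1"
    using rank_nth[OF f, of "length f"] rank_nth[OF f, of "Suc (length f)"]
      rank_nth[OF h, of "length f"] rank_nth[OF h, of "Suc (length f)"]
    by (simp_all add: nth_append p_def)
  have N: "?k < gdim m n" "?l < gdim m n" using idx v by auto
  have ne: "?k \<noteq> ?l" "?l \<noteq> opp ?k" using idx(3)[OF v(1)] idx(3)[OF v(2)] xy N by (metis index_coord_opp)+
  have pair: "root_pair ?k ?l" using N ne by (simp add: root_pair_def)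
  have p: "p > 0" by (simp add: p_def)
  show "adjacent ?r ?k ?l"
    unfolding adjacent_def using antisymmetric_index_eval rank_inj[OF f] pair r by auto
  have other: "?s i = ?r i" if "i < gdim m n" "i \<notin> {?k, opp ?k, ?l, opp ?l}" for i
  proof -
    have "index_coord i \<noteq> snd x" "index_coord i \<noteq> snd y" using that idx_eqI v by blast+
    then have "rho ?h (index_coord i) = rho ?f (index_coord i)"
      using rho_cong_tail[of "[y, x]" "[x, y]" "index_coord i" f g] by simp
    then show ?thesis by (simp add: index_eval_def)
  qed
  have avoid: "?r i \<notin> {p, p + 1, - p, - p - 1}" if "i < gdim m n" "i \<notin> {?k, opp ?k, ?l, opp ?l}" for i
  proof -
    have "?r i \<noteq> ?r j" if "j \<in> {?k, opp ?k, ?l, opp ?l}" for j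
    proof -
      have "j < gdim m n" "i \<noteq> j" using that N \<open>i \<notin> _\<close> by auto
      then show ?thesis using rank_inj[OF f] \<open>i < gdim m n\<close> by (auto simp: inj_on_def)
    qed
    from this[of ?k] this[of "opp ?k"] this[of ?l] this[of "opp ?l"] show ?thesis using r N by simp
  qed
  have op: "?r (opp ?k) = - p - 1" "?r (opp ?l) = - p" "?s (opp ?k) = - p" "?s (opp ?l) = - p - 1"
    using r N by simp_all
  show "reflected ?r ?s ?k ?l"
    unfolding reflected_def
  proof (intro allI impI)
    fix i j assume ij: "root_pair i j \<and> ?s j < ?s i"
    then have iN: "i < gdim m n" "j < gdim m n" by (auto simp: root_pair_def)
    have split: "q = ?k \<or> q = opp ?k \<or> q = ?l \<or> q = opp ?l \<or>
       q \<notin> {?k, opp ?k, ?l, opp ?l} \<and> ?s q = ?r q \<and> (?r q > p + 1 \<or> - p < ?r q \<and> ?r q < p \<or> ?r q < - p - 1)"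
      if "q < gdim m n" for q using other[OF that] avoid[OF that] by fastforce
    show "i = ?l \<and> j = ?k \<or> i = opp ?k \<and> j = opp ?l \<or>
      ?r j < ?r i \<and> \<not> (i = ?k \<and> j = ?l) \<and> \<not> (i = opp ?l \<and> j = opp ?k)"
      using split[OF iN(1)] split[OF iN(2)] conjunct2[OF ij] r op p by smt
  qed
qed

text \<open>The last entry has the least positive rank, so that no index lies between it and its
  opposite.\<close>

lemma rank_flip_last:
  assumes f: "valid_seq (f @ [x])"
  shows "index_eval (rho (f @ [x])) (idx x) = 1" "index_eval (rho (f @ [flip x])) (idx x) = - 1"
    and "i < gdim m n \<Longrightarrow> i = idx x \<or> i = opp (idx x) \<or>
      index_eval (rho (f @ [flip x])) i = index_eval (rho (f @ [x])) i \<and> \<bar>index_eval (rho (f @ [x])) i\<bar> > 1"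
proof -
  let ?f = "f @ [x]" and ?h = "f @ [flip x]"
  have v: "valid_entry x" using valid_seq_entry[OF f] by auto
  note N = idx(1)[OF v]
  show r: "index_eval (rho ?f) (idx x) = 1"
    using rank_nth[OF f, of "length f"] by simp
  have "snd x \<notin> snd ` set f" using f by (auto simp: valid_seq_def)
  then have "rho ?h (snd x) = - rho ?f (snd x)" by (simp add: rho_append)
  then show "index_eval (rho ?h) (idx x) = - 1" using r v by (simp add: index_eval_idx)
  assume i: "i < gdim m n"
  show "i = idx x \<or> i = opp (idx x) \<or> index_eval (rho ?h) i = index_eval (rho ?f) i \<and> \<bar>index_eval (rho ?f) i\<bar> > 1"
  proof (rule ccontr)
    assume not: "\<not> ?thesis"
    then have index_coord: "index_coord i \<noteq> snd x" using idx_eqI[OF v i] by blast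
    then have "rho ?h (index_coord i) = rho ?f (index_coord i)"
      using rho_cong_tail[of "[flip x]" "[x]" "index_coord i" f "[]"] by simp
    then have "index_eval (rho ?h) i = index_eval (rho ?f) i" by (simp add: index_eval_def)
    then have "\<bar>index_eval (rho ?f) i\<bar> \<le> 1" using not by auto
    moreover obtain k where k: "k < length ?f" "index_coord i = snd (?f ! k)"
      "index_eval (rho ?f) i = int (length ?f - k) \<or> index_eval (rho ?f) i = - int (length ?f - k)"
      using rank_index[OF f i] by blast
    ultimately have "k = length f" by auto
    then show False using k(2) index_coord by simp
  qed
qed

text \<open>The pair of the long root is its own mirror image, so a single comparison is
  reversed.\<close>

lemma rank_flip_last_Del:
  assumes f: "valid_seq (f @ [x])" and x: "is_Del (snd x)"
  shows "adjacent (index_eval (rho (f @ [x]))) (idx x) (opp (idx x))"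
    and "reflected (index_eval (rho (f @ [x]))) (index_eval (rho (f @ [flip x]))) (idx x) (opp (idx x))"
proof -
  let ?k = "idx x" and ?r = "index_eval (rho (f @ [x]))" and ?s = "index_eval (rho (f @ [flip x]))"
  have v: "valid_entry x" using valid_seq_entry[OF f] by auto
  note N = idx(1)[OF v]
  have pair: "root_pair ?k (opp ?k)" using N idx_less_2n[OF v] x by (simp add: root_pair_def)
  note r = rank_flip_last[OF f]
  have op: "?r (opp ?k) = - 1" "?s (opp ?k) = 1" using r(1,2) N by simp_all
  have nb: "\<not> (?r (opp ?k) < ?r i \<and> ?r i < ?r ?k)" if "i < gdim m n" for i
    using r(3)[OF that] r(1) op by auto
  show "adjacent ?r ?k (opp ?k)"
    unfolding adjacent_def using antisymmetric_index_eval rank_inj[OF f] pair r(1) op nb by auto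
  show "reflected ?r ?s ?k (opp ?k)"
    unfolding reflected_def
  proof (intro allI impI)
    fix i j assume ij: "root_pair i j \<and> ?s j < ?s i"
    then have iN: "i < gdim m n" "j < gdim m n" by (auto simp: root_pair_def)
    show "i = opp ?k \<and> j = ?k \<or> i = opp ?k \<and> j = opp (opp ?k) \<or>
      ?r j < ?r i \<and> \<not> (i = ?k \<and> j = opp ?k) \<and> \<not> (i = opp (opp ?k) \<and> j = opp ?k)"
      unfolding opp_opp[OF N]
      using r(3)[OF iN(1)] r(3)[OF iN(2)] conjunct2[OF ij] r(1,2) op by smt
  qed
qed

text \<open>The entry \<open>\<plusminus>\<epsilon>\<close> at the end of a sequence may change its sign because \<open>\<plusminus>2\<epsilon>\<close> is not a root.\<close>

lemma rank_flip_last_Eps: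
  assumes f: "valid_seq (f @ [x])" and x: "is_Eps (snd x)"
    and ij: "root_pair i j" "index_eval (rho (f @ [flip x])) j < index_eval (rho (f @ [flip x])) i"
  shows "index_eval (rho (f @ [x])) j < index_eval (rho (f @ [x])) i"
proof -
  let ?k = "idx x" and ?r = "index_eval (rho (f @ [x]))" and ?s = "index_eval (rho (f @ [flip x]))"
  have v: "valid_entry x" using valid_seq_entry[OF f] by auto
  note N = idx(1)[OF v]
  have nd: "\<not> ?k < 2 * n" "\<not> opp ?k < 2 * n" using N idx_less_2n[OF v] x by (auto simp: is_Eps_not_Del)
  have iN: "i < gdim m n" "j < gdim m n" using ij by (auto simp: root_pair_def)
  note r = rank_flip_last[OF f]
  have op: "?r (opp ?k) = - 1" "?s (opp ?k) = 1" using r(1,2) N by simp_all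
  have "\<not> (i = ?k \<and> j = opp ?k)" "\<not> (i = opp ?k \<and> j = ?k)" "i \<noteq> j"
    using ij(1) nd N by (auto simp: root_pair_def)
  then show ?thesis
    using r(3)[OF iN(1)] r(3)[OF iN(2)] ij(2) r(1,2) op by smt
qed

end

section \<open>Extremal weights along moves of sequences\<close>

context osp_module begin

lemma reflect_swap:
  assumes irr: "osp_irreducible m n sc gr act" and f: "valid_seq (f @ x # y # g)"
    and ex: "extremal (index_eval (rho (f @ x # y # g))) \<mu>"
    and same: "is_Del (snd x) = is_Del (snd y)"
    and K: "fst x * \<mu> (snd x) - fst y * \<mu> (snd y) = int K"
  shows "extremal (index_eval (rho (f @ y # x # g))) (\<mu> + wscale (int K) (entry_wt y - entry_wt x))"
proof -
  have v: "valid_entry x" "valid_entry y" using valid_seq_entry[OF f] by auto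
  have ne: "idx y \<noteq> opp (idx x)"
  proof
    assume "idx y = opp (idx x)"
    then have "snd y = snd x" using idx(3)[OF v(1)] idx(3)[OF v(2)] idx(1)[OF v(1)] by (metis index_coord_opp)
    then show False using f by (auto simp: valid_seq_def)
  qed
  have "index_eval \<mu> (idx x) - (if idx y = opp (idx x) then 0 else index_eval \<mu> (idx y)) = int K"
    using K v ne by (simp add: index_eval_idx)
  moreover have "(idx x < 2 * n) = (idx y < 2 * n)" using v same by (simp add: idx_less_2n)
  ultimately show ?thesis
    using reflect_even[OF irr rank_swap[OF f] ex] v by (simp only: index_wt_idx)
qed

lemma reflect_swap_odd:
  assumes irr: "osp_irreducible m n sc gr act" and f: "valid_seq (f @ x # y # g)"
    and ex: "extremal (index_eval (rho (f @ x # y # g))) \<mu>"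
    and diff: "is_Del (snd x) \<noteq> is_Del (snd y)"
  shows "extremal (index_eval (rho (f @ y # x # g)))
    (\<mu> + wscale (if fst x * \<mu> (snd x) + fst y * \<mu> (snd y) = 0 then 0 else 1) (entry_wt y - entry_wt x))"
proof -
  have v: "valid_entry x" "valid_entry y" using valid_seq_entry[OF f] by auto
  have odd: "(idx x < 2 * n) \<noteq> (idx y < 2 * n)" using v diff by (simp add: idx_less_2n)
  show ?thesis
    using reflect_odd[OF irr rank_swap[OF f] ex odd] v by (simp only: index_wt_idx index_eval_idx)
qed

lemma reflect_flip_last:
  assumes irr: "osp_irreducible m n sc gr act" and f: "valid_seq (f @ [x])"
    and ex: "extremal (index_eval (rho (f @ [x]))) \<mu>" and x: "is_Del (snd x)"
    and K: "fst x * \<mu> (snd x) = int K"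
  shows "extremal (index_eval (rho (f @ [flip x]))) (\<mu> + wscale (int K) (entry_wt (flip x) - entry_wt x))"
proof -
  have v: "valid_entry x" using valid_seq_entry[OF f] by auto
  have "index_eval \<mu> (idx x) - (if opp (idx x) = opp (idx x) then 0 else index_eval \<mu> (opp (idx x))) = int K"
    using K v by (simp add: index_eval_idx)
  moreover have "(idx x < 2 * n) = (opp (idx x) < 2 * n)" using idx(1)[OF v] by simp
  ultimately have "extremal (index_eval (rho (f @ [flip x]))) (\<mu> + wscale (int K) (index_wt (idx (flip x)) - index_wt (idx x)))"
    using reflect_even[OF irr rank_flip_last_Del[OF f x] ex] idx_flip[OF v] by simp
  then show ?thesis using v valid_flip[OF v] by (simp only: index_wt_idx)
qed

text \<open>The invariant of the moves: order and block Frobenius weight change in step.\<close>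

definition hooked :: "(nat \<Rightarrow> nat) \<Rightarrow> entry list \<Rightarrow> bool" where
  "hooked lam f \<longleftrightarrow> valid_seq f \<and> extremal (index_eval (rho f)) (frob_weight lam 0 0 f)"

text \<open>\<open>U\<close> and \<open>V\<close> collect the entries before and after the two
  neighbours; they are the same for both orders because the counters agree after the pair.
  Neighbours of the same kind trade their coefficients, which decrease along the sequence as the
  partition and its conjugate do.\<close>

lemma hooked_swap:
  assumes irr: "osp_irreducible m n sc gr act" and lam: "is_partition lam"
    and P: "hooked lam (f @ x # y # g)"
  shows "hooked lam (f @ y # x # g)"
proof -
  have f: "valid_seq (f @ x # y # g)" and ex: "extremal (index_eval (rho (f @ x # y # g))) (frob_weight lam 0 0 (f @ x # y # g))"
    using P by (auto simp: hooked_def)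
  have v: "fst x * fst x = 1" "fst y * fst y = 1"
    using valid_seq_entry[OF f, of x] valid_seq_entry[OF f, of y] by (auto simp: valid_entry_def)
  have dist: "snd x \<noteq> snd y" "snd x \<notin> snd ` set f" "snd x \<notin> snd ` set g"
    "snd y \<notin> snd ` set f" "snd y \<notin> snd ` set g"
    using f by (auto simp: valid_seq_def)
  define d e where "d = dels f" and "e = epss f"
  define U where "U = frob_weight lam 0 0 f"
  define V where "V = frob_weight lam (d + dels [x, y]) (e + epss [x, y]) g"
  have out: "U (snd x) = 0" "U (snd y) = 0" "V (snd x) = 0" "V (snd y) = 0"
    using dist by (simp_all add: U_def V_def frob_weight_outside)
  have L: "frob_weight lam 0 0 (f @ x # y # g) = U + frob_weight lam d e [x, y] + V"
    using frob_weight_append[of lam 0 0 f "[x, y] @ g"] frob_weight_append[of lam d e "[x, y]" g]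
    by (simp add: U_def V_def d_def e_def add.assoc)
  have "dels [y, x] = dels [x, y]" "epss [y, x] = epss [x, y]" by (simp_all add: dels_def epss_def)
  then have L': "frob_weight lam 0 0 (f @ y # x # g) = U + frob_weight lam d e [y, x] + V"
    using frob_weight_append[of lam 0 0 f "[y, x] @ g"] frob_weight_append[of lam d e "[y, x]" g]
    by (simp add: U_def V_def d_def e_def add.assoc)
  have val: "(U + (wscale a (entry_wt x) + wscale b (entry_wt y)) + V) (snd x) = a * fst x"
    "(U + (wscale a (entry_wt x) + wscale b (entry_wt y)) + V) (snd y) = b * fst y" for a b
    using out dist by (auto simp: wscale_def entry_wt_def basis_wt_def)
  have valx: "fst x * (U + (wscale a (entry_wt x) + wscale b (entry_wt y)) + V) (snd x) = a"
    "fst y * (U + (wscale a (entry_wt x) + wscale b (entry_wt y)) + V) (snd y) = b" for a b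
    unfolding val using v by (simp_all add: algebra_simps)
  have shift: "U + (wscale a (entry_wt x) + wscale b (entry_wt y)) + V + wscale c (entry_wt y - entry_wt x) =
      U + (wscale (b + c) (entry_wt y) + wscale (a - c) (entry_wt x)) + V" for a b c
    by (rule HOL.ext) (simp add: wscale_def algebra_simps)
  have even: ?thesis if same: "is_Del (snd x) = is_Del (snd y)"
    and xy: "frob_weight lam d e [x, y] = wscale (int a) (entry_wt x) + wscale (int b) (entry_wt y)"
    and yx: "frob_weight lam d e [y, x] = wscale (int a) (entry_wt y) + wscale (int b) (entry_wt x)"
    and ab: "b \<le> a" for a b
  proof -
    have K: "fst x * (frob_weight lam 0 0 (f @ x # y # g)) (snd x) - fst y * (frob_weight lam 0 0 (f @ x # y # g)) (snd y) = int (a - b)"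
      unfolding L xy valx using ab by simp
    have "frob_weight lam 0 0 (f @ x # y # g) + wscale (int (a - b)) (entry_wt y - entry_wt x) = frob_weight lam 0 0 (f @ y # x # g)"
      unfolding L L' xy yx shift using ab by simp
    then show ?thesis
      using reflect_swap[OF irr f ex same K] valid_seq_swap[OF f] by (simp add: hooked_def)
  qed
  \<comment> \<open>If the box (d + 1, e + 1) belongs to the diagram, one unit passes from
    \<open>x\<close> to \<open>y\<close>; otherwise all four coefficients are 0. The sum of the
    coefficients \<open>a\<close> and \<open>b\<close> of the old order vanishes exactly in the
    second case, in agreement with \<open>reflect_odd\<close>.\<close>
  have odd: ?thesis if diff: "is_Del (snd x) \<noteq> is_Del (snd y)"
    and xy: "frob_weight lam d e [x, y] = wscale (int a) (entry_wt x) + wscale (int b) (entry_wt y)"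
    and yx: "frob_weight lam d e [y, x] = wscale (int b') (entry_wt y) + wscale (int a') (entry_wt x)"
    and ab: "a = 0 \<and> b = 0 \<and> a' = 0 \<and> b' = 0 \<or> a = Suc a' \<and> b' = Suc b" for a b a' b'
  proof -
    let ?t = "if fst x * (frob_weight lam 0 0 (f @ x # y # g)) (snd x) + fst y * (frob_weight lam 0 0 (f @ x # y # g)) (snd y) = 0
      then 0 else 1 :: int"
    have t: "?t = (if int a + int b = 0 then 0 else 1)" unfolding L xy valx ..
    have "frob_weight lam 0 0 (f @ x # y # g) + wscale ?t (entry_wt y - entry_wt x) = frob_weight lam 0 0 (f @ y # x # g)"
      unfolding t unfolding L L' xy yx shift using ab by (auto simp: add.commute)
    then show ?thesis
      using reflect_swap_odd[OF irr f ex diff] valid_seq_swap[OF f] by (simp add: hooked_def)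
  qed
  note iff = less_conjugate_iff[OF lam, of d e]
  consider "is_Del (snd x)" "is_Del (snd y)" | "\<not> is_Del (snd x)" "\<not> is_Del (snd y)" |
    "is_Del (snd x)" "\<not> is_Del (snd y)" | "\<not> is_Del (snd x)" "is_Del (snd y)" by blast
  then show ?thesis
  proof cases
    case 1
    have "lam (Suc (Suc d)) \<le> lam (Suc d)" using lam by (simp add: is_partition_def)
    then show ?thesis
      using 1 by (intro even[of "lam (Suc d) - e" "lam (Suc (Suc d)) - e"]) auto
  next
    case 2
    show ?thesis
      using 2 conjugate_Suc_le[OF lam, of e]
      by (intro even[of "conjugate lam (Suc e) - d" "conjugate lam (Suc (Suc e)) - d"]) auto
  next
    case 3
    show ?thesis
      using 3 iff by (intro odd[of "lam (Suc d) - e" "conjugate lam (Suc e) - Suc d"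
        "conjugate lam (Suc e) - d" "lam (Suc d) - Suc e"]) auto
  next
    case 4
    show ?thesis
      using 4 iff by (intro odd[of "conjugate lam (Suc e) - d" "lam (Suc d) - Suc e"
        "lam (Suc d) - e" "conjugate lam (Suc e) - Suc d"]) auto
  qed
qed

lemma hooked_flip_Del:
  assumes irr: "osp_irreducible m n sc gr act"
    and P: "hooked lam (f @ [x])" and x: "is_Del (snd x)"
  shows "hooked lam (f @ [flip x])"
proof -
  have f: "valid_seq (f @ [x])" and ex: "extremal (index_eval (rho (f @ [x]))) (frob_weight lam 0 0 (f @ [x]))"
    using P by (auto simp: hooked_def)
  have v: "fst x * fst x = 1"
    using valid_seq_entry[OF f, of x] by (auto simp: valid_entry_def)
  define a where "a = lam (Suc (dels f)) - epss f"
  have L: "frob_weight lam 0 0 (f @ [x]) = frob_weight lam 0 0 f + wscale (int a) (entry_wt x)"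
    "frob_weight lam 0 0 (f @ [flip x]) = frob_weight lam 0 0 f + wscale (int a) (entry_wt (flip x))"
    using x by (simp_all add: frob_weight_append a_def)
  have "snd x \<notin> snd ` set f" using f by (auto simp: valid_seq_def)
  then have "fst x * frob_weight lam 0 0 (f @ [x]) (snd x) = int a"
    unfolding L using v by (simp add: frob_weight_outside wscale_def entry_wt_def basis_wt_def algebra_simps)
  moreover have "frob_weight lam 0 0 (f @ [x]) + wscale (int a) (entry_wt (flip x) - entry_wt x) = frob_weight lam 0 0 (f @ [flip x])"
    unfolding L by (rule HOL.ext) (simp add: wscale_def algebra_simps)
  ultimately show ?thesis
    using reflect_flip_last[OF irr f ex x] valid_seq_flip[OF f] by (simp add: hooked_def)
qed

lemma extremal_flip_last_Eps:
  assumes "valid_seq (f @ [x])" "is_Eps (snd x)" "extremal (index_eval (rho (f @ [x]))) \<mu>"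
  shows "extremal (index_eval (rho (f @ [flip x]))) \<mu>"
  using extremal_cong[OF assms(3)] rank_flip_last_Eps[OF assms(1,2)] by blast

text \<open>
  Changing the sign of the last entry does not affect the positive roots, so the reflection in
  \<open>x + y\<close> becomes the swap of \<open>x\<close> and \<open>-y\<close>.
\<close>

lemma hooked_flip_Eps:
  assumes irr: "osp_irreducible m n sc gr act" and lam: "is_partition lam"
    and P: "hooked lam (f @ [x, y])" and xy: "is_Eps (snd x)" "is_Eps (snd y)"
  shows "hooked lam (f @ [flip y, flip x])"
proof -
  have f: "valid_seq (f @ [x, y])" and ex: "extremal (index_eval (rho (f @ [x, y]))) (frob_weight lam 0 0 (f @ [x, y]))"
    using P by (auto simp: hooked_def)
  have v: "fst x * fst x = 1" "fst y * fst y = 1"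
    using valid_seq_entry[OF f, of x] valid_seq_entry[OF f, of y] by (auto simp: valid_entry_def)
  have dist: "snd x \<noteq> snd y" "snd x \<notin> snd ` set f" "snd y \<notin> snd ` set f"
    using f by (auto simp: valid_seq_def)
  have nd: "\<not> is_Del (snd x)" "\<not> is_Del (snd y)" using xy by (simp_all add: is_Eps_not_Del)
  define a b where "a = conjugate lam (Suc (epss f)) - dels f"
    and "b = conjugate lam (Suc (Suc (epss f))) - dels f"
  have ab: "b \<le> a" using conjugate_Suc_le[OF lam] by (simp add: a_def b_def diff_le_mono)
  have L: "frob_weight lam 0 0 (f @ [x, y]) = frob_weight lam 0 0 f + (wscale (int a) (entry_wt x) + wscale (int b) (entry_wt y))"
    "frob_weight lam 0 0 (f @ [flip y, flip x]) = frob_weight lam 0 0 f + (wscale (int a) (entry_wt (flip y)) + wscale (int b) (entry_wt (flip x)))"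
    using nd by (simp_all add: frob_weight_append a_def b_def)
  have f1: "valid_seq (f @ [x, flip y])" using valid_seq_flip[of "f @ [x]" y "[]"] f by simp
  have e1: "extremal (index_eval (rho (f @ [x, flip y]))) (frob_weight lam 0 0 (f @ [x, y]))"
    using extremal_flip_last_Eps[of "f @ [x]" y] f ex xy by simp
  have f2: "valid_seq (f @ [flip y, x])" using valid_seq_swap[of f x "flip y" "[]"] f1 by simp
  have val: "frob_weight lam 0 0 (f @ [x, y]) (snd x) = int a * fst x" "frob_weight lam 0 0 (f @ [x, y]) (snd y) = int b * fst y"
    unfolding L using dist by (simp_all add: frob_weight_outside wscale_def entry_wt_def basis_wt_def)
  \<comment> \<open>The coefficient along \<open>flip y\<close> is -b, so the coroot eigenvalue is
    the sum a + b.\<close>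
  have K: "fst x * frob_weight lam 0 0 (f @ [x, y]) (snd x) - fst (flip y) * frob_weight lam 0 0 (f @ [x, y]) (snd (flip y)) = int (a + b)"
    unfolding snd_flip fst_flip val using v by (simp add: algebra_simps)
  have "is_Del (snd x) = is_Del (snd (flip y))" using nd by simp
  then have "extremal (index_eval (rho (f @ [flip y, x]))) (frob_weight lam 0 0 (f @ [x, y]) + wscale (int (a + b)) (entry_wt (flip y) - entry_wt x))"
    using reflect_swap[OF irr f1 e1 _ K] by blast
  moreover have "frob_weight lam 0 0 (f @ [x, y]) + wscale (int (a + b)) (entry_wt (flip y) - entry_wt x) = frob_weight lam 0 0 (f @ [flip y, flip x])"
    unfolding L by (rule HOL.ext) (simp add: wscale_def entry_wt_def algebra_simps)
  ultimately have "extremal (index_eval (rho (f @ [flip y, flip x]))) (frob_weight lam 0 0 (f @ [flip y, flip x]))"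
    using extremal_flip_last_Eps[of "f @ [flip y]" x] f2 xy by simp
  moreover have "valid_seq (f @ [flip y, flip x])" using valid_seq_flip[of "f @ [flip y]" x "[]"] f2 by simp
  ultimately show ?thesis by (simp add: hooked_def)
qed

lemma hooked_permute:
  assumes "osp_irreducible m n sc gr act" "is_partition lam" "mset f = mset g" "hooked lam f"
  shows "hooked lam g"
  using assms(3,4) by (rule adjacent_swaps_permute[of "hooked lam", rotated]) (rule hooked_swap[OF assms(1,2)])

lemma hooked_signed_permute:
  assumes "osp_irreducible m n sc gr act" "is_partition lam"
    and "mset cs = mset cs'" "hooked lam (signed S cs)"
  shows "hooked lam (signed S cs')"
  by (rule hooked_permute[OF assms(1,2) _ assms(4)]) (use assms(3) in \<open>simp add: signed_def\<close>)

text \<open>Signs can be changed only at the end of a sequence, so the coordinates concerned are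
  first moved there: a \<delta> alone, an \<epsilon> together with a second one. Hence the evenness
  condition.\<close>

lemma hooked_flip_set:
  assumes irr: "osp_irreducible m n sc gr act" and lam: "is_partition lam"
    and D: "D \<subseteq> coords m n" "even (card {c \<in> D. is_Eps c})"
    and cs: "distinct cs" "set cs = coords m n"
    and P: "hooked lam (signed S cs)"
  shows "hooked lam (signed (toggle S D) cs)"
proof -
  have "finite D" using D(1) by (rule finite_subset) (simp add: coords_def)
  then show ?thesis
    using D
  proof (induction "card D" arbitrary: D rule: less_induct)
    case less
    show ?case
    proof (cases "\<exists>c\<in>D. is_Del c")
      case True
      then obtain c where c: "c \<in> D" "is_Del c" by blast
      let ?D = "D - {c}"
      have "{d \<in> ?D. is_Eps d} = {d \<in> D. is_Eps d}" using c by (auto simp: is_Eps_not_Del)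
      then have IH: "hooked lam (signed (toggle S ?D) cs)"
        using less.prems c card_Diff1_less[of D c] by (intro less.hyps) auto
      let ?cs = "remove1 c cs"
      have ms: "mset cs = mset (?cs @ [c])" using c less.prems cs by auto
      have "hooked lam (signed (toggle S ?D) (?cs @ [c]))"
        by (rule hooked_signed_permute[OF irr lam ms IH])
      then have "hooked lam (signed (toggle S ?D) ?cs @ [flip (if c \<in> toggle S ?D then - 1 else 1, c)])"
        using c by (intro hooked_flip_Del[OF irr]) (simp_all add: signed_def)
      moreover have "signed (toggle S ?D) ?cs @ [flip (if c \<in> toggle S ?D then - 1 else 1, c)] =
          signed (toggle S D) (?cs @ [c])"
        using cs(1) c by (auto simp: signed_def toggle_def flip_def)
      ultimately show ?thesis using hooked_signed_permute[OF irr lam ms[symmetric]] by simp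
    next
      case False
      then have DE: "{c \<in> D. is_Eps c} = D" by (auto simp: is_Eps_not_Del)
      show ?thesis
      proof (cases "D = {}")
        case True
        then show ?thesis using P by (simp add: toggle_def)
      next
        case nonempty: False
        then obtain a where a: "a \<in> D" by blast
        have "D \<noteq> {a}" using less.prems(3) DE by (metis card_1_singleton_iff odd_one One_nat_def)
        then obtain b where b: "b \<in> D" "b \<noteq> a" using a by blast
        let ?D = "D - {a, b}"
        have "{a, b} \<subseteq> D" using a b by simp
        then have card: "card D = card ?D + 2"
          using card_mono[OF less.prems(1), of "{a, b}"] b by (simp add: card_Diff_subset)
        have "{c \<in> ?D. is_Eps c} = ?D" using DE by auto
        then have IH: "hooked lam (signed (toggle S ?D) cs)"
          using less card DE by (intro less.hyps) auto
        have Eps: "is_Eps a" "is_Eps b" using a b DE by auto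
        let ?cs = "remove1 b (remove1 a cs)"
        have ms: "mset cs = mset (?cs @ [a, b])"
          using a b less.prems(2) cs
          by (subst set_eq_iff_mset_eq_distinct[symmetric]) (auto simp: set_remove1_eq distinct_remove1)
        have "mset (?cs @ [b, a]) = mset (?cs @ [a, b])" by (simp add: add_mset_commute)
        then have ms': "mset (?cs @ [b, a]) = mset cs" by (rule trans[OF _ ms[symmetric]])
        let ?s = "\<lambda>c. (if c \<in> toggle S ?D then - 1 else 1, c) :: entry"
        have "hooked lam (signed (toggle S ?D) (?cs @ [a, b]))"
          by (rule hooked_signed_permute[OF irr lam ms IH])
        then have "hooked lam (signed (toggle S ?D) ?cs @ [flip (?s b), flip (?s a)])"
          using Eps by (intro hooked_flip_Eps[OF irr lam]) (simp_all add: signed_def)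
        \<comment> \<open>\<open>hooked_flip_Eps\<close> also exchanges the two entries, hence the
          order b, a.\<close>
        moreover have "signed (toggle S ?D) ?cs @ [flip (?s b), flip (?s a)] = signed (toggle S D) (?cs @ [b, a])"
          using cs(1) a b by (auto simp: signed_def toggle_def flip_def)
        ultimately show ?thesis using hooked_signed_permute[OF irr lam ms'] by simp
      qed
    qed
  qed
qed

lemma signed_negatives:
  assumes "valid_seq f"
  shows "signed (negatives f) (map snd f) = f"
proof -
  have "(if snd x \<in> negatives f then - 1 else 1, snd x) = x" if "x \<in> set f" for x
  proof -
    have "snd x \<in> negatives f \<longleftrightarrow> fst x = - 1"
    proof
      assume "snd x \<in> negatives f"
      then have "(- 1, snd x) \<in> set f" by (simp add: negatives_def)
      moreover have "inj_on snd (set f)" using assms by (simp add: valid_seq_def distinct_map)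
      ultimately have "(- 1, snd x) = x" using that by (metis inj_onD snd_conv)
      then show "fst x = - 1" by (metis fst_conv)
    next
      assume "fst x = - 1"
      then have "(- 1, snd x) = x" by (metis prod.collapse)
      then show "snd x \<in> negatives f" using that by (simp add: negatives_def)
    qed
    moreover have "fst x = 1 \<or> fst x = - 1" using assms that by (auto simp: valid_seq_def)
    ultimately show ?thesis by (auto simp: prod_eq_iff)
  qed
  then show ?thesis by (simp add: signed_def o_def map_idI)
qed

text \<open>The signs are changed first, in the coordinate order of \<open>f\<close> and along the
  symmetric difference of the two sign sets; a permutation then produces the order of
  \<open>g\<close>.\<close>

lemma hooked_all:
  assumes irr: "osp_irreducible m n sc gr act" and lam: "is_partition lam"
    and P: "hooked lam f" and g: "valid_seq g"
    and parity: "even (card {c \<in> toggle (negatives f) (negatives g). is_Eps c})"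
  shows "hooked lam g"
proof -
  let ?D = "toggle (negatives f) (negatives g)"
  have f: "valid_seq f" using P by (simp add: hooked_def)
  have "negatives h \<subseteq> coords m n" if "valid_seq h" for h
    using that by (force simp: negatives_def valid_seq_def)
  then have D: "?D \<subseteq> coords m n" using f g by (auto simp: toggle_def)
  have "hooked lam (signed (toggle (negatives f) ?D) (map snd f))"
    using f D parity P by (intro hooked_flip_set[OF irr lam]) (auto simp: valid_seq_def signed_negatives)
  moreover have "toggle (negatives f) ?D = negatives g" by (auto simp: toggle_def)
  moreover have ms: "mset (map snd f) = mset (map snd g)"
    using f g by (subst set_eq_iff_mset_eq_distinct[symmetric]) (auto simp: valid_seq_def)
  ultimately have "hooked lam (signed (negatives g) (map snd g))"
    using hooked_signed_permute[OF irr lam ms] by simp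
  then show ?thesis by (simp add: signed_negatives[OF g])
qed

end

section \<open>Block Frobenius coordinates along a sequence\<close>

lemma filter_positions_snoc:
  "filter (\<lambda>k. P (snd ((f @ [x]) ! k))) [0..<length (f @ [x])] =
     filter (\<lambda>k. P (snd (f ! k))) [0..<length f] @ (if P (snd x) then [length f] else [])"
proof -
  have "filter (\<lambda>k. P (snd ((f @ [x]) ! k))) [0..<length f] = filter (\<lambda>k. P (snd (f ! k))) [0..<length f]"
    by (rule filter_cong) (auto simp: nth_append)
  then show ?thesis by simp
qed

lemma length_filter_positions:
  "length (filter (\<lambda>k. P (snd (f ! k))) [0..<length f]) = length (filter (\<lambda>x. P (snd x)) f)"
  by (induction f rule: rev_induct) (simp_all add: filter_positions_snoc[unfolded length_append_singleton] del: upt_Suc)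

lemma card_prefix_positions:
  "card {k. k < length f \<and> P (snd ((f @ g) ! k))} = length (filter (\<lambda>x. P (snd x)) f)"
proof -
  have "{k. k < length f \<and> P (snd ((f @ g) ! k))} = {k. k < length f \<and> P (snd (f ! k))}"
    by (auto simp: nth_append)
  then show ?thesis by (simp add: length_filter_conv_card)
qed

lemma del_pos_snoc:
  assumes "i \<in> {1..dels f}"
  shows "del_pos (f @ [x]) i = del_pos f i" "del_pos f i < length f"
proof -
  let ?l = "filter (\<lambda>k. is_Del (snd (f ! k))) [0..<length f]"
  have i: "i - 1 < length ?l" using assms by (auto simp: length_filter_positions dels_def)
  show "del_pos (f @ [x]) i = del_pos f i"
    unfolding del_pos_def filter_positions_snoc using i by (simp add: nth_append)
  have "?l ! (i - 1) \<in> set ?l" using i by (rule nth_mem)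
  then show "del_pos f i < length f" by (simp add: del_pos_def)
qed

lemma eps_pos_snoc:
  assumes "i \<in> {1..epss f}"
  shows "eps_pos (f @ [x]) i = eps_pos f i" "eps_pos f i < length f"
proof -
  let ?l = "filter (\<lambda>k. is_Eps (snd (f ! k))) [0..<length f]"
  have i: "i - 1 < length ?l" using assms by (auto simp: length_filter_positions epss_def)
  show "eps_pos (f @ [x]) i = eps_pos f i"
    unfolding eps_pos_def filter_positions_snoc using i by (simp add: nth_append)
  have "?l ! (i - 1) \<in> set ?l" using i by (rule nth_mem)
  then show "eps_pos f i < length f" by (simp add: eps_pos_def)
qed

lemma del_pos_last: "is_Del (snd x) \<Longrightarrow> del_pos (f @ [x]) (Suc (dels f)) = length f"
  unfolding del_pos_def filter_positions_snoc by (simp add: nth_append length_filter_positions dels_def)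

lemma eps_pos_last: "is_Eps (snd x) \<Longrightarrow> eps_pos (f @ [x]) (Suc (epss f)) = length f"
  unfolding eps_pos_def filter_positions_snoc by (simp add: nth_append length_filter_positions epss_def)

lemma card_less_cong:
  "p < length f \<Longrightarrow> {k. k < p \<and> P (snd ((f @ g) ! k))} = {k. k < p \<and> P (snd (f ! k))}"
  by (auto simp: nth_append)

lemma frob_p_snoc: "i \<in> {1..dels f} \<Longrightarrow> frob_p lam (f @ [x]) i = frob_p lam f i"
  by (simp only: frob_p_def del_pos_snoc card_less_cong[OF del_pos_snoc(2)])

lemma frob_q_snoc: "i \<in> {1..epss f} \<Longrightarrow> frob_q lam (f @ [x]) i = frob_q lam f i"
  by (simp only: frob_q_def eps_pos_snoc card_less_cong[OF eps_pos_snoc(2)])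

lemma frob_p_last: "is_Del (snd x) \<Longrightarrow> frob_p lam (f @ [x]) (Suc (dels f)) = lam (Suc (dels f)) - epss f"
  by (simp only: frob_p_def del_pos_last card_prefix_positions[of f is_Eps "[x]"] epss_def)

lemma frob_q_last:
  "is_Eps (snd x) \<Longrightarrow> frob_q lam (f @ [x]) (Suc (epss f)) = conjugate lam (Suc (epss f)) - dels f"
  by (simp only: frob_q_def eps_pos_last card_prefix_positions[of f is_Del "[x]"] dels_def)

text \<open>Induction from the right: appending an entry leaves the positions and counts of all
  earlier entries unchanged. Writing \<open>epss f\<close> and \<open>dels f\<close> for m and n
  lets the statement pass to prefixes.\<close>

lemma lam_borel_eq_frob_weight: "lam_borel (epss f) (dels f) lam f = frob_weight lam 0 0 f"
proof (induction f rule: rev_induct)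
  case Nil
  then show ?case by (simp add: lam_borel_def dels_def epss_def)
next
  case (snoc x f)
  have D: "(\<Sum>i=1..dels f. wscale (int (frob_p lam (f @ [x]) i)) (entry_wt ((f @ [x]) ! del_pos (f @ [x]) i))) =
      (\<Sum>i=1..dels f. wscale (int (frob_p lam f i)) (entry_wt (f ! del_pos f i)))"
    by (rule sum.cong[OF refl]) (simp only: frob_p_snoc del_pos_snoc nth_append if_True)
  have E: "(\<Sum>i=1..epss f. wscale (int (frob_q lam (f @ [x]) i)) (entry_wt ((f @ [x]) ! eps_pos (f @ [x]) i))) =
      (\<Sum>i=1..epss f. wscale (int (frob_q lam f i)) (entry_wt (f ! eps_pos f i)))"
    by (rule sum.cong[OF refl]) (simp only: frob_q_snoc eps_pos_snoc nth_append if_True)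
  show ?case
  proof (cases "is_Del (snd x)")
    case True
    then have "dels (f @ [x]) = Suc (dels f)" "epss (f @ [x]) = epss f"
      by (simp_all add: dels_def epss_def is_Eps_not_Del)
    then have "lam_borel (epss (f @ [x])) (dels (f @ [x])) lam (f @ [x]) =
       lam_borel (epss f) (dels f) lam f + wscale (int (lam (Suc (dels f)) - epss f)) (entry_wt x)"
      using True D E by (simp add: lam_borel_def del_pos_last frob_p_last)
    then show ?thesis using snoc True by (simp add: frob_weight_append)
  next
    case False
    then have Eps: "is_Eps (snd x)" by (simp add: is_Eps_not_Del)
    have "dels (f @ [x]) = dels f" "epss (f @ [x]) = Suc (epss f)"
      using False by (simp_all add: dels_def epss_def is_Eps_not_Del)
    then have "lam_borel (epss (f @ [x])) (dels (f @ [x])) lam (f @ [x]) =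
       lam_borel (epss f) (dels f) lam f + wscale (int (conjugate lam (Suc (epss f)) - dels f)) (entry_wt x)"
      using Eps D E by (simp add: lam_borel_def eps_pos_last frob_q_last)
    then show ?thesis using snoc False by (simp add: frob_weight_append)
  qed
qed

text \<open>The last \<epsilon>-entry is the last entry of the sequence, so negating its term
  amounts to flipping that entry.\<close>

lemma lam_borel_minus_eq_frob_weight:
  assumes "is_Eps (snd x)"
  shows "lam_borel_minus (epss (f @ [x])) (dels (f @ [x])) lam (f @ [x]) = frob_weight lam 0 0 (f @ [flip x])"
proof -
  let ?f = "f @ [x]"
  have de: "dels ?f = dels f" "epss ?f = Suc (epss f)"
    using assms by (simp_all add: dels_def epss_def is_Eps_not_Del)
  have "lam_borel_minus (epss ?f) (dels ?f) lam ?f = lam_borel (epss ?f) (dels ?f) lam ?f -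
      wscale (int (conjugate lam (Suc (epss f)) - dels f)) (entry_wt x) -
      wscale (int (conjugate lam (Suc (epss f)) - dels f)) (entry_wt x)"
    unfolding de using assms by (simp add: lam_borel_def lam_borel_minus_def eps_pos_last frob_q_last)
  also have "\<dots> = frob_weight lam 0 0 f - wscale (int (conjugate lam (Suc (epss f)) - dels f)) (entry_wt x)"
    unfolding lam_borel_eq_frob_weight using assms by (simp add: frob_weight_append is_Eps_not_Del)
  also have "\<dots> = frob_weight lam 0 0 (f @ [flip x])"
    using assms by (simp add: frob_weight_append is_Eps_not_Del) (simp add: fun_eq_iff wscale_def entry_wt_def)
  finally show ?thesis .
qed

definition neg_eps :: "entry list \<Rightarrow> nat" where
  "neg_eps f = length (filter (\<lambda>x. is_Eps (snd x) \<and> fst x = - 1) f)"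

lemma seq_sign_eq:
  assumes "fst ` set f \<subseteq> {1, - 1}"
  shows "seq_sign (epss f) f = (- 1) ^ neg_eps f"
  using assms
proof (induction f rule: rev_induct)
  case Nil
  then show ?case by (simp add: seq_sign_def neg_eps_def epss_def)
next
  case (snoc x f)
  have E: "(\<Prod>j=1..epss f. fst ((f @ [x]) ! eps_pos (f @ [x]) j)) = (\<Prod>j=1..epss f. fst (f ! eps_pos f j))"
    by (rule prod.cong[OF refl]) (simp only: eps_pos_snoc nth_append if_True)
  show ?case
  proof (cases "is_Eps (snd x)")
    case True
    then have "epss (f @ [x]) = Suc (epss f)" by (simp add: epss_def)
    then have "seq_sign (epss (f @ [x])) (f @ [x]) = seq_sign (epss f) f * fst x"
      using True E by (simp add: seq_sign_def eps_pos_last)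
    then show ?thesis using snoc True by (auto simp: neg_eps_def)
  next
    case False
    then have "epss (f @ [x]) = epss f" by (simp add: epss_def)
    then show ?thesis using snoc False E by (auto simp: neg_eps_def seq_sign_def)
  qed
qed

lemma neg_eps_card:
  assumes "distinct (map snd f)"
  shows "card {c \<in> negatives f. is_Eps c} = neg_eps f"
proof -
  let ?l = "filter (\<lambda>x. is_Eps (snd x) \<and> fst x = - 1) f"
  have "{c \<in> negatives f. is_Eps c} = set (map snd ?l)" by (force simp: negatives_def)
  moreover have "distinct (map snd ?l)" using assms by (rule distinct_map_filter)
  ultimately show ?thesis by (simp only: distinct_card length_map neg_eps_def)
qed

section \<open>Nonnegative combinations of simple roots\<close>

lemma nonneg_comb_add:
  assumes "a \<in> nonneg_comb S" "b \<in> nonneg_comb S"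
  shows "a + b \<in> nonneg_comb S"
proof -
  obtain k l where "a = (\<Sum>\<beta>\<in>S. wscale (int (k \<beta>)) \<beta>)" "b = (\<Sum>\<beta>\<in>S. wscale (int (l \<beta>)) \<beta>)"
    using assms by (auto simp: nonneg_comb_def)
  then have "a + b = (\<Sum>\<beta>\<in>S. wscale (int (k \<beta>)) \<beta> + wscale (int (l \<beta>)) \<beta>)"
    by (simp add: sum.distrib)
  also have "\<dots> = (\<Sum>\<beta>\<in>S. wscale (int (k \<beta> + l \<beta>)) \<beta>)"
    by (rule sum.cong[OF refl]) (simp add: wscale_def fun_eq_iff algebra_simps)
  finally show ?thesis
    unfolding nonneg_comb_def mem_Collect_eq
    by (intro exI[of _ "\<lambda>\<beta>. k \<beta> + l \<beta>"] conjI TrueI)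
qed

lemma nonneg_comb_zero: "0 \<in> nonneg_comb S"
proof -
  have "0 = (\<Sum>\<beta>\<in>S. wscale (int 0) \<beta>)" by simp
  then show ?thesis
    unfolding nonneg_comb_def mem_Collect_eq by (intro exI[of _ "\<lambda>_. 0"] conjI TrueI)
qed

lemma nonneg_comb_base:
  assumes "finite S" "a \<in> S"
  shows "a \<in> nonneg_comb S"
proof -
  have "(\<Sum>\<beta>\<in>S. wscale (int (if \<beta> = a then 1 else 0)) \<beta>) = (\<Sum>\<beta>\<in>S. if \<beta> = a then a else 0)"
    by (rule sum.cong) auto
  also have "\<dots> = a" using assms by simp
  finally have "a = (\<Sum>\<beta>\<in>S. wscale (int (if \<beta> = a then 1 else 0)) \<beta>)" ..
  then show ?thesis
    unfolding nonneg_comb_def mem_Collect_eq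
    by (intro exI[of _ "\<lambda>\<beta>. if \<beta> = a then 1 else 0"] conjI TrueI)
qed

text \<open>Differences telescope, and two such differences reduce a sum to the fork root of the
  last two entries. Twice the last entry is left out: it would need the last difference with a
  negative coefficient.\<close>

lemma nonneg_comb_seq_simple:
  assumes len: "2 \<le> length f" and last: "is_Eps (snd (last f))"
  defines "C \<equiv> nonneg_comb (seq_simple f)" and "w \<equiv> \<lambda>k. entry_wt (f ! k)"
  shows "a \<le> b \<Longrightarrow> b < length f \<Longrightarrow> w a - w b \<in> C"
    and "a < length f \<Longrightarrow> b < length f \<Longrightarrow> a \<noteq> b \<or> Suc a < length f \<Longrightarrow> w a + w b \<in> C"
proof -
  have fin: "finite (seq_simple f)"
  proof -
    have "{entry_wt (f ! k) - entry_wt (f ! Suc k) | k. Suc k < length f} =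
      (\<lambda>k. entry_wt (f ! k) - entry_wt (f ! Suc k)) ` {k. Suc k < length f}" by auto
    moreover have "finite {k. Suc k < length f}" by (rule finite_subset[of _ "{..<length f}"]) auto
    ultimately show ?thesis by (auto simp: seq_simple_def)
  qed
  have add: "u \<in> C \<Longrightarrow> v \<in> C \<Longrightarrow> u + v \<in> C" for u v unfolding C_def by (rule nonneg_comb_add)
  have base: "w k - w (Suc k) \<in> C" if "Suc k < length f" for k
    unfolding C_def w_def by (rule nonneg_comb_base[OF fin]) (use that in \<open>auto simp: seq_simple_def\<close>)
  let ?N = "length f"
  have fork: "w (?N - 2) + w (?N - 1) \<in> C"
    unfolding C_def w_def by (rule nonneg_comb_base[OF fin]) (use last in \<open>simp add: seq_simple_def is_Eps_not_Del\<close>)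
  have diff: "w a - w b \<in> C" if "a \<le> b" "b < ?N" for a b
    using that
  proof (induction rule: dec_induct)
    case base
    show ?case unfolding C_def diff_self by (rule nonneg_comb_zero)
  next
    case (step b)
    have "w a - w b \<in> C" by (rule step.IH) (use step.prems in linarith)
    then have "(w a - w b) + (w b - w (Suc b)) \<in> C" by (rule add) (rule base[OF step.prems])
    moreover have "(w a - w b) + (w b - w (Suc b)) = w a - w (Suc b)" by (rule HOL.ext) simp
    ultimately show ?case by (simp only:)
  qed
  then show "a \<le> b \<Longrightarrow> b < length f \<Longrightarrow> w a - w b \<in> C" .
  have sum: "w a + w b \<in> C" if "a \<le> b" "b < ?N" "Suc a < ?N" for a b
  proof -
    have "(w a - w (?N - 2)) + (w b - w (?N - 1)) + (w (?N - 2) + w (?N - 1)) \<in> C"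
      by (intro add fork diff) (use that in auto)
    moreover have "(w a - w (?N - 2)) + (w b - w (?N - 1)) + (w (?N - 2) + w (?N - 1)) = w a + w b"
      by (rule HOL.ext) simp
    ultimately show ?thesis by (simp only:)
  qed
  assume ab: "a < length f" "b < length f" "a \<noteq> b \<or> Suc a < length f"
  show "w a + w b \<in> C"
  proof (cases "a \<le> b")
    case True
    then show ?thesis by (intro sum) (use ab in auto)
  next
    case False
    have "w b + w a \<in> C" by (intro sum) (use ab False in auto)
    then show ?thesis by (simp only: add.commute)
  qed
qed

section \<open>Weights of the standard sequence\<close>

lemma frob_weight_Del_block:
  "frob_weight lam 0 0 (map (\<lambda>i. (1, Del i)) [1..<Suc n]) = (\<Sum>i=1..n. wscale (int (lam i)) (basis_wt (Del i)))"
proof (induction n)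
  case (Suc n)
  have "dels (map (\<lambda>i. (1, Del i)) [1..<Suc n]) = n" "epss (map (\<lambda>i. (1, Del i)) [1..<Suc n]) = 0"
    by (simp_all add: dels_def epss_def filter_map o_def del: upt_Suc)
  then show ?case
    using Suc by (simp add: frob_weight_append entry_wt_def)
qed simp

lemma frob_weight_Eps_block:
  "frob_weight lam d 0 (map (\<lambda>j. (1, Eps j)) [1..<Suc m]) =
    (\<Sum>j=1..m. wscale (int (conjugate lam j - d)) (basis_wt (Eps j)))"
proof (induction m)
  case (Suc m)
  have "dels (map (\<lambda>j. (1, Eps j)) [1..<Suc m]) = 0" "epss (map (\<lambda>j. (1, Eps j)) [1..<Suc m]) = m"
    by (simp_all add: dels_def epss_def filter_map o_def del: upt_Suc)
  then show ?case
    using Suc by (simp add: frob_weight_append entry_wt_def)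
qed simp

text \<open>Removing the first n rows shortens each column by n, truncated at 0. The two numbers are
  compared through the \<open>d\<close> below them, which turns both sides into conditions on the
  same box.\<close>

lemma hook_nu_eq:
  assumes "is_partition lam" "1 \<le> j"
  shows "hook_nu n lam j = conjugate lam j - n"
proof -
  obtain e where j: "j = Suc e" using assms(2) by (cases j) auto
  have "is_partition (\<lambda>i. lam (n + i))"
    using assms(1) unfolding is_partition_def by (metis add_Suc_right le_add2 le_trans trans_less_add2)
  then have "d < hook_nu n lam j \<longleftrightarrow> d < conjugate lam j - n" for d
    using less_conjugate_iff[of "\<lambda>i. lam (n + i)" d e] less_conjugate_iff[OF assms(1), of "n + d" e]
    unfolding hook_nu_def j by auto
  then show ?thesis by (metis linorder_neqE_nat less_irrefl)
qed

lemma frob_weight_std_seq: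
  assumes "is_partition lam"
  shows "frob_weight lam 0 0 (std_seq m n) = lam_sharp m n lam"
proof -
  have "dels (map (\<lambda>i. (1, Del i)) [1..<Suc n]) = n" "epss (map (\<lambda>i. (1, Del i)) [1..<Suc n]) = 0"
    by (simp_all add: dels_def epss_def filter_map o_def del: upt_Suc)
  then have "frob_weight lam 0 0 (std_seq m n) = (\<Sum>i=1..n. wscale (int (lam i)) (basis_wt (Del i))) +
      (\<Sum>j=1..m. wscale (int (conjugate lam j - n)) (basis_wt (Eps j)))"
    unfolding std_seq_def frob_weight_append frob_weight_Del_block by (simp only: frob_weight_Eps_block add_0)
  also have "(\<Sum>j=1..m. wscale (int (conjugate lam j - n)) (basis_wt (Eps j))) =
      (\<Sum>j=1..m. wscale (int (hook_nu n lam j)) (basis_wt (Eps j)))"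
    using hook_nu_eq[OF assms] by (intro sum.cong) auto
  finally show ?thesis by (simp only: lam_sharp_def)
qed

lemma lam_sharp_minus_eq:
  "1 \<le> m \<Longrightarrow> lam_sharp_minus m n lam = lam_sharp m n lam -
    wscale (2 * int (hook_nu n lam m)) (basis_wt (Eps m))"
proof -
  assume "1 \<le> m"
  then obtain k where m: "m = Suc k" by (cases m) auto
  show ?thesis
    unfolding m lam_sharp_def lam_sharp_minus_def
    by (simp add: fun_eq_iff wscale_def algebra_simps)
qed

definition std_front :: "nat \<Rightarrow> nat \<Rightarrow> entry list" where
  "std_front m n = map (\<lambda>i. (1, Del i)) [1..<Suc n] @ map (\<lambda>j. (1, Eps j)) [1..<m]"

lemma std_seq_snoc: "1 \<le> m \<Longrightarrow> std_seq m n = std_front m n @ [(1, Eps m)]"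
  by (simp add: std_seq_def std_front_def)

lemma frob_weight_std_seq_flip:
  assumes "is_partition lam" "1 \<le> m"
  shows "frob_weight lam 0 0 (std_front m n @ [flip (1, Eps m)]) = lam_sharp_minus m n lam"
proof -
  have "dels (std_front m n) = n" "epss (std_front m n) = m - 1"
    by (simp_all add: dels_def epss_def std_front_def filter_map o_def del: upt_Suc)
  then have "frob_weight lam 0 0 (std_front m n @ [flip (1, Eps m)]) = frob_weight lam 0 0 (std_seq m n) -
      wscale (2 * int (conjugate lam m - n)) (basis_wt (Eps m))"
    using assms(2) unfolding std_seq_snoc[OF assms(2)] frob_weight_append
    by (simp add: flip_def entry_wt_def) (simp add: fun_eq_iff wscale_def algebra_simps)
  then show ?thesis
    by (simp only: frob_weight_std_seq[OF assms(1)] hook_nu_eq[OF assms] lam_sharp_minus_eq[OF assms(2)])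
qed

section \<open>Borel subalgebras\<close>

context osp_indices begin

lemma valid_seq_dels_epss:
  assumes "valid_seq f"
  shows "dels f = n" "epss f = m" "length f = n + m"
proof -
  have count: "length (filter (\<lambda>x. P (snd x)) f) = card {c \<in> coords m n. P c}" for P
  proof -
    let ?l = "filter (\<lambda>x. P (snd x)) f"
    have "set (map snd ?l) = {c \<in> coords m n. P c}"
      using assms by (force simp: valid_seq_def)
    moreover have "distinct (map snd ?l)"
      using assms by (intro distinct_map_filter) (simp add: valid_seq_def)
    ultimately show ?thesis by (metis distinct_card length_map)
  qed
  have "{c \<in> coords m n. is_Del c} = Del ` {1..n}" "{c \<in> coords m n. is_Eps c} = Eps ` {1..m}"
    by (auto simp: coords_def)
  then show de: "dels f = n" "epss f = m"
    unfolding dels_def epss_def count by (simp_all add: card_image inj_on_def)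
  have "length f = dels f + epss f"
    unfolding dels_def epss_def is_Eps_not_Del by (rule sum_length_filter_compl[symmetric])
  then show "length f = n + m" using de by simp
qed

lemma index_entry:
  assumes "valid_seq f" "i < gdim m n"
  obtains k where "k < length f" "i = idx (f ! k) \<or> i = opp (idx (f ! k))"
proof -
  have "index_coord i \<in> snd ` set f" using assms index_coord_in_coords by (auto simp: valid_seq_def)
  then obtain k where "k < length f" "index_coord i = snd (f ! k)" by (metis imageE in_set_conv_nth)
  then show ?thesis using that idx_eqI[OF valid_seq_entry[OF assms(1)] assms(2)] by auto
qed

lemma index_wt_opp: "i < gdim m n \<Longrightarrow> index_wt (opp i) = - index_wt i"
  by (simp add: index_wt_def wscale_def fun_eq_iff)

text \<open>Links the order of \<open>f\<close> with \<open>std_borel\<close>, whose positive roots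
  are defined as nonnegative combinations of simple roots.\<close>

lemma positive_pair_nonneg_comb:
  assumes f: "valid_seq f" and last: "is_Eps (snd (last f))" and len: "2 \<le> length f"
    and ij: "root_pair i j" "index_eval (rho f) j < index_eval (rho f) i"
  shows "index_wt i - index_wt j \<in> nonneg_comb (seq_simple f)"
proof -
  let ?N = "length f"
  note comb = nonneg_comb_seq_simple[OF len last]
  have iN: "i < gdim m n" "j < gdim m n" using ij(1) by (auto simp: root_pair_def)
  obtain a where a: "a < ?N" "i = idx (f ! a) \<or> i = opp (idx (f ! a))" using index_entry[OF f iN(1)] .
  obtain b where b: "b < ?N" "j = idx (f ! b) \<or> j = opp (idx (f ! b))" using index_entry[OF f iN(2)] .
  have v: "valid_entry (f ! a)" "valid_entry (f ! b)" using valid_seq_entry[OF f] a b by auto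
  note N = idx(1)[OF v(1)] idx(1)[OF v(2)]
  have r: "index_eval (rho f) (idx (f ! a)) = int (?N - a)" "index_eval (rho f) (idx (f ! b)) = int (?N - b)"
    using rank_nth[OF f] a b by auto
  have ro: "index_eval (rho f) (opp (idx (f ! a))) = - int (?N - a)" "index_eval (rho f) (opp (idx (f ! b))) = - int (?N - b)"
    using r N by simp_all
  have w: "index_wt (idx (f ! a)) = entry_wt (f ! a)" "index_wt (idx (f ! b)) = entry_wt (f ! b)"
    "index_wt (opp (idx (f ! a))) = - entry_wt (f ! a)" "index_wt (opp (idx (f ! b))) = - entry_wt (f ! b)"
    using v N by (simp_all only: index_wt_opp index_wt_idx)
  consider "i = idx (f ! a)" "j = idx (f ! b)" | "i = idx (f ! a)" "j = opp (idx (f ! b))" |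
    "i = opp (idx (f ! a))" "j = idx (f ! b)" | "i = opp (idx (f ! a))" "j = opp (idx (f ! b))"
    using a b by blast
  then show ?thesis
  proof cases
    case 1
    then have "a \<le> b" using ij(2) r by simp
    then show ?thesis using comb(1)[of a b] b(1) by (simp only: 1 w)
  next
    case 2
    \<comment> \<open>Otherwise the root would be twice the last entry, an \<epsilon>, which
      \<open>root_pair\<close> excludes.\<close>
    have "a \<noteq> b \<or> Suc a < ?N"
    proof (rule ccontr)
      assume "\<not> ?thesis"
      then have "a = b" "a = length f - 1" using a(1) by linarith+
      moreover have "f \<noteq> []" using a(1) by auto
      ultimately have ab: "a = b" "f ! a = last f" by (simp_all add: last_conv_nth)
      then have "idx (f ! a) < 2 * n" using ij(1) 2 by (simp add: root_pair_def)
      then show False using idx_less_2n[OF v(1)] ab last by (simp add: is_Eps_not_Del)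
    qed
    then have "entry_wt (f ! a) + entry_wt (f ! b) \<in> nonneg_comb (seq_simple f)"
      using comb(2)[of a b] a(1) b(1) by blast
    then show ?thesis by (simp only: 2 w diff_minus_eq_add)
  next
    case 3
    then show ?thesis using ij(2) r ro a(1) b(1) by simp
  next
    case 4
    then have "b \<le> a" using ij(2) ro by simp
    then have "entry_wt (f ! b) - entry_wt (f ! a) \<in> nonneg_comb (seq_simple f)"
      using comb(1)[of b a] a(1) by blast
    then show ?thesis by (simp only: 4 w minus_diff_minus minus_diff_eq)
  qed
qed

lemma std_seq_valid: "valid_seq (std_seq m n)"
proof -
  have "snd ` set (std_seq m n) = coords m n"
    by (simp add: std_seq_def coords_def image_Un image_image atLeastLessThanSuc_atLeastAtMost del: upt_Suc)
  then show ?thesis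
    by (auto simp: valid_seq_def std_seq_def distinct_map inj_on_def o_def simp del: upt_Suc)
qed

lemma positive_pair_std_borel:
  assumes mn: "1 \<le> m" "1 \<le> n"
    and ij: "root_pair i j" "index_eval (rho (std_seq m n)) j < index_eval (rho (std_seq m n)) i"
  shows "index_wt i - index_wt j \<in> pos_roots m n (std_borel m n)"
proof -
  have len: "2 \<le> length (std_seq m n)" using mn by (simp add: std_seq_def)
  have last: "is_Eps (snd (last (std_seq m n)))" using mn by (simp add: std_seq_snoc)
  have "index_wt i - index_wt j \<in> roots m n \<inter> nonneg_comb (seq_simple (std_seq m n))"
    using positive_pair_nonneg_comb[OF std_seq_valid last len ij] root_pair_roots[OF ij(1)] by blast
  then show ?thesis
    unfolding pos_roots_def std_borel_def cartan_plus_def by (auto intro: hull_inc)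
qed

text \<open>An integer counterpart of \<open>real_eval\<close>; with \<open>rho f\<close> as first
  argument its value on a root is a difference of ranks.\<close>

definition linear_form :: "weight \<Rightarrow> weight \<Rightarrow> int" where
  "linear_form \<rho> \<alpha> = (\<Sum>c\<in>coords m n. \<rho> c * \<alpha> c)"

lemma finite_coords: "finite (coords m n)"
  by (simp add: coords_def)

lemma linear_form_add: "linear_form \<rho> (\<alpha> + \<beta>) = linear_form \<rho> \<alpha> + linear_form \<rho> \<beta>"
  by (simp add: linear_form_def sum.distrib algebra_simps)

lemma linear_form_diff: "linear_form \<rho> (\<alpha> - \<beta>) = linear_form \<rho> \<alpha> - linear_form \<rho> \<beta>"
  by (simp add: linear_form_def sum_subtractf algebra_simps)

lemma linear_form_index_wt:
  assumes "i < gdim m n"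
  shows "linear_form \<rho> (index_wt i) = index_eval \<rho> i"
proof -
  have "linear_form \<rho> (index_wt i) = (\<Sum>c\<in>coords m n. if c = index_coord i then index_eval \<rho> i else 0)"
    unfolding linear_form_def by (rule sum.cong) (auto simp: index_wt_def wscale_def basis_wt_def index_eval_def)
  then show ?thesis using index_coord_in_coords[OF assms] finite_coords by simp
qed

lemma linear_form_entry: "valid_entry x \<Longrightarrow> linear_form \<rho> (entry_wt x) = index_eval \<rho> (idx x)"
  using linear_form_index_wt[OF idx(1)] by (simp add: index_wt_idx)

lemma linear_form_seq_simple:
  assumes f: "valid_seq f" and len: "2 \<le> length f" and \<alpha>: "\<alpha> \<in> seq_simple f"
  shows "linear_form (rho f) \<alpha> > 0"
proof -
  have val: "linear_form (rho f) (entry_wt (f ! k)) = int (length f - k)" if "k < length f" for k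
    using linear_form_entry[of "f ! k"] valid_seq_entry[OF f, of "f ! k"] rank_nth[OF f that] that by simp
  consider k where "Suc k < length f" "\<alpha> = entry_wt (f ! k) - entry_wt (f ! Suc k)" |
    "\<alpha> = wscale 2 (entry_wt (last f))" | "\<alpha> = entry_wt (f ! (length f - 2)) + entry_wt (f ! (length f - 1))"
    using \<alpha> by (auto simp: seq_simple_def split: if_splits)
  then show ?thesis
  proof cases
    case 1
    then show ?thesis using val[of k] val[of "Suc k"] by (simp add: linear_form_diff)
  next
    case 2
    have *: "wscale 2 (entry_wt (last f)) = entry_wt (f ! (length f - 1)) + entry_wt (f ! (length f - 1))"
      using len by (subst (1) last_conv_nth) (auto simp: wscale_def)
    show ?thesis unfolding 2 * linear_form_add using val[of "length f - 1"] len by simp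
  next
    case 3
    show ?thesis unfolding 3 linear_form_add using val[of "length f - 1"] val[of "length f - 2"] len by simp
  qed
qed

lemma real_eval_add: "real_eval m n \<phi> (\<alpha> + \<beta>) = real_eval m n \<phi> \<alpha> + real_eval m n \<phi> \<beta>"
  by (simp add: real_eval_def sum.distrib algebra_simps)

lemma real_eval_diff: "real_eval m n \<phi> (\<alpha> - \<beta>) = real_eval m n \<phi> \<alpha> - real_eval m n \<phi> \<beta>"
  by (simp add: real_eval_def sum_subtractf algebra_simps)

lemma finite_roots: "finite (roots m n)"
proof (rule finite_subset)
  show "roots m n \<subseteq> (\<lambda>(i, j). index_wt i - index_wt j) ` ({..<gdim m n} \<times> {..<gdim m n})"
    by (auto elim!: rootsE simp: root_pair_def)
qed simp

text \<open>The span could a priori contain further root spaces. It lies in the subspace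
  \<open>?W\<close> of matrices whose off-diagonal entries sit at pairs positive for \<phi>, and
  \<open>root_vec i j\<close> is in \<open>?W\<close> only if its root is positive.\<close>

lemma pos_roots_eq:
  assumes B: "B = cartan_plus m n {\<alpha> \<in> roots m n. real_eval m n \<phi> \<alpha> > 0}"
  shows "pos_roots m n B = {\<alpha> \<in> roots m n. real_eval m n \<phi> \<alpha> > 0}"
proof
  show "{\<alpha> \<in> roots m n. real_eval m n \<phi> \<alpha> > 0} \<subseteq> pos_roots m n B"
    unfolding B pos_roots_def cartan_plus_def by (auto intro: hull_inc)
  let ?N = "gdim m n" and ?ev = "\<lambda>p. real_eval m n \<phi> (index_wt p)"
  let ?W = "{A \<in> carrier_mat ?N ?N. \<forall>p<?N. \<forall>q<?N. A $$ (p, q) \<noteq> 0 \<longrightarrow> p = q \<or> ?ev q < ?ev p} :: complex mat set"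
  have W: "mat_subspace ?N ?W"
    unfolding mat_subspace_def
  proof (intro conjI ballI allI)
    fix A C assume "A \<in> ?W" "C \<in> ?W"
    then have c: "A \<in> carrier_mat ?N ?N" "C \<in> carrier_mat ?N ?N"
      and s: "\<And>p q. p < ?N \<Longrightarrow> q < ?N \<Longrightarrow> A $$ (p, q) \<noteq> 0 \<or> C $$ (p, q) \<noteq> 0 \<Longrightarrow> p = q \<or> ?ev q < ?ev p"
      by blast+
    have "p = q \<or> ?ev q < ?ev p" if "p < ?N" "q < ?N" "(A + C) $$ (p, q) \<noteq> 0" for p q
    proof -
      have "A $$ (p, q) \<noteq> 0 \<or> C $$ (p, q) \<noteq> 0" using that carrier_matD[OF c(2)] by auto
      then show ?thesis using s that by blast
    qed
    then show "A + C \<in> ?W" using c by auto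
  next
    fix k A assume "A \<in> ?W"
    then have c: "A \<in> carrier_mat ?N ?N"
      and s: "\<And>p q. p < ?N \<Longrightarrow> q < ?N \<Longrightarrow> A $$ (p, q) \<noteq> 0 \<Longrightarrow> p = q \<or> ?ev q < ?ev p"
      by blast+
    have "p = q \<or> ?ev q < ?ev p" if "p < ?N" "q < ?N" "(k \<cdot>\<^sub>m A) $$ (p, q) \<noteq> 0" for p q
    proof -
      have "A $$ (p, q) \<noteq> 0" using that carrier_matD[OF c] by auto
      then show ?thesis using s that by blast
    qed
    then show "k \<cdot>\<^sub>m A \<in> ?W" using c by auto
  qed auto
  have "cartan m n \<subseteq> ?W"
  proof
    fix H assume H: "H \<in> cartan m n"
    show "H \<in> ?W" using cartanD(2)[OF H] cartanD(3)[OF H] by blast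
  qed
  moreover have "root_space m n \<beta> \<subseteq> ?W" if \<beta>: "\<beta> \<in> roots m n" "real_eval m n \<phi> \<beta> > 0" for \<beta>
  proof
    fix A assume A: "A \<in> root_space m n \<beta>"
    have "A \<in> osp m n" using A by (simp add: root_space_def)
    then have c: "A \<in> carrier_mat ?N ?N"
      by (auto simp: osp_def intro: osp_homD(1) add_carrier_mat)
    have "?ev q < ?ev p" if "p < ?N" "q < ?N" "A $$ (p, q) \<noteq> 0" for p q
    proof -
      have "\<beta> = index_wt p - index_wt q" using \<beta>(1) by (intro root_space_support[OF _ A that]) (auto simp: roots_def)
      then show ?thesis using \<beta>(2) by (simp only: real_eval_diff)
    qed
    then show "A \<in> ?W" using c by blast
  qed
  ultimately have "B \<subseteq> ?W"
    unfolding B cartan_plus_def by (intro hull_minimal W) blast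
  show "pos_roots m n B \<subseteq> {\<alpha> \<in> roots m n. real_eval m n \<phi> \<alpha> > 0}"
  proof
    fix \<alpha> assume "\<alpha> \<in> pos_roots m n B"
    then have \<alpha>: "\<alpha> \<in> roots m n" "root_space m n \<alpha> \<subseteq> B" by (auto simp: pos_roots_def)
    obtain i j where ij: "root_pair i j" "\<alpha> = index_wt i - index_wt j" using rootsE[OF \<alpha>(1)] .
    have N: "i < ?N" "j < ?N" "i \<noteq> j" using ij(1) by (auto simp: root_pair_def)
    have "root_vec i j \<in> ?W" using root_vec_root_space[OF N(1,2)] ij(2) \<alpha>(2) \<open>B \<subseteq> ?W\<close> by blast
    moreover have "root_vec i j $$ (i, j) \<noteq> 0" using root_vec_diag_entry[of i j] ij(1) by simp
    ultimately have "?ev j < ?ev i" using N by blast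
    then have "real_eval m n \<phi> \<alpha> > 0" unfolding ij(2) real_eval_diff by simp
    then show "\<alpha> \<in> {\<alpha> \<in> roots m n. real_eval m n \<phi> \<alpha> > 0}" using \<alpha>(1) by blast
  qed
qed

text \<open>A positive root that is not simple is a sum of two positive roots with smaller
  \<phi>-values, and there are finitely many roots. So positivity of \<open>rho f\<close> spreads
  from the simple roots to every positive root of \<open>B\<close>.\<close>

lemma linear_form_pos_roots:
  assumes B: "borel_subalgebra m n B" and f: "valid_seq f" "2 \<le> length f" "simple_roots m n B = seq_simple f"
    and \<alpha>: "\<alpha> \<in> pos_roots m n B"
  shows "linear_form (rho f) \<alpha> > 0"
proof -
  obtain \<phi> where "B = cartan_plus m n {\<alpha> \<in> roots m n. real_eval m n \<phi> \<alpha> > 0}"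
    using B by (auto simp: borel_subalgebra_def)
  note pos = pos_roots_eq[OF this]
  let ?ev = "real_eval m n \<phi>" and ?P = "pos_roots m n B"
  have fin: "finite ?P" using finite_roots by (auto simp: pos_roots_def)
  show ?thesis
    using \<alpha>
  proof (induction "card {\<beta> \<in> ?P. ?ev \<beta> < ?ev \<alpha>}" arbitrary: \<alpha> rule: less_induct)
    case less
    show ?case
    proof (cases "\<alpha> \<in> simple_roots m n B")
      case True
      then show ?thesis using linear_form_seq_simple[OF f(1,2)] f(3) by simp
    next
      case False
      then obtain \<beta> \<gamma> where *: "\<beta> \<in> ?P" "\<gamma> \<in> ?P" "\<alpha> = \<beta> + \<gamma>"
        using less.prems by (auto simp: simple_roots_def)
      have "?ev \<beta> > 0" "?ev \<gamma> > 0" using * pos by auto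
      then have lt: "?ev \<beta> < ?ev \<alpha>" "?ev \<gamma> < ?ev \<alpha>"
        unfolding *(3) real_eval_add by simp_all
      have "linear_form (rho f) \<delta> > 0" if "\<delta> \<in> ?P" "?ev \<delta> < ?ev \<alpha>" for \<delta>
      proof (rule less.hyps[OF _ that(1)])
        have "{\<beta> \<in> ?P. ?ev \<beta> < ?ev \<delta>} \<subset> {\<beta> \<in> ?P. ?ev \<beta> < ?ev \<alpha>}" using that by auto
        then show "card {\<beta> \<in> ?P. ?ev \<beta> < ?ev \<delta>} < card {\<beta> \<in> ?P. ?ev \<beta> < ?ev \<alpha>}"
          using fin by (intro psubset_card_mono) auto
      qed
      then show ?thesis using *(1,2) lt unfolding *(3) linear_form_add by (simp add: add_pos_pos)
    qed
  qed
qed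

lemma valid_seq_of_admissible: "admissible_seq m n f \<Longrightarrow> valid_seq f"
  by (simp add: admissible_seq_def valid_seq_def)

end

section \<open>From extremal weights to highest weights\<close>

context osp_module begin

text \<open>Root vectors for positive roots of \<open>B\<close> are strictly triangular for the
  order of \<open>f\<close> and thus kill the singular vector; irreducibility makes that vector a
  generator.\<close>

lemma highest_weight_of_extremal:
  assumes irr: "osp_irreducible m n sc gr act"
    and B: "borel_subalgebra m n B" and f: "valid_seq f" "2 \<le> length f" "simple_roots m n B = seq_simple f"
    and ex: "extremal (index_eval (rho f)) \<mu>"
  shows "highest_weight m n sc gr act B \<mu>"
proof -
  obtain v where v: "v \<noteq> 0" "\<exists>a. v \<in> gr a" "has_weight \<mu> v" "singular (index_eval (rho f)) v"
    using ex by (auto simp: extremal_def)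
  have "act A v = 0" if \<alpha>: "\<alpha> \<in> pos_roots m n B" and A: "A \<in> root_space m n \<alpha>" for \<alpha> A
  proof -
    obtain A0 A1 where *: "A = A0 + A1" "A0 \<in> osp_hom m n False" "A1 \<in> osp_hom m n True"
      using A by (auto simp: root_space_def osp_def)
    note c = osp_homD(1)[OF *(2)] osp_homD(1)[OF *(3)]
    have root: "\<alpha> \<in> roots m n" using \<alpha> by (simp add: pos_roots_def)
    have supp: "index_eval (rho f) q < index_eval (rho f) p" if pq: "p < gdim m n" "q < gdim m n"
      and nz: "A0 $$ (p, q) \<noteq> 0 \<or> A1 $$ (p, q) \<noteq> 0" for p q
    proof -
      have sum: "A $$ (p, q) = A0 $$ (p, q) + A1 $$ (p, q)"
        using pq carrier_matD[OF c(2)] by (simp add: *(1))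
      \<comment> \<open>The two components live on positions of different parity, so neither can
        cancel the other in \<open>A\<close>.\<close>
      have "A0 $$ (p, q) = 0 \<or> A1 $$ (p, q) = 0"
        using osp_homD(3)[OF *(2) pq] osp_homD(3)[OF *(3) pq] by blast
      then have "A $$ (p, q) \<noteq> 0" using sum nz by auto
      then have "\<alpha> = index_wt p - index_wt q"
        using root by (intro root_space_support[OF _ A pq]) (auto simp: roots_def)
      moreover have "linear_form (rho f) \<alpha> > 0" using linear_form_pos_roots[OF B f \<alpha>] .
      ultimately show ?thesis using pq by (simp only: linear_form_diff linear_form_index_wt)
    qed
    have "act A0 v = 0" "act A1 v = 0"
      using singular_upper[OF v(4) *(2)] singular_upper[OF v(4) *(3)] supp by (auto simp: upper_def)
    moreover have "act A v = act A0 v + act A1 v"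
      unfolding *(1) using * osp_hom_subset_osp by (intro act_add) auto
    ultimately show ?thesis by simp
  qed
  moreover have "W = UNIV" if "osp_submodule m n sc gr act W" "v \<in> W" for W
    using irr that v(1) by (auto simp: osp_irreducible_def)
  ultimately show ?thesis
    unfolding highest_weight_def using v by (auto simp: has_weight_def)
qed

lemma extremal_std:
  assumes mn: "1 \<le> m" "1 \<le> n" and hw: "highest_weight m n sc gr act (std_borel m n) \<mu>"
  shows "extremal (index_eval (rho (std_seq m n))) \<mu>"
proof -
  obtain v where v: "v \<noteq> 0" "\<exists>a. v \<in> gr a" "\<forall>H\<in>cartan m n. act H v = sc (wt_eval m n \<mu> H) v"
    "\<forall>\<alpha>\<in>pos_roots m n (std_borel m n). \<forall>A\<in>root_space m n \<alpha>. act A v = 0"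
    using hw by (auto simp: highest_weight_def)
  have "singular (index_eval (rho (std_seq m n))) v"
    unfolding singular_def
  proof (intro allI impI)
    fix i j assume ij: "root_pair i j \<and> index_eval (rho (std_seq m n)) j < index_eval (rho (std_seq m n)) i"
    then have "i < gdim m n" "j < gdim m n" by (auto simp: root_pair_def)
    then show "act (root_vec i j) v = 0"
      using v(4) positive_pair_std_borel[OF mn] ij root_vec_root_space by blast
  qed
  then show ?thesis unfolding extremal_def has_weight_def using v by blast
qed

lemma negatives_std: "negatives (std_seq m n) = {}"
  by (auto simp: negatives_def std_seq_def)

lemma hooked_even:
  assumes mn: "1 \<le> m" "1 \<le> n" and lam: "is_partition lam"
    and irr: "osp_irreducible m n sc gr act"
    and hw: "highest_weight m n sc gr act (std_borel m n) (lam_sharp m n lam)"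
    and f: "valid_seq f" "even (neg_eps f)"
  shows "extremal (index_eval (rho f)) (frob_weight lam 0 0 f)"
proof -
  have "hooked lam (std_seq m n)"
    using extremal_std[OF mn hw] std_seq_valid by (simp add: hooked_def frob_weight_std_seq[OF lam])
  moreover have "even (card {c \<in> toggle (negatives (std_seq m n)) (negatives f). is_Eps c})"
    using f neg_eps_card[of f] by (simp add: negatives_std toggle_def valid_seq_def)
  ultimately have "hooked lam f" using hooked_all[OF irr lam _ f(1)] by blast
  then show ?thesis by (simp add: hooked_def)
qed

text \<open>The starting point \<open>?g\<close> is the standard sequence with its last sign
  changed. This leaves the positive roots alone, so the given highest weight is extremal for
  \<open>?g\<close>, which has exactly one negative \<epsilon>.\<close>

lemma hooked_odd:
  assumes mn: "1 \<le> m" "1 \<le> n" and lam: "is_partition lam"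
    and irr: "osp_irreducible m n sc gr act"
    and hw: "highest_weight m n sc gr act (std_borel m n) (lam_sharp_minus m n lam)"
    and f: "valid_seq f" "odd (neg_eps f)"
  shows "extremal (index_eval (rho f)) (frob_weight lam 0 0 f)"
proof -
  let ?g = "std_front m n @ [flip (1, Eps m)]"
  have std: "std_seq m n = std_front m n @ [(1, Eps m)]" by (rule std_seq_snoc[OF mn(1)])
  have g: "valid_seq ?g" using valid_seq_flip[of "std_front m n" "(1, Eps m)" "[]"] std_seq_valid std by simp
  have "extremal (index_eval (rho ?g)) (lam_sharp_minus m n lam)"
    using extremal_flip_last_Eps[of "std_front m n" "(1, Eps m)"] extremal_std[OF mn hw] std_seq_valid
    by (simp add: std)
  then have "hooked lam ?g"
    using g frob_weight_std_seq_flip[OF lam mn(1), of n] by (simp add: hooked_def)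
  moreover have "even (card {c \<in> toggle (negatives ?g) (negatives f). is_Eps c})"
  proof -
    have "(- 1, c) \<notin> set (std_front m n)" for c
      by (auto simp: std_front_def)
    then have "negatives ?g = {Eps m}"
      unfolding negatives_def flip_def set_append by simp
    \<comment> \<open>Toggling the single coordinate \<open>Eps m\<close> changes the number of
      negative \<epsilon>-entries of \<open>f\<close> by one, from odd to even.\<close>
    then have eq: "{c \<in> toggle (negatives ?g) (negatives f). is_Eps c} =
      (if Eps m \<in> negatives f then {c \<in> negatives f. is_Eps c} - {Eps m}
       else insert (Eps m) {c \<in> negatives f. is_Eps c})"
      unfolding \<open>negatives ?g = {Eps m}\<close> toggle_def by (cases "Eps m \<in> negatives f") auto
    have "finite (negatives f)"
      by (rule finite_subset[of _ "snd ` set f"]) (force simp: negatives_def)+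
    moreover have "odd (card {c \<in> negatives f. is_Eps c})"
      using f neg_eps_card[of f] by (simp add: valid_seq_def)
    ultimately show ?thesis
      unfolding eq by (auto simp: card_Diff_singleton elim: oddE)
  qed
  ultimately have "hooked lam f" using hooked_all[OF irr lam _ f(1)] by blast
  then show ?thesis by (simp add: hooked_def)
qed

end

text \<open>If the last entry were a \<delta>, twice that entry would be a long simple root.\<close>

lemma vee_shape_last:
  assumes "encodes m n f B" "vee_shape m n B" "f \<noteq> []"
  shows "is_Eps (snd (last f))"
proof (rule ccontr)
  assume "\<not> ?thesis"
  then obtain i where i: "snd (last f) = Del i" by (cases "snd (last f)") auto
  have f: "snd ` set f = coords m n" "fst ` set f \<subseteq> {1, - 1}" "simple_roots m n B = seq_simple f"
    using assms(1) by (auto simp: encodes_def admissible_seq_def)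
  have mem: "last f \<in> set f" using assms(3) by simp
  then have "Del i \<in> coords m n" using f(1) i by (metis imageI)
  then have "i \<in> {1..n}" by (auto simp: coords_def)
  moreover have "fst (last f) = 1 \<or> fst (last f) = - 1" using mem f(2) by auto
  moreover have "wscale 2 (entry_wt (last f)) = wscale (2 * fst (last f)) (basis_wt (Del i))"
    by (simp add: entry_wt_def i wscale_def fun_eq_iff)
  ultimately have "wscale 2 (entry_wt (last f)) \<in> long_roots n"
    unfolding long_roots_def by force
  moreover have "wscale 2 (entry_wt (last f)) \<in> seq_simple f" using i by (simp add: seq_simple_def)
  ultimately show False using assms(2) f(3) by (auto simp: vee_shape_def)
qed

theorem theorem6p9:
  fixes m n :: nat
    and lam :: "nat \<Rightarrow> nat"
    and B :: "complex mat set"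
    and f :: "entry list"
    and sc :: "complex \<Rightarrow> 'v::ab_group_add \<Rightarrow> 'v"
    and gr :: "bool \<Rightarrow> 'v set"
    and act :: "complex mat \<Rightarrow> 'v \<Rightarrow> 'v"
  assumes "1 \<le> m" and "1 \<le> n"
    and "hook_partition n m lam"
    and "borel_subalgebra m n B"
    and "encodes m n f B"
  shows "(vee_shape m n B \<longrightarrow>
            (is_L m n sc gr act (lam_sharp m n lam) \<longrightarrow>
               highest_weight m n sc gr act B (lam_borel m n lam f)) \<and>
            (is_L m n sc gr act (lam_sharp_minus m n lam) \<longrightarrow>
               highest_weight m n sc gr act B (lam_borel_minus m n lam f))) \<and>
         (bar_shape m n B \<longrightarrow>
            (seq_sign m f = 1 \<longrightarrow> is_L m n sc gr act (lam_sharp m n lam) \<longrightarrow>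
               highest_weight m n sc gr act B (lam_borel m n lam f)) \<and>
            (seq_sign m f = -1 \<longrightarrow> is_L m n sc gr act (lam_sharp_minus m n lam) \<longrightarrow>
               highest_weight m n sc gr act B (lam_borel m n lam f)))"
proof -
  interpret osp_indices m n .
  have f: "valid_seq f" and simple: "simple_roots m n B = seq_simple f" and adm: "admissible_seq m n f"
    using assms(5) by (auto simp: encodes_def valid_seq_of_admissible)
  note de = valid_seq_dels_epss[OF f]
  have len: "2 \<le> length f" using de(3) assms(1,2) by simp
  have lam: "is_partition lam" using assms(3) by (simp add: hook_partition_def)
  have L: "osp_module m n sc gr act" "osp_irreducible m n sc gr act"
    "highest_weight m n sc gr act (std_borel m n) \<mu>" if "is_L m n sc gr act \<mu>" for \<mu>
    using that by (simp_all add: is_L_def)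
  have B: "highest_weight m n sc gr act B \<mu>"
    if "is_L m n sc gr act \<nu>" "osp_module.extremal m n sc gr act (index_eval (rho f)) \<mu>" for \<mu> \<nu>
    using osp_module.highest_weight_of_extremal[OF L(1,2)[OF that(1)] assms(4) f len simple that(2)] .
  have even: "highest_weight m n sc gr act B (lam_borel m n lam f)"
    if "is_L m n sc gr act (lam_sharp m n lam)" "even (neg_eps f)"
    using B[OF that(1) osp_module.hooked_even[OF L(1)[OF that(1)] assms(1,2) lam L(2,3)[OF that(1)] f that(2)]]
      lam_borel_eq_frob_weight[of f lam] de by simp
  have odd: "highest_weight m n sc gr act B (lam_borel m n lam f)"
    if "is_L m n sc gr act (lam_sharp_minus m n lam)" "odd (neg_eps f)"
    using B[OF that(1) osp_module.hooked_odd[OF L(1)[OF that(1)] assms(1,2) lam L(2,3)[OF that(1)] f that(2)]]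
      lam_borel_eq_frob_weight[of f lam] de by simp
  have sign: "seq_sign m f = (- 1) ^ neg_eps f"
    using seq_sign_eq[of f] f de by (simp add: valid_seq_def)
  \<comment> \<open>The normalisation of the undetermined last sign in \<open>admissible_seq\<close>
    supplies the even parity.\<close>
  have last: "is_Eps (snd (last f))" "even (neg_eps f)" if "vee_shape m n B"
  proof -
    have "f \<noteq> []" using len by auto
    then show last: "is_Eps (snd (last f))" by (rule vee_shape_last[OF assms(5) that])
    have "neg_eps f = card {k. k < length f \<and> is_Eps (snd (f ! k)) \<and> fst (f ! k) = - 1}"
      unfolding neg_eps_def by (rule length_filter_conv_card)
    then show "even (neg_eps f)" using adm last by (simp add: admissible_seq_def)
  qed
  \<comment> \<open>With its last sign changed the sequence has an odd number of negative
    \<epsilon>-entries, so \<open>hooked_odd\<close> applies. Changing the sign back preserves the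
    positive roots and hence the extremal weight, which in terms of \<open>f\<close> is
    \<open>lam_borel_minus\<close>.\<close>
  have minus: "highest_weight m n sc gr act B (lam_borel_minus m n lam f)"
    if Lm: "is_L m n sc gr act (lam_sharp_minus m n lam)" and vee: "vee_shape m n B"
  proof -
    interpret osp_module m n sc gr act by (rule L(1)[OF Lm])
    have "f \<noteq> []" using len by auto
    then obtain h x where hx: "f = h @ [x]" by (metis append_butlast_last_id)
    have x: "is_Eps (snd x)" using last(1)[OF vee] hx by simp
    have vh: "valid_seq (h @ [flip x])" using valid_seq_flip[of h x "[]"] f hx by simp
    have "fst x = 1 \<or> fst x = - 1" using f hx by (auto simp: valid_seq_def)
    then have "odd (neg_eps (h @ [flip x]))"
      using last(2)[OF vee] x by (auto simp: neg_eps_def hx)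
    then have "extremal (index_eval (rho (h @ [flip x]))) (frob_weight lam 0 0 (h @ [flip x]))"
      by (rule hooked_odd[OF assms(1,2) lam L(2,3)[OF Lm] vh])
    moreover have "flip (flip x) = x" by (simp add: flip_def)
    ultimately have "extremal (index_eval (rho f)) (frob_weight lam 0 0 (h @ [flip x]))"
      using extremal_flip_last_Eps[OF vh] x hx by simp
    then show ?thesis
      using B[OF Lm] lam_borel_minus_eq_frob_weight[OF x, of h lam] de hx by simp
  qed
  have "even (neg_eps f)" if "seq_sign m f = 1" using that sign by (cases "even (neg_eps f)") auto
  moreover have "odd (neg_eps f)" if "seq_sign m f = - 1" using that sign by (cases "even (neg_eps f)") auto
  ultimately show ?thesis using even odd minus last(2) by blast
qed

end
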